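(* Let $M^2$ be a smooth connected $2$-manifold and let $f:M^2\to H^3$ (resp. $f:M^2\to S^3_1$) be a co-orientable linear Weingarten front of Bryant type (having at least one regular point; in the case of $S^3_1$, this is required of its unit normal field viewed as a front in $H^3$). Then $M^2$ is orientable. Moreover, the zig-zag representation $\sigma_f:\pi_1(M^2)\to\mathbb{Z}$ is trivial.
   Context: $\mathbb{R}^4_1$ is Lorentz-Minkowski $4$-space with $\langle x,y\rangle=-x_0y_0+x_1y_1+x_2y_2+x_3y_3$; $H^3=\{x:\langle x,x\rangle=-1,\ x_0>0\}$ and $S^3_1=\{x:\langle x,x\rangle=1\}$. Fronts. A $C^\infty$ map $f:M^2\to N^3$ is a (wave) front if it lifts to a Legendrian immersion $L_f:M^2\to P(T^*N^3)$ into the projectified cotangent bundle with its canonical contact structure, and it is co-orientable if $L_f$ lifts to a $C^\infty$ map into $T^*N^3$. A co-orientable front $f:M^2\to H^3$ has a globally defined unit normal field $\nu:M^2\to S^3_1$ with $\langle f,\nu\rangle=\langle df,\nu\rangle=0$, and $(f,\nu)$ is an immersion. A front in $S^3_1$ is spacelike if the plane orthogonal to its normal direction is spacelike at each point. Exchanging roles, $\nu$ is a spacelike co-orientable front in $S^3_1$ with unit normal $f$; conversely a spacelike co-orientable front in $S^3_1$ has a unit normal field which is a front in $H^3$ or in $-H^3$ (and is taken in $H^3$ after a change of sign). A point is regular if the map is an immersion there. The parallel fronts of $f$ (defined on open sets $U$ carrying a unit normal $\nu$) are $f_{U,\delta}=(\cosh\delta)f+(\sinh\delta)\nu$, $\delta\in\mathbb{R}$.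 Linear Weingarten fronts of Bryant type. For an immersion into $H^3$ with unit normal $\nu$, the principal curvatures are determined by $d\nu=-df\circ A$, $H$ is the mean curvature $(\kappa_1+\kappa_2)/2$ and $K=\kappa_1\kappa_2-1$ is the Gaussian curvature. An immersion is horospherical linear Weingarten if $a(H-1)+bK=0$ for some unit normal and some real constants $a,b$ with $a^2+b^2\ne0$. A front $f:M^2\to H^3$ is a horospherical linear Weingarten front if each $p\in M^2$ has a co-orientable neighborhood $U$ and a $\delta_0\in\mathbb{R}$ such that $f_{U,\delta_0}$ is a horospherical linear Weingarten immersion. For $\varepsilon\in\mathbb{R}$, $W_\varepsilon(M^2)$ is the set of horospherical linear Weingarten fronts $f:M^2\to H^3$ satisfying $2\varepsilon(H-1)+(1-\varepsilon)K=0$ on the regular set (for $\varepsilon=0$: flat fronts). A linear Weingarten front of Bryant type in $H^3$ is an element of $\bigcup_{\varepsilon\in\mathbb{R}}W_\varepsilon(M^2)$. A co-orientable linear Weingarten front of Bryant type in $S^3_1$ is a spacelike co-orientable front in $S^3_1$ whose unit normal field in $H^3$ is a linear Weingarten front of Bryant type. Zig-zag representation. For a co-orientable front $f$ with unit normal $\nu$, let $E_p=\{v\in\mathbb{R}^4_1: \langle v,f(p)\rangle=\langle v,\nu(p)\rangle=0\}$, a Euclidean plane. Both $df_p$ and $d\nu_p$ map $T_pM^2$ into $E_p$, and $\langle df(X),d\nu(Y)\rangle$ is symmetric in $X,Y$. With respect to any basis of $T_pM^2$ and any orthonormal basis of $E_p$, the number $\det(df_p+i\,d\nu_p)\in\mathbb{C}$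 is nonzero, and $$m(p):=\frac{\det(df_p+i\,d\nu_p)^2}{|\det(df_p+i\,d\nu_p)|^2}\in U(1)$$ is independent of the bases. This gives a homomorphism $m_*:\pi_1(M^2)\to\pi_1(U(1))=\mathbb{Z}$ (the Maslov class of the Legendrian immersion, i.e. the signed count of cuspidal edges crossed by a generic loop). The zig-zag representation $\sigma_f$ is, up to sign, one half of this homomorphism (it is integer valued on orientable $M^2$): along a generic loop the zig and zag cusps form a cyclic word, reduced to $(\text{zig zag})^k$ by cancelling adjacent equal letters, and $\sigma_f$ records $k$. It is invariant under deformations through fronts, and $\sigma_f$ and $\sigma_\nu$ agree (up to sign convention). *)

theory Defs
  imports "HOL-Complex_Analysis.Complex_Analysis" "HOL-Algebra.Group"
begin

section \<open>Smooth surfaces\<close>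

text \<open>Both notions are meant for open \<open>S\<close>.\<close>

primrec Ck_on :: "nat \<Rightarrow> 'a::euclidean_space set \<Rightarrow> ('a \<Rightarrow> 'b::real_normed_vector) \<Rightarrow> bool" where
  "Ck_on 0 S f = continuous_on S f"
| "Ck_on (Suc k) S f = ((\<forall>x\<in>S. f differentiable (at x)) \<and>
     (\<forall>v. Ck_on k S (\<lambda>x. frechet_derivative f (at x) v)))"

definition smooth_on :: "'a::euclidean_space set \<Rightarrow> ('a \<Rightarrow> 'b::real_normed_vector) \<Rightarrow> bool" where
  "smooth_on S f \<longleftrightarrow> (\<forall>k. Ck_on k S f)"

text \<open>A chart is a pair of an open set and a map that matters only on that set.\<close>

type_synonym 'a chart = "'a set \<times> ('a \<Rightarrow> real^2)"
type_synonym 'a atlas = "'a chart set"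

definition transition :: "'a chart \<Rightarrow> 'a chart \<Rightarrow> real^2 \<Rightarrow> real^2" where
  "transition c d = snd d \<circ> inv_into (fst c) (snd c)"

definition is_chart :: "'a topology \<Rightarrow> 'a chart \<Rightarrow> bool" where
  "is_chart M c \<longleftrightarrow> openin M (fst c) \<and> open (snd c ` fst c) \<and>
     homeomorphic_map (subtopology M (fst c)) (top_of_set (snd c ` fst c)) (snd c)"

definition smooth_atlas :: "'a topology \<Rightarrow> 'a atlas \<Rightarrow> bool" where
  "smooth_atlas M A \<longleftrightarrow> (\<forall>c\<in>A. is_chart M c) \<and> (\<Union>c\<in>A. fst c) = topspace M \<and>
     (\<forall>c\<in>A. \<forall>d\<in>A. smooth_on (snd c ` (fst c \<inter> fst d)) (transition c d))"

definition smooth_surface :: "'a topology \<Rightarrow> 'a atlas \<Rightarrow> bool" where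
  "smooth_surface M A \<longleftrightarrow> Hausdorff_space M \<and> second_countable M \<and> smooth_atlas M A"

text \<open>The atlas \<open>A\<close> need not be maximal, so the oriented atlas \<open>B\<close> is only required to be
  compatible with it.\<close>

definition orientable_surface :: "'a topology \<Rightarrow> 'a atlas \<Rightarrow> bool" where
  "orientable_surface M A \<longleftrightarrow> (\<exists>B. smooth_atlas M B \<and> smooth_atlas M (A \<union> B) \<and>
     (\<forall>c\<in>B. \<forall>d\<in>B. \<forall>p \<in> fst c \<inter> fst d.
        det (matrix (frechet_derivative (transition c d) (at (snd c p)))) > 0))"

definition smooth_map_on :: "'a atlas \<Rightarrow> 'a set \<Rightarrow> ('a \<Rightarrow> 'b::real_normed_vector) \<Rightarrow> bool" where
  "smooth_map_on A U f \<longleftrightarrow>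
     (\<forall>c\<in>A. smooth_on (snd c ` (fst c \<inter> U)) (f \<circ> inv_into (fst c) (snd c)))"

text \<open>The tangent space at \<open>p\<close> is identified with the plane by a preferred chart around \<open>p\<close>; all
  notions below that are built from differentials do not depend on this choice.\<close>

definition chart_at :: "'a atlas \<Rightarrow> 'a \<Rightarrow> 'a chart" where
  "chart_at A p = (SOME c. c \<in> A \<and> p \<in> fst c)"

definition differential :: "'a atlas \<Rightarrow> ('a \<Rightarrow> 'b::real_normed_vector) \<Rightarrow> 'a \<Rightarrow> real^2 \<Rightarrow> 'b" where
  "differential A f p = (let c = chart_at A p in
     frechet_derivative (f \<circ> inv_into (fst c) (snd c)) (at (snd c p)))"

definition regular_point :: "'a atlas \<Rightarrow> ('a \<Rightarrow> 'b::real_normed_vector) \<Rightarrow> 'a \<Rightarrow> bool" where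
  "regular_point A f p \<longleftrightarrow> inj (differential A f p)"

definition tangent_basis :: "(2 \<Rightarrow> real^2) \<Rightarrow> bool" where
  "tangent_basis b \<longleftrightarrow> inj b \<and> independent (range b)"


section \<open>Lorentz-Minkowski space\<close>

definition mink :: "real^4 \<Rightarrow> real^4 \<Rightarrow> real" where
  "mink x y = - (x$0 * y$0) + x$1 * y$1 + x$2 * y$2 + x$3 * y$3"

definition H3 :: "(real^4) set" where
  "H3 = {x. mink x x = -1 \<and> x$0 > 0}"

definition S31 :: "(real^4) set" where
  "S31 = {x. mink x x = 1}"


section \<open>Fronts\<close>

text \<open>Below, \<open>N\<close> is \<^const>\<open>H3\<close> or \<^const>\<open>S31\<close>, whose tangent space at \<open>x\<close> is the
  \<^const>\<open>mink\<close>-orthogonal complement of \<open>x\<close>. The (possibly indefinite) metric of \<open>N\<close> identifies a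
  nonzero covector with a nonzero tangent vector \<open>n\<close>, and a point of the projectified cotangent
  bundle over \<open>x\<close> with the line spanned by \<open>n\<close>; the canonical contact structure becomes the
  condition that \<open>n\<close> is orthogonal to the differential of the base point.\<close>

definition conormal_field :: "'a atlas \<Rightarrow> 'a set \<Rightarrow> ('a \<Rightarrow> real^4) \<Rightarrow> ('a \<Rightarrow> real^4) \<Rightarrow> bool" where
  "conormal_field A U f n \<longleftrightarrow> smooth_map_on A U n \<and>
     (\<forall>p\<in>U. n p \<noteq> 0 \<and> mink (f p) (n p) = 0 \<and> (\<forall>X. mink (differential A f p X) (n p) = 0))"

definition represents :: "'a set \<Rightarrow> ('a \<Rightarrow> real^4) \<Rightarrow> ('a \<Rightarrow> (real^4) set) \<Rightarrow> bool" where
  "represents U n L \<longleftrightarrow> (\<forall>p\<in>U. L p = span {n p})"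

text \<open>\<open>front M A N f L\<close>: the map \<open>p \<mapsto> (f p, L p)\<close> is a Legendrian immersion lifting \<open>f\<close>. The last
  condition says that the differential of \<open>(f, [n])\<close> is injective.\<close>

definition front ::
  "'a topology \<Rightarrow> 'a atlas \<Rightarrow> (real^4) set \<Rightarrow> ('a \<Rightarrow> real^4) \<Rightarrow> ('a \<Rightarrow> (real^4) set) \<Rightarrow> bool" where
  "front M A N f L \<longleftrightarrow> smooth_map_on A (topspace M) f \<and> f ` topspace M \<subseteq> N \<and>
     (\<forall>p\<in>topspace M. \<exists>U n. openin M U \<and> p \<in> U \<and> conormal_field A U f n \<and> represents U n L \<and>
        (\<forall>q\<in>U. \<forall>X. differential A f q X = 0 \<and> differential A n q X \<in> span {n q} \<longrightarrow> X = 0))"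

definition coorientable_front ::
  "'a topology \<Rightarrow> 'a atlas \<Rightarrow> (real^4) set \<Rightarrow> ('a \<Rightarrow> real^4) \<Rightarrow> ('a \<Rightarrow> (real^4) set) \<Rightarrow> bool" where
  "coorientable_front M A N f L \<longleftrightarrow> front M A N f L \<and>
     (\<exists>n. conormal_field A (topspace M) f n \<and> represents (topspace M) n L)"

definition spacelike_front ::
  "'a topology \<Rightarrow> 'a atlas \<Rightarrow> ('a \<Rightarrow> real^4) \<Rightarrow> ('a \<Rightarrow> (real^4) set) \<Rightarrow> bool" where
  "spacelike_front M A f L \<longleftrightarrow> front M A S31 f L \<and>
     (\<forall>p\<in>topspace M. \<forall>v. v \<noteq> 0 \<and> mink (f p) v = 0 \<and> (\<forall>n\<in>L p. mink n v = 0) \<longrightarrow> mink v v > 0)"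

text \<open>The target \<open>Q\<close> of a unit normal field is \<^const>\<open>S31\<close> for maps into \<^const>\<open>H3\<close>, and
  \<^const>\<open>H3\<close> for spacelike fronts in \<^const>\<open>S31\<close>.\<close>

definition unit_normal ::
  "'a atlas \<Rightarrow> (real^4) set \<Rightarrow> 'a set \<Rightarrow> ('a \<Rightarrow> real^4) \<Rightarrow> ('a \<Rightarrow> real^4) \<Rightarrow> bool" where
  "unit_normal A Q U f n \<longleftrightarrow> conormal_field A U f n \<and> n ` U \<subseteq> Q"

definition parallel_front :: "('a \<Rightarrow> real^4) \<Rightarrow> ('a \<Rightarrow> real^4) \<Rightarrow> real \<Rightarrow> 'a \<Rightarrow> real^4" where
  "parallel_front f n \<delta> = (\<lambda>p. cosh \<delta> *\<^sub>R f p + sinh \<delta> *\<^sub>R n p)"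


section \<open>Linear Weingarten fronts of Bryant type\<close>

definition shape_operator ::
  "'a atlas \<Rightarrow> ('a \<Rightarrow> real^4) \<Rightarrow> ('a \<Rightarrow> real^4) \<Rightarrow> 'a \<Rightarrow> real^2 \<Rightarrow> real^2" where
  "shape_operator A f n p =
     (THE S. linear S \<and> (\<forall>X. differential A n p X = - differential A f p (S X)))"

text \<open>The shape operator is self-adjoint, hence diagonalizable, so the pair of principal curvatures
  exists and is unique up to order.\<close>

definition principal_curvatures ::
  "'a atlas \<Rightarrow> ('a \<Rightarrow> real^4) \<Rightarrow> ('a \<Rightarrow> real^4) \<Rightarrow> 'a \<Rightarrow> real \<Rightarrow> real \<Rightarrow> bool" where
  "principal_curvatures A f n p \<kappa>\<^sub>1 \<kappa>\<^sub>2 \<longleftrightarrow> (\<exists>b. tangent_basis b \<and>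
     shape_operator A f n p (b 1) = \<kappa>\<^sub>1 *\<^sub>R b 1 \<and> shape_operator A f n p (b 2) = \<kappa>\<^sub>2 *\<^sub>R b 2)"

definition mean_curvature :: "'a atlas \<Rightarrow> ('a \<Rightarrow> real^4) \<Rightarrow> ('a \<Rightarrow> real^4) \<Rightarrow> 'a \<Rightarrow> real" where
  "mean_curvature A f n p =
     (THE h. \<exists>\<kappa>\<^sub>1 \<kappa>\<^sub>2. principal_curvatures A f n p \<kappa>\<^sub>1 \<kappa>\<^sub>2 \<and> h = (\<kappa>\<^sub>1 + \<kappa>\<^sub>2) / 2)"

definition gauss_curvature :: "'a atlas \<Rightarrow> ('a \<Rightarrow> real^4) \<Rightarrow> ('a \<Rightarrow> real^4) \<Rightarrow> 'a \<Rightarrow> real" where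
  "gauss_curvature A f n p =
     (THE k. \<exists>\<kappa>\<^sub>1 \<kappa>\<^sub>2. principal_curvatures A f n p \<kappa>\<^sub>1 \<kappa>\<^sub>2 \<and> k = \<kappa>\<^sub>1 * \<kappa>\<^sub>2 - 1)"

definition horospherical_LW_immersion :: "'a atlas \<Rightarrow> 'a set \<Rightarrow> ('a \<Rightarrow> real^4) \<Rightarrow> bool" where
  "horospherical_LW_immersion A U g \<longleftrightarrow>
     smooth_map_on A U g \<and> g ` U \<subseteq> H3 \<and> (\<forall>p\<in>U. regular_point A g p) \<and>
     (\<exists>n a b. unit_normal A S31 U g n \<and> a\<^sup>2 + b\<^sup>2 \<noteq> 0 \<and>
        (\<forall>p\<in>U. a * (mean_curvature A g n p - 1) + b * gauss_curvature A g n p = 0))"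

definition horospherical_LW_front ::
  "'a topology \<Rightarrow> 'a atlas \<Rightarrow> ('a \<Rightarrow> real^4) \<Rightarrow> ('a \<Rightarrow> (real^4) set) \<Rightarrow> bool" where
  "horospherical_LW_front M A f L \<longleftrightarrow> front M A H3 f L \<and>
     (\<forall>p\<in>topspace M. \<exists>U n \<delta>\<^sub>0. openin M U \<and> p \<in> U \<and>
        unit_normal A S31 U f n \<and> represents U n L \<and>
        horospherical_LW_immersion A U (parallel_front f n \<delta>\<^sub>0))"

text \<open>Fronts here need not be co-orientable and the sign of the mean curvature depends on the unit
  normal, so the equation is required for a suitable unit normal near each regular point.\<close>

definition W ::
  "'a topology \<Rightarrow> 'a atlas \<Rightarrow> real \<Rightarrow> (('a \<Rightarrow> real^4) \<times> ('a \<Rightarrow> (real^4) set)) set" where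
  "W M A \<epsilon> = {(f, L). horospherical_LW_front M A f L \<and>
     (\<forall>p\<in>topspace M. regular_point A f p \<longrightarrow> (\<exists>U n. openin M U \<and> p \<in> U \<and>
        unit_normal A S31 U f n \<and> represents U n L \<and>
        (\<forall>q\<in>U. regular_point A f q \<longrightarrow>
           2 * \<epsilon> * (mean_curvature A f n q - 1) + (1 - \<epsilon>) * gauss_curvature A f n q = 0)))}"

definition bryant_type_H3 ::
  "'a topology \<Rightarrow> 'a atlas \<Rightarrow> ('a \<Rightarrow> real^4) \<Rightarrow> ('a \<Rightarrow> (real^4) set) \<Rightarrow> bool" where
  "bryant_type_H3 M A f L \<longleftrightarrow> (f, L) \<in> (\<Union>\<epsilon>. W M A \<epsilon>)"

text \<open>The unit normal \<open>n\<close> with values in \<^const>\<open>H3\<close> is unique; regarded as a front in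
  \<^const>\<open>H3\<close> it has unit normal \<open>f\<close>.\<close>

definition coorientable_bryant_type_S31 ::
  "'a topology \<Rightarrow> 'a atlas \<Rightarrow> ('a \<Rightarrow> real^4) \<Rightarrow> ('a \<Rightarrow> (real^4) set) \<Rightarrow> bool" where
  "coorientable_bryant_type_S31 M A f L \<longleftrightarrow> coorientable_front M A S31 f L \<and> spacelike_front M A f L \<and>
     (\<exists>n. unit_normal A H3 (topspace M) f n \<and> represents (topspace M) n L \<and>
        bryant_type_H3 M A n (\<lambda>p. span {f p}))"


section \<open>The zig-zag representation\<close>

definition loops :: "'a topology \<Rightarrow> 'a \<Rightarrow> (real \<Rightarrow> 'a) set" where
  "loops M x = {\<gamma>. pathin M \<gamma> \<and> \<gamma> 0 = x \<and> \<gamma> 1 = x}"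

definition loop_homotopy :: "'a topology \<Rightarrow> 'a \<Rightarrow> ((real \<Rightarrow> 'a) \<times> (real \<Rightarrow> 'a)) set" where
  "loop_homotopy M x = {(\<gamma>, \<eta>). \<gamma> \<in> loops M x \<and> \<eta> \<in> loops M x \<and>
     homotopic_with (\<lambda>r. r 0 = x \<and> r 1 = x) (top_of_set {0..1}) M \<gamma> \<eta>}"

text \<open>The library's concatenation \<open>+++\<close> is only available on types of class
  \<^class>\<open>topological_space\<close>.\<close>

definition concat_loops :: "(real \<Rightarrow> 'a) \<Rightarrow> (real \<Rightarrow> 'a) \<Rightarrow> real \<Rightarrow> 'a" where
  "concat_loops \<gamma> \<eta> = (\<lambda>t. if t \<le> 1/2 then \<gamma> (2 * t) else \<eta> (2 * t - 1))"

definition fundamental_group :: "'a topology \<Rightarrow> 'a \<Rightarrow> (real \<Rightarrow> 'a) set monoid" where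
  "fundamental_group M x =
     \<lparr>carrier = loops M x // loop_homotopy M x,
      mult = (\<lambda>c d. loop_homotopy M x `` {concat_loops \<gamma> \<eta> | \<gamma> \<eta>. \<gamma> \<in> c \<and> \<eta> \<in> d}),
      one = loop_homotopy M x `` {\<lambda>_. x}\<rparr>"

definition normal_plane :: "('a \<Rightarrow> real^4) \<Rightarrow> ('a \<Rightarrow> real^4) \<Rightarrow> 'a \<Rightarrow> (real^4) set" where
  "normal_plane f \<nu> p = {v. mink v (f p) = 0 \<and> mink v (\<nu> p) = 0}"

definition mink_orthonormal :: "(real^4) set \<Rightarrow> (2 \<Rightarrow> real^4) \<Rightarrow> bool" where
  "mink_orthonormal E e \<longleftrightarrow> range e \<subseteq> E \<and> (\<forall>i j. mink (e i) (e j) = (if i = j then 1 else 0))"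

definition maslov_det ::
  "'a atlas \<Rightarrow> ('a \<Rightarrow> real^4) \<Rightarrow> ('a \<Rightarrow> real^4) \<Rightarrow> 'a \<Rightarrow> (2 \<Rightarrow> real^2) \<Rightarrow> (2 \<Rightarrow> real^4) \<Rightarrow> complex" where
  "maslov_det A f \<nu> p b e = det ((\<chi> i j.
     complex_of_real (mink (differential A f p (b j)) (e i)) +
     \<i> * complex_of_real (mink (differential A \<nu> p (b j)) (e i))) :: complex^2^2)"

text \<open>The description incorporates the independence of the chosen bases.\<close>

definition maslov_map :: "'a atlas \<Rightarrow> ('a \<Rightarrow> real^4) \<Rightarrow> ('a \<Rightarrow> real^4) \<Rightarrow> 'a \<Rightarrow> complex" where
  "maslov_map A f \<nu> p = (THE m. \<forall>b e. tangent_basis b \<and> mink_orthonormal (normal_plane f \<nu> p) e \<longrightarrow>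
     m = (maslov_det A f \<nu> p b e)\<^sup>2 / complex_of_real ((cmod (maslov_det A f \<nu> p b e))\<^sup>2))"

text \<open>The winding number about 0 identifies the fundamental group of the unit circle with the
  integers, so that the homomorphism induced by \<^const>\<open>maslov_map\<close> takes the class \<open>c\<close> to twice
  \<open>zigzag_rep A f \<nu> c\<close>. Replacing \<open>\<nu>\<close> by \<open>- \<nu>\<close> changes the sign.\<close>

definition zigzag_rep ::
  "'a atlas \<Rightarrow> ('a \<Rightarrow> real^4) \<Rightarrow> ('a \<Rightarrow> real^4) \<Rightarrow> (real \<Rightarrow> 'a) set \<Rightarrow> int" where
  "zigzag_rep A f \<nu> c =
     (THE k. \<forall>\<gamma>\<in>c. winding_number (maslov_map A f \<nu> \<circ> \<gamma>) 0 = of_int (2 * k))"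

end

theory Submission
  imports Defs
begin

text \<open>Let \<open>A\<close> and \<open>T\<close> be the signed areas of \<open>df\<close> and \<open>d\<nu>\<close> in the normal plane and \<open>M\<close> their mixed area, so that
  \<open>det (df + i d\<nu>) = A - T + i M\<close>. In these terms the equation of the class \<open>W\<^sub>\<epsilon>\<close> is \<open>A - T = s (A + t M + T)\<close>
  with \<open>s = - \<epsilon>\<close>, where \<open>t = \<plusminus>1\<close> accounts for the choice of the normal, and it makes sense at singular points.
  Symmetry of \<open>\<langle>df, d\<nu>\<rangle>\<close> gives \<open>M\<^sup>2 \<ge> 4 A T\<close>, and for an immersion \<open>(f, \<nu>)\<close> the equation then implies
  \<open>t M + s (A - T) \<noteq> 0\<close>. This number is multiplied by the Jacobian under a change of coordinates, so it orients the
  surface; and it keeps \<open>det (df + i d\<nu>)\<close> off a line through the origin, so that the Maslov map avoids a ray and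
  has winding number zero along every loop.

  The equation with fixed \<open>s\<close> and \<open>t\<close> is given only near regular points, and \<open>t\<close> might jump across the singular
  set, near which one merely knows a relation with unknown coefficients that comes from a parallel front. The map
  \<open>(s - 1) f + (s + 1) \<nu>\<close> is constant or has, in the conformal coordinate given by the lightlike Gauss map \<open>f + \<nu>\<close>,
  a nonzero holomorphic Hopf differential. This yields unique continuation and the rigidity of isoparametric
  pieces, which exclude a jump of \<open>t\<close>.\<close>

text \<open>The companion is found by polarity: \<open>(s - 1) f + (s + 1) \<nu>\<close> is, up to a
  factor, the one combination whose differential has zero mixed area with that of
  \<open>f + \<nu>\<close> exactly when the Weingarten equation holds with \<open>t = 1\<close>. Its
  Minkowski square is \<open>4 s\<close>. A nonzero constant ratio of its area to that of
  \<open>f + \<nu>\<close> would make it lightlike, so for nonzero \<open>s\<close> an isoparametric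
  piece has a constant companion. For \<open>s = 0\<close> the equation does not contain
  \<open>t\<close>. A parallel front arises from \<open>(f, \<nu>)\<close> by a hyperbolic rotation,
  which keeps \<open>A - T\<close> and only rescales \<open>f \<plusminus> \<nu>\<close>. Hence a
  relation on a regular parallel front reads \<open>a (A \<plusminus> M + T) + d (A - T) = 0\<close>
  for \<open>f\<close>, also at its singular points. If it carries the opposite sign, the Weingarten
  equation turns it into a constant ratio of \<open>A\<close> to \<open>A + M + T\<close>, and
  rigidity fixes the parameter of the other normal as \<open>1 / s\<close>. The pairs
  \<open>(s, \<nu>)\<close> and \<open>(1 / s, - \<nu>)\<close> have proportional companions, so
  constancy seen from one normal can be continued with the equation of the other.\<close>

no_notation fps_nth (infixl "$" 75)

subsection \<open>The Minkowski product and oriented areas\<close>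

lemma bounded_bilinear_mink: "bounded_bilinear mink"
proof -
  have "bilinear mink"
    by (auto simp: bilinear_def linear_iff mink_def algebra_simps)
  then show ?thesis
    by (simp add: bilinear_conv_bounded_bilinear)
qed

interpretation mink: bounded_bilinear mink
  by (rule bounded_bilinear_mink)

lemmas mink_bilinear = mink.add_left mink.add_right mink.diff_left mink.diff_right
  mink.scaleR_left mink.scaleR_right mink.minus_left mink.minus_right mink.zero_left mink.zero_right

lemma mink_commute: "mink x y = mink y x"
  by (simp add: mink_def algebra_simps)

text \<open>The library enumerates this index type as 1, 2, 3, 4, whereas \<open>mink\<close> uses
  0, 1, 2, 3. Both lists name the same four coordinates.\<close>

lemma four_zero: "(4::4) = 0"
  by simp

lemma vec4_4: "x $ (4::4) = x $ 0"
  by (simp only: four_zero)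

lemma vec4_eqI:
  assumes "v $ 0 = w $ 0" "v $ 1 = w $ 1" "v $ 2 = w $ 2" "v $ 3 = w $ 3"
  shows "v = (w :: real^4)"
  using assms by (simp only: vec_eq_iff forall_4 four_zero)

lemma mink_nondegenerate:
  assumes "\<And>w. mink v w = 0"
  shows "v = 0"
proof -
  have "v $ 1 = 0" "v $ 2 = 0" "v $ 3 = 0" "v $ 0 = 0"
    using assms[of "axis 1 1"] assms[of "axis 2 1"] assms[of "axis 3 1"] assms[of "axis 0 1"]
    by (simp_all add: mink_def axis_def)
  then show ?thesis
    by (intro vec4_eqI) simp_all
qed

text \<open>For fixed \<open>a\<close> and \<open>b\<close> this is an area form in \<open>c\<close>
  and \<open>d\<close> on the plane orthogonal to \<open>a\<close> and \<open>b\<close>, so oriented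
  areas need no choice of a frame. The tangent vectors occupy rows 1 and 2, where row linearity of
  \<open>det\<close> is used.\<close>

definition vol :: "real^4 \<Rightarrow> real^4 \<Rightarrow> real^4 \<Rightarrow> real^4 \<Rightarrow> real" where
  "vol a b c d = det (\<chi> i. if i = 1 then c else if i = 2 then d else if i = 3 then a else b)"

lemma vol_alt: "vol a b c d = det (\<chi> i. if i = 2 then d else if i = 1 then c else if i = 3 then a else b)"
  unfolding vol_def by (rule arg_cong[where f = det]) (simp add: vec_eq_iff)

lemma vol_add: "vol a b (c + c') d = vol a b c d + vol a b c' d"
  "vol a b c (d + d') = vol a b c d + vol a b c d'"
proof -
  show "vol a b (c + c') d = vol a b c d + vol a b c' d"
    unfolding vol_def
    using det_row_add[of 1 "\<lambda>_. c" "\<lambda>_. c'" "\<lambda>i. if i = 2 then d else if i = 3 then a else b"]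
    by simp
  show "vol a b c (d + d') = vol a b c d + vol a b c d'"
    unfolding vol_alt
    using det_row_add[of 2 "\<lambda>_. d" "\<lambda>_. d'" "\<lambda>i. if i = 1 then c else if i = 3 then a else b"]
    by simp
qed

lemma vol_scaleR: "vol a b (r *\<^sub>R c) d = r * vol a b c d"
  "vol a b c (r *\<^sub>R d) = r * vol a b c d"
proof -
  show "vol a b (r *\<^sub>R c) d = r * vol a b c d"
    unfolding vol_def
    using det_row_mul[of 1 r "\<lambda>_. c" "\<lambda>i. if i = 2 then d else if i = 3 then a else b"]
    unfolding scalar_mult_eq_scaleR .
  show "vol a b c (r *\<^sub>R d) = r * vol a b c d"
    unfolding vol_alt
    using det_row_mul[of 2 r "\<lambda>_. d" "\<lambda>i. if i = 1 then c else if i = 3 then a else b"]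
    unfolding scalar_mult_eq_scaleR .
qed

lemma vol_zero: "vol a b 0 d = 0" "vol a b c 0 = 0"
  using vol_scaleR(1)[of a b 0 c d] vol_scaleR(2)[of a b c 0 d] by auto

lemma vol_minus: "vol a b (- c) d = - vol a b c d" "vol a b c (- d) = - vol a b c d"
  using vol_scaleR(1)[of a b "-1" c d] vol_scaleR(2)[of a b c "-1" d] by auto

lemma vol_diff: "vol a b (c - c') d = vol a b c d - vol a b c' d"
  "vol a b c (d - d') = vol a b c d - vol a b c d'"
  using vol_add(1)[of a b c "- c'" d] vol_add(2)[of a b c d "- d'"] by (auto simp: vol_minus)

lemma vol_same: "vol a b c c = 0"
  unfolding vol_def by (rule det_identical_rows[of 1 2]) (auto simp: row_def vec_eq_iff)

lemma vol_swap: "vol a b d c = - vol a b c d"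
  using vol_same[of a b "c + d"] vol_same[of a b c] vol_same[of a b d] by (simp add: vol_add)

lemmas vol_bilinear = vol_add vol_diff vol_scaleR vol_zero vol_minus vol_same

lemma vol_minus_normal: "vol a (- b) c d = - vol a b c d"
proof -
  have 1: "vol a e c d = det (\<chi> i. if i = 4 then e else if i = 1 then c else if i = 2 then d else a)" for e
    unfolding vol_def
  proof (rule arg_cong[where f = det], unfold vec_eq_iff, intro allI)
    fix i j :: 4
    show "(\<chi> i. if i = 1 then c else if i = 2 then d else if i = 3 then a else e) $ i $ j =
      (\<chi> i. if i = 4 then e else if i = 1 then c else if i = 2 then d else a) $ i $ j"
      using exhaust_4[of i] by auto
  qed
  show ?thesis
    unfolding 1 using det_row_mul[of 4 "-1" "\<lambda>_. b" "\<lambda>i. if i = 1 then c else if i = 2 then d else a"]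
    unfolding scalar_mult_eq_scaleR scaleR_minus1_left by (simp only: mult_minus1)
qed

lemma det_nonzero_ker:
  fixes A :: "real^'n^'n"
  assumes "det A \<noteq> 0" "A *v x = 0"
  shows "x = 0"
  using assms invertible_det_nz[of A] invertible_left_inverse[of A] matrix_left_invertible_ker[of A] by auto

lemma vol_nonzero:
  assumes "\<And>w x y z. w *\<^sub>R a + x *\<^sub>R b + y *\<^sub>R c + z *\<^sub>R d = 0 \<Longrightarrow> w = 0 \<and> x = 0 \<and> y = 0 \<and> z = 0"
  shows "vol a b c d \<noteq> 0"
proof
  define R :: "real^4^4" where "R = (\<chi> i. if i = 1 then c else if i = 2 then d else if i = 3 then a else b)"
  assume "vol a b c d = 0"
  then have "det (transpose R) = 0" by (simp add: vol_def R_def)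
  then obtain x where x: "transpose R *v x = 0" "x \<noteq> 0"
    using invertible_det_nz[of "transpose R"] invertible_left_inverse[of "transpose R"]
      matrix_left_invertible_ker[of "transpose R"] by auto
  have "transpose R *v x = x $ 3 *\<^sub>R a + x $ 4 *\<^sub>R b + x $ 1 *\<^sub>R c + x $ 2 *\<^sub>R d"
    by (simp add: vec_eq_iff matrix_vector_mult_def transpose_def R_def sum_4 algebra_simps)
  then have "x $ 1 = 0" "x $ 2 = 0" "x $ 3 = 0" "x $ 4 = 0"
    using assms x(1) by metis+
  then have "x = 0"
    by (metis (no_types) exhaust_4 vec_eq_iff zero_index)
  with x(2) show False by simp
qed

lemma continuous_on_vol:
  assumes "continuous_on S a" "continuous_on S b" "continuous_on S c" "continuous_on S d"
  shows "continuous_on S (\<lambda>x. vol (a x) (b x) (c x) (d x))"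
proof -
  have "continuous_on S (\<lambda>x. (\<chi> i. if i = 1 then c x else if i = 2 then d x else
    if i = 3 then a x else b x) $ i $ j)" for i j :: 4
    using assms by (cases "i = 1"; cases "i = 2"; cases "i = 3") (auto intro!: continuous_intros)
  then show ?thesis
    unfolding vol_def det_def
    by (intro continuous_on_sum continuous_on_mult continuous_on_prod continuous_on_const)
qed

subsection \<open>Orthonormal frames of the normal plane\<close>

definition perp2 :: "real^4 \<Rightarrow> real^4 \<Rightarrow> (real^4) set" where
  "perp2 f n = {v. mink v f = 0 \<and> mink v n = 0}"

lemma perp2_lincomb: "v \<in> perp2 f n \<Longrightarrow> w \<in> perp2 f n \<Longrightarrow> a *\<^sub>R v + b *\<^sub>R w \<in> perp2 f n"
  by (simp add: perp2_def mink_bilinear)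

lemma subspace_perp2: "subspace (perp2 f n)"
  by (simp add: subspace_def perp2_def mink_bilinear)

text \<open>The reversed Cauchy-Schwarz inequality for a timelike \<open>f\<close>: orthogonality
  expresses the time coordinate of \<open>v\<close> through the space coordinates, and the Euclidean
  inequality in three dimensions then bounds it.\<close>

lemma mink_pos:
  assumes "mink f f = -1" "mink v f = 0" "v \<noteq> 0"
  shows "mink v v > 0"
proof (rule ccontr)
  assume "\<not> mink v v > 0"
  define q where "q = (f$1)\<^sup>2 + (f$2)\<^sup>2 + (f$3)\<^sup>2"
  define r where "r = (v$1)\<^sup>2 + (v$2)\<^sup>2 + (v$3)\<^sup>2"
  have 1: "(f$0)\<^sup>2 = 1 + q" using assms(1) by (simp add: mink_def q_def power2_eq_square)
  have 2: "v$0 * f$0 = v$1*f$1 + v$2*f$2 + v$3*f$3" using assms(2) by (simp add: mink_def)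
  have 3: "r \<le> (v$0)\<^sup>2" using \<open>\<not> mink v v > 0\<close> by (simp add: mink_def r_def power2_eq_square)
  have 4: "(v$1*f$1 + v$2*f$2 + v$3*f$3)\<^sup>2 \<le> r * q"
  proof -
    \<comment> \<open>Lagrange's identity: the defect in the Cauchy-Schwarz inequality is the sum of
      the squares of the 2x2 minors.\<close>
    have "r * q - (v$1*f$1 + v$2*f$2 + v$3*f$3)\<^sup>2 =
      (v$1*f$2 - v$2*f$1)\<^sup>2 + (v$1*f$3 - v$3*f$1)\<^sup>2 + (v$2*f$3 - v$3*f$2)\<^sup>2"
      by (simp add: r_def q_def power2_eq_square algebra_simps)
    then show ?thesis by (smt (verit) zero_le_power2)
  qed
  have "(v$0)\<^sup>2 * (1 + q) \<le> r * q" using 1 2 4 by (metis power_mult_distrib)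
  moreover have "r * q \<le> (v$0)\<^sup>2 * q" by (rule mult_right_mono[OF 3]) (simp add: q_def)
  ultimately have "(v$0)\<^sup>2 \<le> 0" by argo
  then have v0: "v$0 = 0" by simp
  with 3 have "r \<le> 0" by simp
  then have "v$1 = 0" "v$2 = 0" "v$3 = 0"
    unfolding r_def by (smt (verit) zero_le_power2 zero_eq_power2)+
  then have "v = 0"
    using v0 by (intro vec4_eqI) simp_all
  with assms(3) show False by simp
qed

text \<open>The map \<open>J\<close> flips the time coordinate and so turns the Minkowski product
  into the Euclidean one. The plane becomes the Euclidean orthogonal complement of at most two
  independent vectors.\<close>

lemma dim_perp2_ge: "dim (perp2 f n) \<ge> 2"
proof -
  define J :: "real^4 \<Rightarrow> real^4" where "J f = (\<chi> i. if i = 0 then - f $ 0 else f $ i)" for f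
  have J: "J f \<bullet> v = mink v f" for f v
    by (simp add: inner_vec_def sum_4 J_def mink_def vec4_4)
  define Z where "Z = span {J f, J n}"
  have "dim {y \<in> UNIV. \<forall>x\<in>Z. orthogonal x y} + dim Z = dim (UNIV :: (real^4) set)"
    by (rule dim_subspace_orthogonal_to_vectors) (auto simp: Z_def)
  moreover have "dim Z \<le> 2"
    unfolding Z_def dim_span by (rule order_trans[OF dim_le_card']) (auto simp: card_insert_if)
  moreover have "{y \<in> UNIV. \<forall>x\<in>Z. orthogonal x y} = perp2 f n"
  proof (intro subset_antisym subsetI)
    fix y assume "y \<in> {y \<in> UNIV. \<forall>x\<in>Z. orthogonal x y}"
    then have "orthogonal (J f) y" "orthogonal (J n) y"
      by (auto simp: Z_def span_base)
    then show "y \<in> perp2 f n" by (simp add: orthogonal_def J perp2_def)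
  next
    fix y assume "y \<in> perp2 f n"
    then have "orthogonal y x" if "x \<in> {J f, J n}" for x
      using that by (auto simp: orthogonal_def J perp2_def inner_commute[of y])
    then show "y \<in> {y \<in> UNIV. \<forall>x\<in>Z. orthogonal x y}"
      using orthogonal_to_span[of _ "{J f, J n}" y] by (auto simp: Z_def orthogonal_commute)
  qed
  ultimately show ?thesis by simp
qed

definition frame :: "real^4 \<Rightarrow> real^4 \<Rightarrow> real^4 \<Rightarrow> real^4 \<Rightarrow> bool" where
  "frame f n e1 e2 \<longleftrightarrow> mink f f = -1 \<and> mink n n = 1 \<and> mink f n = 0 \<and> e1 \<in> perp2 f n \<and> e2 \<in> perp2 f n
     \<and> mink e1 e1 = 1 \<and> mink e2 e2 = 1 \<and> mink e1 e2 = 0"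

lemma frame_indep:
  assumes "frame f n e1 e2" "w *\<^sub>R f + x *\<^sub>R n + y *\<^sub>R e1 + z *\<^sub>R e2 = 0"
  shows "w = 0 \<and> x = 0 \<and> y = 0 \<and> z = 0"
proof -
  have "mink (w *\<^sub>R f + x *\<^sub>R n + y *\<^sub>R e1 + z *\<^sub>R e2) v = 0" for v
    by (simp add: assms(2) mink_bilinear)
  from this[of f] this[of n] this[of e1] this[of e2] assms(1) show ?thesis
    by (simp add: frame_def perp2_def mink_bilinear mink_commute)
qed

lemma frame_vol: "frame f n e1 e2 \<Longrightarrow> vol f n e1 e2 \<noteq> 0"
  by (rule vol_nonzero) (use frame_indep in blast)

text \<open>The remainder \<open>r\<close> is orthogonal to \<open>f\<close>, \<open>n\<close>,
  \<open>e1\<close> and \<open>e2\<close>. These are linearly independent, so \<open>r\<close> is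
  orthogonal to everything and vanishes by nondegeneracy.\<close>

lemma frame_exp:
  assumes fr: "frame f n e1 e2" and v: "v \<in> perp2 f n"
  shows "v = mink v e1 *\<^sub>R e1 + mink v e2 *\<^sub>R e2"
proof (rule ccontr)
  assume "\<not> ?thesis"
  define r where "r = v - (mink v e1 *\<^sub>R e1 + mink v e2 *\<^sub>R e2)"
  have r: "mink r f = 0" "mink r n = 0" "mink r e1 = 0" "mink r e2 = 0"
    using fr v by (simp_all add: frame_def perp2_def mink_bilinear mink_commute r_def)
  let ?R = "(\<chi> i. if i = 1 then e1 else if i = 2 then e2 else if i = 3 then f else n) :: real^4^4"
  define J :: "real^4 \<Rightarrow> real^4" where "J f = (\<chi> i. if i = 0 then - f $ 0 else f $ i)" for f
  have J: "f \<bullet> J v = mink v f" for f v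
    by (simp add: inner_vec_def sum_4 J_def mink_def vec4_4)
  have "det ?R \<noteq> 0" using frame_vol[OF fr] by (simp add: vol_def)
  moreover have "?R *v J r = 0"
    using r by (simp add: vec_eq_iff matrix_vector_mul_component J)
  ultimately have "J r = 0"
    by (rule det_nonzero_ker)
  then have "mink r w = 0" for w
    using J[of w r] by simp
  then have "r = 0" by (rule mink_nondegenerate)
  with \<open>\<not> ?thesis\<close> show False by (simp add: r_def)
qed

lemma frame_vol_exp:
  assumes fr: "frame f n e1 e2" and v: "v \<in> perp2 f n" and w: "w \<in> perp2 f n"
  shows "vol f n v w = vol f n e1 e2 * (mink v e1 * mink w e2 - mink v e2 * mink w e1)"
proof -
  have "vol f n v w = vol f n (mink v e1 *\<^sub>R e1 + mink v e2 *\<^sub>R e2) (mink w e1 *\<^sub>R e1 + mink w e2 *\<^sub>R e2)"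
    by (rule arg_cong2[where f = "vol f n", OF frame_exp[OF fr v] frame_exp[OF fr w]])
  also have "\<dots> = vol f n e1 e2 * (mink v e1 * mink w e2 - mink v e2 * mink w e1)"
    using vol_swap[of f n e2 e1] by (simp add: vol_bilinear algebra_simps)
  finally show ?thesis .
qed

lemma frame_mink:
  assumes fr: "frame f n e1 e2" and v: "v \<in> perp2 f n"
  shows "mink v w = mink v e1 * mink w e1 + mink v e2 * mink w e2"
proof -
  define a b where "a = mink v e1" and "b = mink v e2"
  have "v = a *\<^sub>R e1 + b *\<^sub>R e2"
    using frame_exp[OF fr v] unfolding a_def b_def .
  then have "mink v w = mink (a *\<^sub>R e1 + b *\<^sub>R e2) w" by (rule arg_cong)
  also have "\<dots> = a * mink e1 w + b * mink e2 w"
    by (simp only: mink_bilinear real_scaleR_def)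
  finally show ?thesis
    unfolding mink_commute[of e1 w] mink_commute[of e2 w] a_def b_def .
qed

text \<open>Gram-Schmidt applies because the product is positive definite on the normal plane by
  \<open>mink_pos\<close>.\<close>

lemma frame_exists:
  assumes "mink f f = -1" "mink n n = 1" "mink f n = 0"
  obtains e1 e2 where "frame f n e1 e2"
proof -
  obtain B where B: "B \<subseteq> perp2 f n" "independent B" "card B = dim (perp2 f n)"
    by (rule basis_exists)
  have "2 \<le> card B"
    using dim_perp2_ge[of f n] B(3) by simp
  then obtain C where C: "C \<subseteq> B" "card C = 2"
    by (rule obtain_subset_with_card_n)
  then obtain b1 b2 where "C = {b1, b2}" "b1 \<noteq> b2"
    by (auto simp: card_2_iff)
  with C(1) have b: "b1 \<in> B" "b2 \<in> B" "b1 \<noteq> b2" by auto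
  have ind: "independent {b2, b1}" using B(2) b by (meson empty_subsetI independent_mono insert_subset)
  have E: "b1 \<in> perp2 f n" "b2 \<in> perp2 f n" using B(1) b by auto
  have "b1 \<noteq> 0" using ind dependent_zero by blast
  then have p1: "mink b1 b1 > 0" using E assms mink_pos by (simp add: perp2_def)
  define c where "c = b2 - (mink b2 b1 / mink b1 b1) *\<^sub>R b1"
  have c: "c \<in> perp2 f n" using E by (simp add: c_def perp2_def mink_bilinear)
  have "c \<noteq> 0"
  proof
    assume "c = 0"
    then have "b2 \<in> span {b1}" by (simp add: c_def span_singleton)
    then show False using ind b(3) by (simp add: independent_insert)
  qed
  then have p2: "mink c c > 0" using c assms mink_pos by (simp add: perp2_def)
  have bc: "mink b1 c = 0" using p1 by (simp add: c_def mink_bilinear mink_commute)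
  have sq: "1 / sqrt r * (1 / sqrt r * r) = 1" if "r > 0" for r
    using that by (simp add: field_simps)
  have "mink ((1 / sqrt r) *\<^sub>R v) ((1 / sqrt r) *\<^sub>R v) = 1" if "r = mink v v" "mink v v > 0" for r v
    using sq[of r] that by (simp only: mink_bilinear real_scaleR_def)
  then have "frame f n ((1 / sqrt (mink b1 b1)) *\<^sub>R b1) ((1 / sqrt (mink c c)) *\<^sub>R c)"
    using assms E c p1 p2 bc unfolding frame_def
    by (simp only: mink_bilinear perp2_def mem_Collect_eq) simp
  then show ?thesis by (rule that)
qed

section \<open>Pointwise algebra of the two differentials of a front\<close>

text \<open>The pairs \<open>(p1, q1)\<close>, \<open>(p2, q2)\<close> and \<open>(r1, s1)\<close>,
  \<open>(r2, s2)\<close> are plane coordinates of the images of a tangent basis under df and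
  d\<nu>. If d\<nu> had rank one with image spanned by \<open>(v, w)\<close>, then df of its kernel
  vector would be orthogonal to \<open>(v, w)\<close> by symmetry and parallel to it by the
  vanishing mixed area. So it would be zero, against injectivity of the pair.\<close>

lemma planar_rank_zero:
  fixes p1 :: real
  assumes sym: "p1 * r2 + q1 * s2 = p2 * r1 + q2 * s1"
    and det: "r1 * s2 = s1 * r2" and mix: "(p1 * s2 - q1 * r2) + (r1 * q2 - s1 * p2) = 0"
    and inj: "\<And>x y. x * p1 + y * p2 = 0 \<Longrightarrow> x * q1 + y * q2 = 0 \<Longrightarrow> x * r1 + y * r2 = 0 \<Longrightarrow> x * s1 + y * s2 = 0
      \<Longrightarrow> x = 0 \<and> y = 0"
  shows "r1 = 0 \<and> s1 = 0 \<and> r2 = 0 \<and> s2 = 0"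
proof (rule ccontr)
  assume ne: "\<not> ?thesis"
  obtain x y v w where v: "r1 = x * v" "s1 = x * w" "r2 = y * v" "s2 = y * w" and vw: "v \<noteq> 0 \<or> w \<noteq> 0"
  proof (cases "r1 = 0 \<and> s1 = 0")
    case True
    then show ?thesis using that[of 0 r2 s2 1] ne by auto
  next
    case False
    show ?thesis
    proof (cases "r1 = 0")
      case True
      then show ?thesis using that[of 1 r1 s1 "s2 / s1"] False det by (simp add: field_simps)
    next
      case r: False
      show ?thesis using that[of 1 r1 s1 "r2 / r1"] r det by (simp add: field_simps)
    qed
  qed
  define m n where "m = y * p1 - x * p2" and "n = y * q1 - x * q2"
  have 1: "m * v + n * w = 0" using sym by (simp add: v m_def n_def algebra_simps)
  have 2: "m * w - n * v = 0" using mix by (simp add: v m_def n_def algebra_simps)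
  have "m * (v * v + w * w) = (m * v + n * w) * v + (m * w - n * v) * w" "n * (v * v + w * w) = (m * v + n * w) * w - (m * w - n * v) * v"
    by (simp_all add: algebra_simps)
  then have "m = 0" "n = 0" using 1 2 vw by (auto simp: add_nonneg_eq_0_iff)
  then have "y = 0 \<and> -x = 0"
    by (intro inj[of y "-x", simplified conj_commute]) (simp_all add: v m_def n_def)
  then show False using ne v by simp
qed

text \<open>Where the first matrix is invertible, the second is its composite with a symmetric
  endomorphism of the plane, with entries \<open>a\<close>, \<open>b\<close>, \<open>c\<close>. The
  inequality is the nonnegativity of the discriminant \<open>(a - c)^2 + 4 b^2\<close> of its
  characteristic polynomial.\<close>

lemma planar_discriminant:
  fixes p1 :: real
  assumes sym: "p1 * r2 + q1 * s2 = p2 * r1 + q2 * s1"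
  shows "4 * (p1 * q2 - q1 * p2) * (r1 * s2 - s1 * r2) \<le> (p1 * s2 - q1 * r2 + (r1 * q2 - s1 * p2))\<^sup>2"
proof (cases "p1 * q2 - q1 * p2 = 0")
  case True then show ?thesis by simp
next
  case False
  define A where "A = p1 * q2 - q1 * p2"
  define a b b' c where "a = (r1 * q2 - r2 * q1)/A" and "b = (r2 * p1 - r1 * p2)/A"
    and "b' = (s1 * q2 - s2 * q1)/A" and "c = (s2 * p1 - s1 * p2)/A"
  have A: "A \<noteq> 0" using False by (simp add: A_def)
  have k: "r1 = a * p1 + b * q1" "r2 = a * p2 + b * q2" "s1 = b'*p1 + c * q1" "s2 = b'*p2 + c * q2"
    using A unfolding a_def b_def b'_def c_def by (simp_all add: field_simps) (simp_all add: A_def algebra_simps)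
  have "(b - b') * A = 0" using sym unfolding k A_def by (simp add: algebra_simps)
  then have b: "b' = b" using A by simp
  have "(p1 * s2 - q1 * r2 + (r1 * q2 - s1 * p2))\<^sup>2 - 4 * (p1 * q2 - q1 * p2) * (r1 * s2 - s1 * r2) =
    (p1 * q2 - q1 * p2)\<^sup>2 * ((a - c)\<^sup>2 + 4 * b\<^sup>2)"
    unfolding k b by (simp add: power2_eq_square algebra_simps)
  moreover have "0 \<le> (p1 * q2 - q1 * p2)\<^sup>2 * ((a - c)\<^sup>2 + 4 * b\<^sup>2)" by simp
  ultimately show ?thesis by linarith
qed

text \<open>What the algebra needs to know of a front at one point: \<open>a1\<close>,
  \<open>a2\<close> and \<open>t1\<close>, \<open>t2\<close> stand for the images of a tangent basis
  under the differentials of the front and of its normal. The last two clauses are the symmetry of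
  the second fundamental form and the immersion property.\<close>

definition front_data :: "real^4 \<Rightarrow> real^4 \<Rightarrow> real^4 \<Rightarrow> real^4 \<Rightarrow> real^4 \<Rightarrow> real^4 \<Rightarrow> bool" where
  "front_data f n a1 a2 t1 t2 \<longleftrightarrow> mink f f = -1 \<and> mink n n = 1 \<and> mink f n = 0 \<and>
     a1 \<in> perp2 f n \<and> a2 \<in> perp2 f n \<and> t1 \<in> perp2 f n \<and> t2 \<in> perp2 f n \<and> mink a1 t2 = mink a2 t1 \<and>
     (\<forall>x y. x *\<^sub>R a1 + y *\<^sub>R a2 = 0 \<and> x *\<^sub>R t1 + y *\<^sub>R t2 = 0 \<longrightarrow> x = 0 \<and> y = 0)"

definition mixed_vol :: "real^4 \<Rightarrow> real^4 \<Rightarrow> real^4 \<Rightarrow> real^4 \<Rightarrow> real^4 \<Rightarrow> real^4 \<Rightarrow> real" where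
  "mixed_vol f n a1 a2 t1 t2 = vol f n a1 t2 + vol f n t1 a2"

text \<open>An invertible recombination of the two differentials keeps the normal plane, the
  symmetry and the joint injectivity. This is what allows \<open>rank_zero\<close> to be applied to
  the differentials of the Gauss map and of the companion.\<close>

lemma front_data_lincomb:
  assumes "front_data f n a1 a2 t1 t2" "c * e \<noteq> d * b"
  shows "front_data f n (c *\<^sub>R a1 + d *\<^sub>R t1) (c *\<^sub>R a2 + d *\<^sub>R t2) (b *\<^sub>R a1 + e *\<^sub>R t1) (b *\<^sub>R a2 + e *\<^sub>R t2)"
proof -
  have inj: "x = 0 \<and> y = 0" if 1: "x *\<^sub>R (c *\<^sub>R a1 + d *\<^sub>R t1) + y *\<^sub>R (c *\<^sub>R a2 + d *\<^sub>R t2) = 0"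
    and 2: "x *\<^sub>R (b *\<^sub>R a1 + e *\<^sub>R t1) + y *\<^sub>R (b *\<^sub>R a2 + e *\<^sub>R t2) = 0" for x y
  proof -
    define u v where "u = x *\<^sub>R a1 + y *\<^sub>R a2" and "v = x *\<^sub>R t1 + y *\<^sub>R t2"
    have 1: "c *\<^sub>R u + d *\<^sub>R v = 0" and 2: "b *\<^sub>R u + e *\<^sub>R v = 0"
      using 1 2 by (simp_all add: u_def v_def algebra_simps)
    have "(c * e - d * b) *\<^sub>R u = e *\<^sub>R (c *\<^sub>R u + d *\<^sub>R v) - d *\<^sub>R (b *\<^sub>R u + e *\<^sub>R v)"
      "(c * e - d * b) *\<^sub>R v = c *\<^sub>R (b *\<^sub>R u + e *\<^sub>R v) - b *\<^sub>R (c *\<^sub>R u + d *\<^sub>R v)"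
      by (simp_all add: algebra_simps)
    then have "u = 0" "v = 0" using 1 2 assms(2) by (simp_all only: scaleR_zero_right diff_self scaleR_eq_0_iff right_minus_eq) auto
    then show ?thesis using assms(1) by (auto simp: front_data_def u_def v_def)
  qed
  show ?thesis
    using assms(1) inj unfolding front_data_def
    by (auto simp: perp2_def mink_bilinear algebra_simps mink_commute)
qed

lemma rank_zero:
  assumes fd: "front_data f n a1 a2 t1 t2" and det: "vol f n t1 t2 = 0" and mix: "mixed_vol f n a1 a2 t1 t2 = 0"
  shows "t1 = 0 \<and> t2 = 0"
proof -
  note d = fd[unfolded front_data_def]
  obtain e1 e2 where fr: "frame f n e1 e2" using frame_exists d by metis
  note nz = frame_vol[OF fr]
  note x = frame_vol_exp[OF fr]
  have E: "a1 \<in> perp2 f n" "a2 \<in> perp2 f n" "t1 \<in> perp2 f n" "t2 \<in> perp2 f n" using d by auto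
  have "mink t1 e1 = 0 \<and> mink t1 e2 = 0 \<and> mink t2 e1 = 0 \<and> mink t2 e2 = 0"
  proof (rule planar_rank_zero)
    have "mink a1 t2 = mink a2 t1" using d by blast
    then show "mink a1 e1 * mink t2 e1 + mink a1 e2 * mink t2 e2 = mink a2 e1 * mink t1 e1 + mink a2 e2 * mink t1 e2"
      using frame_mink[OF fr E(1), of t2] frame_mink[OF fr E(2), of t1] by simp
    show "mink t1 e1 * mink t2 e2 = mink t1 e2 * mink t2 e1"
      using det x[OF E(3,4)] nz by simp
    have "vol f n e1 e2 * ((mink a1 e1 * mink t2 e2 - mink a1 e2 * mink t2 e1) + (mink t1 e1 * mink a2 e2 - mink t1 e2 * mink a2 e1)) = 0"
      using mix unfolding mixed_vol_def x[OF E(1,4)] x[OF E(3,2)] by (simp add: algebra_simps)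
    then show "mink a1 e1 * mink t2 e2 - mink a1 e2 * mink t2 e1 + (mink t1 e1 * mink a2 e2 - mink t1 e2 * mink a2 e1) = 0"
      using nz by simp
    fix r s
    assume *: "r * mink a1 e1 + s * mink a2 e1 = 0" "r * mink a1 e2 + s * mink a2 e2 = 0"
      "r * mink t1 e1 + s * mink t2 e1 = 0" "r * mink t1 e2 + s * mink t2 e2 = 0"
    have "r *\<^sub>R a1 + s *\<^sub>R a2 = 0"
      using frame_exp[OF fr perp2_lincomb[OF E(1,2)], of r s] * by (simp add: mink_bilinear)
    moreover have "r *\<^sub>R t1 + s *\<^sub>R t2 = 0"
      using frame_exp[OF fr perp2_lincomb[OF E(3,4)], of r s] * by (simp add: mink_bilinear)
    ultimately show "r = 0 \<and> s = 0" using d by blast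
  qed
  then show ?thesis using frame_exp[OF fr E(3)] frame_exp[OF fr E(4)] by simp
qed

lemma discriminant:
  assumes fd: "front_data f n a1 a2 t1 t2"
  shows "4 * vol f n a1 a2 * vol f n t1 t2 \<le> (mixed_vol f n a1 a2 t1 t2)\<^sup>2"
proof -
  note d = fd[unfolded front_data_def]
  obtain e1 e2 where fr: "frame f n e1 e2" using frame_exists d by metis
  note x = frame_vol_exp[OF fr]
  have E: "a1 \<in> perp2 f n" "a2 \<in> perp2 f n" "t1 \<in> perp2 f n" "t2 \<in> perp2 f n" using d by auto
  define c where "c = vol f n e1 e2"
  define A T M where "A = mink a1 e1 * mink a2 e2 - mink a1 e2 * mink a2 e1"
    and "T = mink t1 e1 * mink t2 e2 - mink t1 e2 * mink t2 e1"
    and "M = mink a1 e1 * mink t2 e2 - mink a1 e2 * mink t2 e1 + (mink t1 e1 * mink a2 e2 - mink t1 e2 * mink a2 e1)"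
  have "mink a1 t2 = mink a2 t1" using d by blast
  then have "4 * A * T \<le> M\<^sup>2"
    unfolding A_def T_def M_def
    by (intro planar_discriminant) (use frame_mink[OF fr E(1), of t2] frame_mink[OF fr E(2), of t1] in simp)
  then have "c\<^sup>2 * (4 * A * T) \<le> c\<^sup>2 * M\<^sup>2" by (rule mult_left_mono) simp
  moreover have "vol f n a1 a2 = c * A" "vol f n t1 t2 = c * T" "mixed_vol f n a1 a2 t1 t2 = c * M"
    unfolding mixed_vol_def x[OF E(1,2)] x[OF E(3,4)] x[OF E(1,4)] x[OF E(3,2)] A_def T_def M_def c_def
    by (simp_all add: algebra_simps)
  ultimately show ?thesis by (simp add: power2_eq_square algebra_simps)
qed

text \<open>This is the nonvanishing of the determinant of df + i d\<nu>. Equal areas and zero mixed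
  area force both areas to vanish by \<open>discriminant\<close>; then \<open>rank_zero\<close>,
  used once for each of the two differentials, kills both.\<close>

lemma maslov_nonzero:
  assumes fd: "front_data f n a1 a2 t1 t2" and "vol f n a1 a2 = vol f n t1 t2"
  shows "mixed_vol f n a1 a2 t1 t2 \<noteq> 0"
proof
  assume M: "mixed_vol f n a1 a2 t1 t2 = 0"
  then have "4 * vol f n t1 t2 * vol f n t1 t2 \<le> 0" using discriminant[OF fd] assms(2) by simp
  then have T: "vol f n t1 t2 = 0" by (simp add: mult_le_0_iff) linarith
  have "t1 = 0 \<and> t2 = 0" by (rule rank_zero[OF fd T M])
  moreover have "front_data f n (1 *\<^sub>R t1) t2 ((-1) *\<^sub>R a1) (- a2)"
    using front_data_lincomb[OF fd, of 0 0 1 "-1"] by simp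
  then have "- a1 = 0 \<and> - a2 = 0"
    by (intro rank_zero[of f n t1 t2]) (use M T assms(2) in \<open>simp_all add: mixed_vol_def vol_bilinear\<close>)
  ultimately show False using fd unfolding front_data_def by (auto dest: spec[of _ 1])
qed

text \<open>In terms of \<open>X\<close>, \<open>Y\<close>, \<open>S\<close> the discriminant
  inequality reads S^2 \<le> X^2 + Y^2. If Y = - s X, the Weingarten equation becomes (1 + s^2) X =
  s S. Squaring yields (1 + s^2) X^2 \<le> s^2 X^2, so X = Y = 0, against
  \<open>maslov_nonzero\<close>.\<close>

lemma orientation_nonzero:
  assumes fd: "front_data f n a1 a2 t1 t2"
    and R: "vol f n a1 a2 - vol f n t1 t2 = s * (vol f n a1 a2 + mixed_vol f n a1 a2 t1 t2 + vol f n t1 t2)"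
  shows "mixed_vol f n a1 a2 t1 t2 + s * (vol f n a1 a2 - vol f n t1 t2) \<noteq> 0"
proof
  define X Y S where "X = vol f n a1 a2 - vol f n t1 t2" and "Y = mixed_vol f n a1 a2 t1 t2"
    and "S = vol f n a1 a2 + vol f n t1 t2"
  assume "mixed_vol f n a1 a2 t1 t2 + s * (vol f n a1 a2 - vol f n t1 t2) = 0"
  then have Y: "Y = - s * X" by (simp add: X_def Y_def)
  have "X = s * (S + Y)" using R by (simp add: X_def Y_def S_def algebra_simps)
  then have 1: "X * (1 + s\<^sup>2) = s * S" by (simp add: Y algebra_simps power2_eq_square)
  have "S\<^sup>2 \<le> X\<^sup>2 + Y\<^sup>2" using discriminant[OF fd]
    by (simp add: X_def Y_def S_def power2_eq_square algebra_simps)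
  then have 2: "S\<^sup>2 \<le> X\<^sup>2 * (1 + s\<^sup>2)" by (simp add: Y power2_eq_square algebra_simps)
  have "(X * (1 + s\<^sup>2))\<^sup>2 = s\<^sup>2 * S\<^sup>2" unfolding 1 by (simp add: power_mult_distrib)
  also have "\<dots> \<le> s\<^sup>2 * (X\<^sup>2 * (1 + s\<^sup>2))" by (rule mult_left_mono[OF 2]) simp
  finally have "(X\<^sup>2 * (1 + s\<^sup>2)) * (1 + s\<^sup>2) \<le> (X\<^sup>2 * (1 + s\<^sup>2)) * s\<^sup>2"
    by (simp add: power2_eq_square algebra_simps)
  then have "X\<^sup>2 * (1 + s\<^sup>2) \<le> 0" by (simp only: distrib_left mult_1_right)
  moreover have "0 < 1 + s\<^sup>2" by (smt (verit) zero_le_power2)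
  ultimately have "X\<^sup>2 \<le> 0" by (simp add: mult_le_0_iff del: power2_less_eq_zero_iff)
  then have "X = 0" by simp
  then show False using maslov_nonzero[OF fd] Y by (simp add: X_def Y_def)
qed

lemma vol_lincomb: "vol f n (c *\<^sub>R a1 + d *\<^sub>R t1) (c *\<^sub>R a2 + d *\<^sub>R t2) =
    c\<^sup>2 * vol f n a1 a2 + c * d * mixed_vol f n a1 a2 t1 t2 + d\<^sup>2 * vol f n t1 t2"
  by (simp add: vol_bilinear mixed_vol_def power2_eq_square algebra_simps)

lemma mixed_vol_lincomb: "mixed_vol f n (c *\<^sub>R a1 + d *\<^sub>R t1) (c *\<^sub>R a2 + d *\<^sub>R t2)
      (b *\<^sub>R a1 + e *\<^sub>R t1) (b *\<^sub>R a2 + e *\<^sub>R t2) =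
    2 * c * b * vol f n a1 a2 + (c * e + d * b) * mixed_vol f n a1 a2 t1 t2 + 2 * d * e * vol f n t1 t2"
  by (simp add: vol_bilinear mixed_vol_def algebra_simps)

text \<open>The next two lemmas say that the differentials of \<open>f + n\<close> and of its companion
  \<open>(s - 1) f + (s + 1) n\<close> have no points of rank one.\<close>

lemma gauss_map_rank:
  assumes fd: "front_data f n a1 a2 t1 t2" and 1: "vol f n a1 a2 = vol f n t1 t2"
    and 2: "vol f n a1 a2 + mixed_vol f n a1 a2 t1 t2 + vol f n t1 t2 = 0"
  shows "a1 + t1 = 0 \<and> a2 + t2 = 0"
proof (rule rank_zero)
  show "front_data f n a1 a2 (a1 + t1) (a2 + t2)"
    using front_data_lincomb[OF fd, of 1 1 0 1] by simp
  show "vol f n (a1 + t1) (a2 + t2) = 0"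
    using vol_lincomb[of f n 1 a1 1 t1 a2 t2] 2 by (simp only: scaleR_one power_one mult_1)
  have "mixed_vol f n a1 a2 (a1 + t1) (a2 + t2) = 2 * vol f n a1 a2 + mixed_vol f n a1 a2 t1 t2"
    by (simp add: mixed_vol_def vol_bilinear)
  then show "mixed_vol f n a1 a2 (a1 + t1) (a2 + t2) = 0" using 1 2 by linarith
qed

lemma companion_rank:
  assumes fd: "front_data f n a1 a2 t1 t2"
    and R: "vol f n a1 a2 - vol f n t1 t2 = s * (vol f n a1 a2 + mixed_vol f n a1 a2 t1 t2 + vol f n t1 t2)"
    and Z: "(s - 1)\<^sup>2 * vol f n a1 a2 + (s\<^sup>2 - 1) * mixed_vol f n a1 a2 t1 t2 + (s + 1)\<^sup>2 * vol f n t1 t2 = 0"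
  shows "(s - 1) *\<^sub>R a1 + (s + 1) *\<^sub>R t1 = 0 \<and> (s - 1) *\<^sub>R a2 + (s + 1) *\<^sub>R t2 = 0"
proof (rule rank_zero)
  have "front_data f n (1 *\<^sub>R a1 + 1 *\<^sub>R t1) (1 *\<^sub>R a2 + 1 *\<^sub>R t2)
      ((s - 1) *\<^sub>R a1 + (s + 1) *\<^sub>R t1) ((s - 1) *\<^sub>R a2 + (s + 1) *\<^sub>R t2)"
    by (rule front_data_lincomb[OF fd]) simp
  then show "front_data f n (a1 + t1) (a2 + t2)
      ((s - 1) *\<^sub>R a1 + (s + 1) *\<^sub>R t1) ((s - 1) *\<^sub>R a2 + (s + 1) *\<^sub>R t2)"
    by simp
  have "(s - 1) * (s + 1) = s\<^sup>2 - 1" by (simp add: power2_eq_square algebra_simps)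
  then show "vol f n ((s - 1) *\<^sub>R a1 + (s + 1) *\<^sub>R t1) ((s - 1) *\<^sub>R a2 + (s + 1) *\<^sub>R t2) = 0"
    unfolding vol_lincomb using Z by simp
  \<comment> \<open>The coefficients \<open>s - 1\<close> and \<open>s + 1\<close> are those for
    which this mixed area is twice the defect in the Weingarten equation \<open>R\<close>.\<close>
  have "mixed_vol f n (a1 + t1) (a2 + t2) ((s - 1) *\<^sub>R a1 + (s + 1) *\<^sub>R t1) ((s - 1) *\<^sub>R a2 + (s + 1) *\<^sub>R t2) =
    2 * (s * (vol f n a1 a2 + mixed_vol f n a1 a2 t1 t2 + vol f n t1 t2) - (vol f n a1 a2 - vol f n t1 t2))"
    using mixed_vol_lincomb[of f n 1 a1 1 t1 a2 t2 "s - 1" "s + 1"]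
    unfolding scaleR_one by (simp add: algebra_simps)
  then show "mixed_vol f n (a1 + t1) (a2 + t2) ((s - 1) *\<^sub>R a1 + (s + 1) *\<^sub>R t1) ((s - 1) *\<^sub>R a2 + (s + 1) *\<^sub>R t2) = 0"
    unfolding R by simp
qed

subsection \<open>Symmetry of second derivatives\<close>

lemma dist_add: "dist p (p + w) = norm (w :: 'a::real_normed_vector)"
  by (metis dist_norm dist_commute add_diff_cancel_left')

text \<open>The mean value theorem in direction \<open>u\<close> turns the second difference into a
  difference of values of \<open>Df\<close> on \<open>u\<close>. These are then linearized at
  \<open>p\<close>, so no continuity of the second derivative enters.\<close>

lemma second_difference:
  fixes f :: "'a::real_normed_vector \<Rightarrow> real"
  assumes S: "open S" "p \<in> S" and f: "\<And>x. x \<in> S \<Longrightarrow> (f has_derivative Df x) (at x)"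
    and L: "((\<lambda>x. Df x u) has_derivative L) (at p)" and e: "e > 0"
  obtains d where "d > 0" "\<And>h. 0 < h \<Longrightarrow> h < d \<Longrightarrow>
    \<bar>f (p + h *\<^sub>R u + h *\<^sub>R v) - f (p + h *\<^sub>R u) - f (p + h *\<^sub>R v) + f p - h * h * L v\<bar>
      \<le> h * h * (e * (2 * norm u + norm v))"
proof -
  obtain d0 where d0: "d0 > 0" "ball p d0 \<subseteq> S" using S open_contains_ball by blast
  obtain d1 where d1: "d1 > 0" "\<And>y. norm (y - p) < d1 \<Longrightarrow> norm (Df y u - Df p u - L (y - p)) \<le> e * norm (y - p)"
    using L e unfolding has_derivative_at_alt by blast
  define d where "d = min d0 d1 / (norm u + norm v + 1)"
  have pos: "norm u + norm v + 1 > 0" using norm_ge_zero[of u] norm_ge_zero[of v] by linarith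
  have "d > 0" using d0 d1 pos by (simp add: d_def)
  moreover have "\<bar>f (p + h *\<^sub>R u + h *\<^sub>R v) - f (p + h *\<^sub>R u) - f (p + h *\<^sub>R v) + f p - h * h * L v\<bar>
      \<le> h * h * (e * (2 * norm u + norm v))" if h: "0 < h" "h < d" for h
  proof -
    have hd: "h * (norm u + norm v + 1) < min d0 d1" using h pos by (simp add: d_def field_simps)
    have nrm: "norm (t *\<^sub>R u + s *\<^sub>R v) < min d0 d1" "norm (t *\<^sub>R u + s *\<^sub>R v) \<le> h * norm u + s * norm v"
      if "0 \<le> t" "t \<le> h" "0 \<le> s" "s \<le> h" for t s
    proof -
      have "norm (t *\<^sub>R u + s *\<^sub>R v) \<le> t * norm u + s * norm v"
        using norm_triangle_ineq[of "t *\<^sub>R u" "s *\<^sub>R v"] that by simp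
      moreover have "t * norm u \<le> h * norm u" "s * norm v \<le> h * norm v"
        using that by (simp_all add: mult_right_mono)
      moreover have "h * (norm u + norm v + 1) = h * norm u + h * norm v + h" by (simp add: algebra_simps)
      ultimately show "norm (t *\<^sub>R u + s *\<^sub>R v) < min d0 d1" "norm (t *\<^sub>R u + s *\<^sub>R v) \<le> h * norm u + s * norm v"
        using hd h(1) by linarith+
    qed
    have inS: "p + (t *\<^sub>R u + s *\<^sub>R v) \<in> S" if "0 \<le> t" "t \<le> h" "0 \<le> s" "s \<le> h" for t s
    proof -
      have "p + (t *\<^sub>R u + s *\<^sub>R v) \<in> ball p d0" using nrm(1)[OF that] dist_add[of p "t *\<^sub>R u + s *\<^sub>R v"] by simp
      then show ?thesis using d0(2) by blast
    qed
    define g where "g t = f (p + (t *\<^sub>R u + h *\<^sub>R v)) - f (p + (t *\<^sub>R u + 0 *\<^sub>R v))" for t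
    have g: "(g has_real_derivative (Df (p + (t *\<^sub>R u + h *\<^sub>R v)) u - Df (p + (t *\<^sub>R u + 0 *\<^sub>R v)) u)) (at t)"
      if t: "0 \<le> t" "t \<le> h" for t
    proof -
      have *: "((\<lambda>t. f (p + (t *\<^sub>R u + s *\<^sub>R v))) has_derivative (\<lambda>r. Df (p + (t *\<^sub>R u + s *\<^sub>R v)) (r *\<^sub>R u))) (at t)"
        if "0 \<le> s" "s \<le> h" for s
      proof (rule has_derivative_compose[where g = f and f = "\<lambda>t. p + (t *\<^sub>R u + s *\<^sub>R v)"])
        show "((\<lambda>t. p + (t *\<^sub>R u + s *\<^sub>R v)) has_derivative (\<lambda>r. r *\<^sub>R u)) (at t)"
          by (auto intro!: derivative_eq_intros)
        show "(f has_derivative Df (p + (t *\<^sub>R u + s *\<^sub>R v))) (at (p + (t *\<^sub>R u + s *\<^sub>R v)))"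
          by (rule f[OF inS[OF t that]])
      qed
      have lin: "Df (p + (t *\<^sub>R u + s *\<^sub>R v)) (r *\<^sub>R u) = r * Df (p + (t *\<^sub>R u + s *\<^sub>R v)) u" if "0 \<le> s" "s \<le> h" for r s
        using has_derivative_linear[OF f[OF inS[OF t that]]] by (simp add: linear_scale)
      have "(g has_derivative (\<lambda>r. Df (p + (t *\<^sub>R u + h *\<^sub>R v)) (r *\<^sub>R u) - Df (p + (t *\<^sub>R u + 0 *\<^sub>R v)) (r *\<^sub>R u))) (at t)"
        unfolding g_def by (rule has_derivative_diff[OF *[of h] *[of 0]]) (use h in auto)
      moreover have "(\<lambda>r. Df (p + (t *\<^sub>R u + h *\<^sub>R v)) (r *\<^sub>R u) - Df (p + (t *\<^sub>R u + 0 *\<^sub>R v)) (r *\<^sub>R u)) =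
          (*) (Df (p + (t *\<^sub>R u + h *\<^sub>R v)) u - Df (p + (t *\<^sub>R u + 0 *\<^sub>R v)) u)"
        by (rule ext) (use h lin[of h] lin[of 0] in \<open>simp add: algebra_simps\<close>)
      ultimately show ?thesis
        unfolding has_field_derivative_def by simp
    qed
    obtain t where t: "0 < t" "t < h" and
      gt: "g h - g 0 = (h - 0) * (Df (p + (t *\<^sub>R u + h *\<^sub>R v)) u - Df (p + (t *\<^sub>R u + 0 *\<^sub>R v)) u)"
      using MVT2[OF h(1) g] by blast
    have a: "\<bar>Df (p + (t *\<^sub>R u + s *\<^sub>R v)) u - Df p u - L (t *\<^sub>R u + s *\<^sub>R v)\<bar> \<le> e * (h * norm u + s * norm v)"
      if "0 \<le> s" "s \<le> h" for s
      using d1(2)[of "p + (t *\<^sub>R u + s *\<^sub>R v)"] nrm[of t s] t that e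
      by (smt (verit) add_diff_cancel_left' mult_left_mono real_norm_def)
    interpret L: linear L using has_derivative_linear[OF L] .
    have "L (t *\<^sub>R u + h *\<^sub>R v) - L (t *\<^sub>R u + 0 *\<^sub>R v) = h * L v"
      by (simp add: L.add L.scale)
    then have "\<bar>(Df (p + (t *\<^sub>R u + h *\<^sub>R v)) u - Df (p + (t *\<^sub>R u + 0 *\<^sub>R v)) u) - h * L v\<bar>
      \<le> e * (h * norm u + h * norm v) + e * (h * norm u + 0 * norm v)"
      using a[of h] a[of 0] h by linarith
    also have "\<dots> = h * (e * (2 * norm u + norm v))" by (simp add: algebra_simps)
    finally have *: "\<bar>(Df (p + (t *\<^sub>R u + h *\<^sub>R v)) u - Df (p + (t *\<^sub>R u + 0 *\<^sub>R v)) u) - h * L v\<bar>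
      \<le> h * (e * (2 * norm u + norm v))" .
    have "f (p + h *\<^sub>R u + h *\<^sub>R v) - f (p + h *\<^sub>R u) - f (p + h *\<^sub>R v) + f p - h * h * L v =
      (g h - g 0) - h * h * L v" by (simp add: g_def add.assoc)
    also have "\<dots> = h * ((Df (p + (t *\<^sub>R u + h *\<^sub>R v)) u - Df (p + (t *\<^sub>R u + 0 *\<^sub>R v)) u) - h * L v)"
      unfolding gt by (simp add: algebra_simps)
    finally show ?thesis
      using mult_left_mono[OF *, of h] h by (simp add: abs_mult)
  qed
  ultimately show ?thesis by (rule that)
qed

text \<open>The second difference is symmetric in \<open>u\<close> and \<open>v\<close>, and after
  division by h^2 both iterated derivatives are its limit.\<close>

lemma symmetric_second_derivative_real:
  fixes f :: "'a::real_normed_vector \<Rightarrow> real"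
  assumes S: "open S" "p \<in> S" and f: "\<And>x. x \<in> S \<Longrightarrow> (f has_derivative Df x) (at x)"
    and Lu: "((\<lambda>x. Df x u) has_derivative Lu) (at p)" and Lv: "((\<lambda>x. Df x v) has_derivative Lv) (at p)"
  shows "Lu v = Lv u"
proof (rule ccontr)
  assume ne: "Lu v \<noteq> Lv u"
  \<comment> \<open>The sum of the two error factors \<open>2 * norm u + norm v\<close> and
    \<open>2 * norm v + norm u\<close>; the summand 1 keeps it positive and makes the final estimate
    strict.\<close>
  define K where "K = 3 * norm u + 3 * norm v + 1"
  have K: "K > 0" using norm_ge_zero[of u] norm_ge_zero[of v] unfolding K_def by linarith
  define e where "e = \<bar>Lu v - Lv u\<bar> / (2 * K)"
  have e: "e > 0" using ne K by (simp add: e_def)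
  obtain d1 where d1: "d1 > 0" "\<And>h. 0 < h \<Longrightarrow> h < d1 \<Longrightarrow>
    \<bar>f (p + h *\<^sub>R u + h *\<^sub>R v) - f (p + h *\<^sub>R u) - f (p + h *\<^sub>R v) + f p - h * h * Lu v\<bar>
      \<le> h * h * (e * (2 * norm u + norm v))"
    using second_difference[OF S f Lu e] by blast
  obtain d2 where d2: "d2 > 0" "\<And>h. 0 < h \<Longrightarrow> h < d2 \<Longrightarrow>
    \<bar>f (p + h *\<^sub>R v + h *\<^sub>R u) - f (p + h *\<^sub>R v) - f (p + h *\<^sub>R u) + f p - h * h * Lv u\<bar>
      \<le> h * h * (e * (2 * norm v + norm u))"
    using second_difference[OF S f Lv e] by blast
  define h where "h = min d1 d2 / 2"
  have h: "0 < h" "h < d1" "h < d2" using d1(1) d2(1) by (auto simp: h_def)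
  have eq: "p + h *\<^sub>R v + h *\<^sub>R u = p + h *\<^sub>R u + h *\<^sub>R v" by simp
  have "\<bar>h * h * Lu v - h * h * Lv u\<bar> \<le> h * h * (e * (2 * norm u + norm v)) + h * h * (e * (2 * norm v + norm u))"
    using d1(2)[OF h(1,2)] d2(2)[OF h(1,3)] unfolding eq by linarith
  also have "\<dots> < h * h * (e * K)" using h e by (simp add: K_def algebra_simps)
  finally have "h * h * \<bar>Lu v - Lv u\<bar> < h * h * (e * K)"
    by (simp add: abs_mult right_diff_distrib[symmetric])
  then have "\<bar>Lu v - Lv u\<bar> < e * K" using h by simp
  then show False using K ne by (simp add: e_def)
qed

lemma symmetric_second_derivative:
  fixes f :: "'a::real_normed_vector \<Rightarrow> 'b::euclidean_space"
  assumes S: "open S" "p \<in> S" and f: "\<And>x. x \<in> S \<Longrightarrow> (f has_derivative Df x) (at x)"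
    and Lu: "((\<lambda>x. Df x u) has_derivative Lu) (at p)" and Lv: "((\<lambda>x. Df x v) has_derivative Lv) (at p)"
  shows "Lu v = Lv u"
proof (rule euclidean_eqI)
  fix b :: 'b
  show "Lu v \<bullet> b = Lv u \<bullet> b"
    by (rule symmetric_second_derivative_real[OF S, of "\<lambda>x. f x \<bullet> b" "\<lambda>x h. Df x h \<bullet> b"])
      (auto intro!: has_derivative_inner_left f Lu Lv)
qed

section \<open>Twice differentiable maps on plane domains\<close>

text \<open>Domains lie in the complex plane because the Gauss map will supply a coordinate in which
  a holomorphic function appears. Differentiability of each directional derivative is exactly what
  the symmetry of second derivatives asks for.\<close>

definition twice_diff_on :: "complex set \<Rightarrow> (complex \<Rightarrow> 'b::real_normed_vector) \<Rightarrow> (complex \<Rightarrow> complex \<Rightarrow> 'b) \<Rightarrow> bool" where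
  "twice_diff_on S f Df \<longleftrightarrow> (\<forall>p\<in>S. (f has_derivative Df p) (at p) \<and> (\<forall>v. (\<lambda>x. Df x v) differentiable (at p)))"

lemma twice_diff_onD:
  assumes "twice_diff_on S f Df" "p \<in> S"
  shows "(f has_derivative Df p) (at p)" "(\<lambda>x. Df x v) differentiable (at p)" "linear (Df p)"
  using assms has_derivative_linear[of f "Df p" "at p"] by (auto simp: twice_diff_on_def)

lemma linear_complex_exp:
  assumes "linear (L :: complex \<Rightarrow> 'b::real_vector)"
  shows "L d = Re d *\<^sub>R L 1 + Im d *\<^sub>R L \<i>"
proof -
  have "d = Re d *\<^sub>R 1 + Im d *\<^sub>R \<i>" by (simp add: complex_eq_iff)
  then have "L d = L (Re d *\<^sub>R 1 + Im d *\<^sub>R \<i>)" by simp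
  then show ?thesis by (simp only: linear_add[OF assms] linear_scale[OF assms])
qed

lemma cauchy_riemann:
  fixes f :: "complex \<Rightarrow> complex"
  assumes "(f has_derivative L) (at z)" "L \<i> = \<i> * L 1"
  shows "(f has_field_derivative L 1) (at z)"
proof -
  have "L = (*) (L 1)"
  proof
    fix d
    have "L d = Re d *\<^sub>R L 1 + Im d *\<^sub>R L \<i>"
      by (rule linear_complex_exp[OF has_derivative_linear[OF assms(1)]])
    also have "\<dots> = (complex_of_real (Re d) + \<i> * complex_of_real (Im d)) * L 1"
      unfolding assms(2) by (simp add: scaleR_conv_of_real algebra_simps)
    also have "\<dots> = L 1 * d" by (simp add: complex_eq[of d, symmetric])
    finally show "L d = L 1 * d" .
  qed
  then show ?thesis using assms(1) by (simp add: has_field_derivative_def)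
qed

subsection \<open>Conformal coordinates\<close>

text \<open>A parametrization of the future light cone up to scaling by stereographic projection, from
  either pole of the sphere at infinity according to the sign of \<open>t\<close>.\<close>

definition lcone :: "real \<Rightarrow> complex \<Rightarrow> real^4" where
  "lcone t z = (\<chi> i. if i = 0 then 1 + ((Re z)\<^sup>2 + (Im z)\<^sup>2) else if i = 1 then 2 * Re z else if i = 2 then 2 * Im z
     else t * ((Re z)\<^sup>2 + (Im z)\<^sup>2 - 1))"

definition lcone_deriv :: "real \<Rightarrow> complex \<Rightarrow> complex \<Rightarrow> real^4" where
  "lcone_deriv t z d = (\<chi> i. if i = 0 then 2 * (Re z * Re d + Im z * Im d) else if i = 1 then 2 * Re d
     else if i = 2 then 2 * Im d else t * (2 * (Re z * Re d + Im z * Im d)))"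

text \<open>Half the second derivative of \<open>lcone\<close> in a unit direction. For
  \<open>t * t = 1\<close> it is lightlike with product -2 with every \<open>lcone t z\<close>, and
  it completes \<open>lcone\<close> and its two partial derivatives to a frame.\<close>

definition lcone_axis :: "real \<Rightarrow> real^4" where
  "lcone_axis t = (\<chi> i. if i = 0 then 1 else if i = 3 then t else 0)"

lemma lcone_nth: "lcone t z $ 0 = 1 + ((Re z)\<^sup>2 + (Im z)\<^sup>2)" "lcone t z $ 1 = 2 * Re z" "lcone t z $ 2 = 2 * Im z"
    "lcone t z $ 3 = t * ((Re z)\<^sup>2 + (Im z)\<^sup>2 - 1)"
  "lcone_deriv t z d $ 0 = 2 * (Re z * Re d + Im z * Im d)" "lcone_deriv t z d $ 1 = 2 * Re d"
    "lcone_deriv t z d $ 2 = 2 * Im d" "lcone_deriv t z d $ 3 = t * (2 * (Re z * Re d + Im z * Im d))"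
  "lcone_axis t $ 0 = 1" "lcone_axis t $ 1 = 0" "lcone_axis t $ 2 = 0" "lcone_axis t $ 3 = t"
  by (simp_all add: lcone_def lcone_deriv_def lcone_axis_def)

lemma has_derivative_vec4:
  fixes f :: "complex \<Rightarrow> real^4"
  assumes "((\<lambda>x. f x $ 0) has_derivative (\<lambda>d. L d $ 0)) (at z)" "((\<lambda>x. f x $ 1) has_derivative (\<lambda>d. L d $ 1)) (at z)"
    "((\<lambda>x. f x $ 2) has_derivative (\<lambda>d. L d $ 2)) (at z)" "((\<lambda>x. f x $ 3) has_derivative (\<lambda>d. L d $ 3)) (at z)"
  shows "(f has_derivative L) (at z)"
proof -
  have "((\<lambda>x. f x \<bullet> axis i 1) has_derivative (\<lambda>d. L d \<bullet> axis i 1)) (at z)" for i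
    using exhaust_4[of i] assms by (auto simp: inner_axis vec4_4)
  then show ?thesis
    by (subst has_derivative_componentwise_within) (auto simp: Basis_vec_def)
qed

lemma lcone_has_derivative: "(lcone t has_derivative lcone_deriv t z) (at z)"
  by (rule has_derivative_vec4) (auto simp: lcone_nth intro!: derivative_eq_intros)

lemma lcone_deriv_has_derivative:
  "((\<lambda>z. lcone_deriv t z d) has_derivative (\<lambda>d'. (2 * (Re d' * Re d + Im d' * Im d)) *\<^sub>R lcone_axis t)) (at z)"
  by (rule has_derivative_vec4) (auto simp: lcone_nth intro!: derivative_eq_intros)

lemma mink_lcone:
  assumes "t * t = 1"
  shows "mink (lcone t z) (lcone t z) = 0" "mink (lcone_deriv t z 1) (lcone_deriv t z 1) = 4"
    "mink (lcone_deriv t z \<i>) (lcone_deriv t z \<i>) = 4" "mink (lcone_deriv t z 1) (lcone_deriv t z \<i>) = 0"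
    "mink (lcone t z) (lcone_deriv t z d) = 0"
proof -
  have "t = 1 \<or> t = -1" using assms by (simp add: square_eq_1_iff)
  then show "mink (lcone t z) (lcone t z) = 0" "mink (lcone_deriv t z 1) (lcone_deriv t z 1) = 4"
    "mink (lcone_deriv t z \<i>) (lcone_deriv t z \<i>) = 4" "mink (lcone_deriv t z 1) (lcone_deriv t z \<i>) = 0"
    "mink (lcone t z) (lcone_deriv t z d) = 0"
    by (auto simp: mink_def lcone_nth algebra_simps power2_eq_square)
qed

text \<open>The expansion of the product in the frame of \<open>lcone\<close>,
  \<open>lcone_axis\<close> and the partial derivatives. The factors come from the squared lengths 4
  of the two spacelike vectors and the product -2 of the two lightlike ones.\<close>

lemma lcone_expansion:
  assumes "t * t = 1"
  shows "4 * mink v w = mink v (lcone_deriv t z 1) * mink w (lcone_deriv t z 1)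
      + mink v (lcone_deriv t z \<i>) * mink w (lcone_deriv t z \<i>)
      - 2 * (mink v (lcone t z) * mink w (lcone_axis t) + mink v (lcone_axis t) * mink w (lcone t z))"
proof -
  have "t = 1 \<or> t = -1" using assms by (simp add: square_eq_1_iff)
  then show ?thesis
    by (auto simp: mink_def lcone_nth algebra_simps power2_eq_square)
qed

text \<open>\<open>Xi\<close> is a map whose differential is, with respect to the conformal structure of the light
  cone, symmetric and trace free. The function \<open>hopf\<close> plays the role of its Hopf differential.\<close>

locale dual_map =
  fixes U :: "complex set" and Xi :: "complex \<Rightarrow> real^4" and D :: "complex \<Rightarrow> complex \<Rightarrow> real^4" and t C :: real
  assumes U: "open U" and Xi: "twice_diff_on U Xi D" and t: "t * t = 1"
    and norm_Xi: "z \<in> U \<Longrightarrow> mink (Xi z) (Xi z) = C"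
    and perp: "z \<in> U \<Longrightarrow> mink (D z d) (lcone t z) = 0"
    and trace: "z \<in> U \<Longrightarrow> mink (D z 1) (lcone_deriv t z 1) + mink (D z \<i>) (lcone_deriv t z \<i>) = 0"
    and u_nonzero: "z \<in> U \<Longrightarrow> mink (Xi z) (lcone t z) \<noteq> 0"
begin

definition "u z = mink (Xi z) (lcone t z)"
definition "P z = mink (D z 1) (lcone_deriv t z 1)"
definition "Q z = mink (D z 1) (lcone_deriv t z \<i>)"
definition "hopf z = (complex_of_real (P z) - \<i> * complex_of_real (Q z)) / complex_of_real (u z)"
definition "D2 z a = frechet_derivative (\<lambda>z. D z a) (at z)"

lemma D2: "z \<in> U \<Longrightarrow> ((\<lambda>z. D z a) has_derivative D2 z a) (at z)"
  unfolding D2_def using frechet_derivative_works twice_diff_onD(2)[OF Xi] by blast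

lemma D2_sym: "z \<in> U \<Longrightarrow> D2 z a b = D2 z b a"
  by (rule symmetric_second_derivative[OF U _ twice_diff_onD(1)[OF Xi] D2 D2])

lemma u_deriv:
  assumes "z \<in> U"
  shows "(u has_derivative (\<lambda>d. mink (Xi z) (lcone_deriv t z d))) (at z)"
proof -
  have "((\<lambda>z. mink (Xi z) (lcone t z)) has_derivative
      (\<lambda>d. mink (Xi z) (lcone_deriv t z d) + mink (D z d) (lcone t z))) (at z)"
    by (rule mink.FDERIV[OF twice_diff_onD(1)[OF Xi assms] lcone_has_derivative])
  then show ?thesis unfolding u_def perp[OF assms] add_0_right .
qed

lemma DN_deriv:
  assumes "z \<in> U"
  shows "((\<lambda>z. mink (D z a) (lcone_deriv t z b)) has_derivative
    (\<lambda>d. 2 * (Re d * Re b + Im d * Im b) * mink (D z a) (lcone_axis t) + mink (D2 z a d) (lcone_deriv t z b))) (at z)"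
  using mink.FDERIV[OF D2[OF assms] lcone_deriv_has_derivative]
  unfolding mink.scaleR_right real_scaleR_def .

text \<open>Differentiating \<open>perp\<close> shows that this form is minus the product of the
  second derivative of \<open>Xi\<close> with \<open>lcone\<close>, and second derivatives are
  symmetric.\<close>

lemma sym: 
  assumes "z \<in> U"
  shows "mink (D z a) (lcone_deriv t z b) = mink (D z b) (lcone_deriv t z a)"
proof -
  have 0: "mink (D z a) (lcone_deriv t z b) + mink (D2 z a b) (lcone t z) = 0" for a b
  proof -
    have 1: "((\<lambda>z. mink (D z a) (lcone t z)) has_derivative
       (\<lambda>d. mink (D z a) (lcone_deriv t z d) + mink (D2 z a d) (lcone t z))) (at z)"
      by (rule mink.FDERIV[OF D2[OF assms] lcone_has_derivative])
    have 2: "((\<lambda>z. mink (D z a) (lcone t z)) has_derivative (\<lambda>d. 0)) (at z)"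
      by (rule has_derivative_transform_within_open[of "\<lambda>z. 0", OF _ U assms]) (auto simp: perp)
    show ?thesis using fun_cong[OF has_derivative_unique[OF 1 2], of b] .
  qed
  show ?thesis using 0[of a b] 0[of b a] unfolding D2_sym[OF assms, of a b] by linarith
qed

text \<open>Constancy of the norm makes \<open>D z d\<close> orthogonal to \<open>Xi z\<close>.
  Expanded in the frame of the cone, this determines the component of \<open>D z d\<close> along
  \<open>lcone_axis\<close> from the two others, since that along \<open>lcone\<close> is
  zero.\<close>

lemma axis_component:
  assumes z: "z \<in> U"
  shows "2 * mink (D z d) (lcone_axis t) * u z =
    mink (D z d) (lcone_deriv t z 1) * mink (Xi z) (lcone_deriv t z 1)
    + mink (D z d) (lcone_deriv t z \<i>) * mink (Xi z) (lcone_deriv t z \<i>)"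
proof -
  have 1: "((\<lambda>z. mink (Xi z) (Xi z)) has_derivative (\<lambda>d. mink (Xi z) (D z d) + mink (D z d) (Xi z))) (at z)"
    by (rule mink.FDERIV[OF twice_diff_onD(1)[OF Xi z] twice_diff_onD(1)[OF Xi z]])
  have 2: "((\<lambda>z. mink (Xi z) (Xi z)) has_derivative (\<lambda>d. 0)) (at z)"
    by (rule has_derivative_transform_within_open[of "\<lambda>z. C", OF _ U z]) (auto simp: norm_Xi)
  have "mink (Xi z) (D z d) + mink (D z d) (Xi z) = 0"
    using fun_cong[OF has_derivative_unique[OF 1 2], of d] .
  then have "mink (D z d) (Xi z) = 0" by (simp add: mink_commute)
  then show ?thesis
    using lcone_expansion[OF t, of "D z d" "Xi z" z] perp[OF z, of d] by (simp add: u_def)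
qed

text \<open>The Codazzi equations. By \<open>trace\<close> and \<open>sym\<close>, \<open>P\<close>
  and \<open>Q\<close> have two expressions each; in each direction the one is used whose derivative
  involves only the mixed second derivative \<open>D2 z 1 \<i>\<close>.\<close>

lemma PQ_deriv:
  assumes z: "z \<in> U"
  shows "(P has_derivative (\<lambda>d. Re d * - mink (D2 z 1 \<i>) (lcone_deriv t z \<i>)
      + Im d * mink (D2 z 1 \<i>) (lcone_deriv t z 1))) (at z)" (is "(P has_derivative ?p) _")
    "(Q has_derivative (\<lambda>d. Re d * (2 * mink (D z \<i>) (lcone_axis t) + mink (D2 z 1 \<i>) (lcone_deriv t z 1))
      + Im d * (2 * mink (D z 1) (lcone_axis t) + mink (D2 z 1 \<i>) (lcone_deriv t z \<i>)))) (at z)" (is "(Q has_derivative ?q) _")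
proof -
  let ?F = "\<lambda>a b d. 2 * (Re d * Re b + Im d * Im b) * mink (D z a) (lcone_axis t) + mink (D2 z a d) (lcone_deriv t z b)"
  have P: "(P has_derivative ?F 1 1) (at z)" and Q: "(Q has_derivative ?F 1 \<i>) (at z)"
    unfolding P_def Q_def by (rule DN_deriv[OF z])+
  have P': "(P has_derivative (\<lambda>d. - ?F \<i> \<i> d)) (at z)"
    by (rule has_derivative_transform_within_open[OF has_derivative_minus[OF DN_deriv[OF z, of \<i> \<i>]] U z])
      (auto dest!: trace simp: P_def)
  have Q': "(Q has_derivative ?F \<i> 1) (at z)"
    by (rule has_derivative_transform_within_open[OF DN_deriv[OF z, of \<i> 1] U z]) (use sym in \<open>simp add: Q_def\<close>)
  have "?F 1 1 = (\<lambda>d. - ?F \<i> \<i> d)" by (rule has_derivative_unique[OF P P'])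
  then have P1: "?F 1 1 1 = - ?F \<i> \<i> 1" by (rule fun_cong)
  have "?F 1 \<i> = ?F \<i> 1" by (rule has_derivative_unique[OF Q Q'])
  then have Q1: "?F 1 \<i> 1 = ?F \<i> 1 1" by (rule fun_cong)
  have "?F 1 1 = ?p"
  proof
    fix d
    have "?F 1 1 d = Re d * ?F 1 1 1 + Im d * ?F 1 1 \<i>"
      using linear_complex_exp[OF has_derivative_linear[OF P], of d] by simp
    then show "?F 1 1 d = ?p d" unfolding P1 by (simp add: D2_sym[OF z, of \<i> 1])
  qed
  with P show "(P has_derivative ?p) (at z)" by simp
  have "?F 1 \<i> = ?q"
  proof
    fix d
    have "?F 1 \<i> d = Re d * ?F 1 \<i> 1 + Im d * ?F 1 \<i> \<i>"
      using linear_complex_exp[OF has_derivative_linear[OF Q], of d] by simp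
    then show "?F 1 \<i> d = ?q d" unfolding Q1 by (simp add: D2_sym[OF z, of \<i> 1])
  qed
  with Q show "(Q has_derivative ?q) (at z)" by simp
qed

text \<open>By \<open>PQ_deriv\<close> the numerator fails the Cauchy-Riemann equations by twice the
  components of \<open>D\<close> along \<open>lcone_axis\<close>. By \<open>axis_component\<close>
  the division by \<open>u\<close> compensates exactly this defect.\<close>

lemma hopf_holomorphic: "hopf holomorphic_on U"
proof -
  have "\<exists>h'. (hopf has_field_derivative h') (at z)" if z: "z \<in> U" for z
  proof -
    define e1 ei w1 wi u1 ui where "e1 = mink (D z 1) (lcone_axis t)" and "ei = mink (D z \<i>) (lcone_axis t)"
      and "w1 = mink (D2 z 1 \<i>) (lcone_deriv t z 1)" and "wi = mink (D2 z 1 \<i>) (lcone_deriv t z \<i>)"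
      and "u1 = mink (Xi z) (lcone_deriv t z 1)" and "ui = mink (Xi z) (lcone_deriv t z \<i>)"
    have u: "u z \<noteq> 0" using u_nonzero[OF z] by (simp add: u_def)
    have ax: "2 * e1 * u z = P z * u1 + Q z * ui" "2 * ei * u z = Q z * u1 - P z * ui"
    proof -
      show "2 * e1 * u z = P z * u1 + Q z * ui"
        using axis_component[OF z, of 1] by (simp add: e1_def P_def Q_def u1_def ui_def)
      have "mink (D z \<i>) (lcone_deriv t z \<i>) = - P z" "mink (D z \<i>) (lcone_deriv t z 1) = Q z"
        using trace[OF z] sym[OF z, of 1 \<i>] by (simp_all add: P_def Q_def)
      then show "2 * ei * u z = Q z * u1 - P z * ui"
        using axis_component[OF z, of \<i>] by (simp add: ei_def u1_def ui_def)
    qed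
    let ?p = "\<lambda>d. Re d * - wi + Im d * w1" and ?q = "\<lambda>d. Re d * (2 * ei + w1) + Im d * (2 * e1 + wi)"
      and ?u = "\<lambda>d. mink (Xi z) (lcone_deriv t z d)"
    have p: "(P has_derivative ?p) (at z)" and q: "(Q has_derivative ?q) (at z)"
      using PQ_deriv[OF z] by (simp_all add: e1_def ei_def w1_def wi_def)
    note ud = u_deriv[OF z]
    have 1: "((\<lambda>z. P z / u z) has_derivative (\<lambda>d. (?p d * u z - P z * ?u d) / (u z * u z))) (at z)"
      by (rule has_derivative_divide'[OF p ud u])
    have 2: "((\<lambda>z. Q z / u z) has_derivative (\<lambda>d. (?q d * u z - Q z * ?u d) / (u z * u z))) (at z)"
      by (rule has_derivative_divide'[OF q ud u])
    have 3: "hopf = (\<lambda>z. complex_of_real (P z / u z) - \<i> * complex_of_real (Q z / u z))"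
      by (rule ext) (simp add: hopf_def diff_divide_distrib)
    have 4: "(hopf has_derivative (\<lambda>d. complex_of_real ((?p d * u z - P z * ?u d) / (u z * u z))
        - \<i> * complex_of_real ((?q d * u z - Q z * ?u d) / (u z * u z)))) (at z)"
      unfolding 3 by (intro has_derivative_diff has_derivative_mult_right has_derivative_of_real 1 2)
    \<comment> \<open>Facts \<open>5\<close> and \<open>6\<close> are the Cauchy-Riemann equations
      for the real part \<open>P / u\<close> and the imaginary part \<open>- Q / u\<close>.\<close>
    have 5: "(?p \<i> * u z - P z * ?u \<i>) / (u z * u z) = (?q 1 * u z - Q z * ?u 1) / (u z * u z)"
      using ax(2) by (simp add: u1_def ui_def algebra_simps)
    have 6: "(?p 1 * u z - P z * ?u 1) / (u z * u z) = - ((?q \<i> * u z - Q z * ?u \<i>) / (u z * u z))"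
      using ax(1) unfolding minus_divide_left by (simp add: u1_def ui_def algebra_simps)
    have "complex_of_real a - \<i> * complex_of_real b = \<i> * (complex_of_real (- b) - \<i> * complex_of_real a)" for a b
      by (simp add: algebra_simps)
    then show ?thesis
      by (intro exI, rule cauchy_riemann[OF 4, unfolded 5 6])
  qed
  then show ?thesis using U by (simp add: holomorphic_on_open)
qed

text \<open>If \<open>P\<close> and \<open>Q\<close> vanish, then \<open>trace\<close> and
  \<open>sym\<close> kill all components along the partial derivatives of \<open>lcone\<close>, and
  \<open>axis_component\<close> and \<open>perp\<close> kill the remaining two.\<close>

lemma differential_zero_iff:
  assumes z: "z \<in> U"
  shows "hopf z = 0 \<longleftrightarrow> D z 1 = 0 \<and> D z \<i> = 0"
proof
  have u: "u z \<noteq> 0" using u_nonzero[OF z] by (simp add: u_def)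
  assume "hopf z = 0"
  then have "complex_of_real (P z) - \<i> * complex_of_real (Q z) = 0" using u by (simp add: hopf_def)
  then have PQ: "P z = 0" "Q z = 0" by (simp_all add: complex_eq_iff)
  have *: "mink (D z d) (lcone_deriv t z a) = 0" if "d \<in> {1, \<i>}" "a \<in> {1, \<i>}" for d a
    using that PQ trace[OF z] sym[OF z, of 1 \<i>] by (auto simp: P_def Q_def)
  have "D z d = 0" if d: "d \<in> {1, \<i>}" for d
  proof (rule mink_nondegenerate)
    have "mink (D z d) (lcone_axis t) = 0" using axis_component[OF z, of d] * d u by simp
    then show "mink (D z d) w = 0" for w
      using lcone_expansion[OF t, of "D z d" w z] * d perp[OF z, of d] by simp
  qed
  then show "D z 1 = 0 \<and> D z \<i> = 0" by simp
next
  assume "D z 1 = 0 \<and> D z \<i> = 0"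
  then show "hopf z = 0" by (simp add: hopf_def P_def Q_def mink_bilinear)
qed

text \<open>If \<open>\<bar>hopf\<bar>\<close> is a constant multiple of \<open>u\<close> to the power \<open>-2\<close> then \<open>log u\<close> is harmonic, and this
  makes \<open>Xi\<close> lightlike.\<close>

lemma lightlike_if_constant:
  assumes z: "z \<in> U" and K: "K \<noteq> 0" and const: "\<And>z. z \<in> U \<Longrightarrow> ((P z)\<^sup>2 + (Q z)\<^sup>2) * (u z)\<^sup>2 = K"
  shows "C = 0"
proof -
  have u0: "u z \<noteq> 0" if "z \<in> U" for z using u_nonzero[OF that] by (simp add: u_def)
  have h0: "hopf z \<noteq> 0" if "z \<in> U" for z
  proof
    assume "hopf z = 0"
    then have "P z = 0" "Q z = 0" using differential_zero_iff[OF that] by (simp_all add: P_def Q_def mink_bilinear)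
    then show False using const[OF that] K by simp
  qed
  \<comment> \<open>The logarithmic derivative of \<open>hopf\<close>. Constancy of |hopf|^2 u^4
    means 2 d(log u) = - Re (chi dz), which is fact \<open>grad\<close>; holomorphy of
    \<open>chi\<close> then expresses that log u is harmonic.\<close>
  define chi where "chi z = deriv hopf z / hopf z" for z
  have hol: "chi holomorphic_on U"
    unfolding chi_def by (intro holomorphic_intros holomorphic_deriv hopf_holomorphic U h0)
  have hd: "(hopf has_field_derivative chi z * hopf z) (at z)" if "z \<in> U" for z
    using holomorphic_derivI[OF hopf_holomorphic U that] h0[OF that] by (simp add: chi_def)
  let ?N = "\<lambda>z d. mink (Xi z) (lcone_deriv t z d)"
  have const': "(u z)^4 * ((Re (hopf z))\<^sup>2 + (Im (hopf z))\<^sup>2) = K" if "z \<in> U" for z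
  proof -
    have "P z = Re (hopf z) * u z" "Q z = - (Im (hopf z) * u z)" using u0[OF that] by (simp_all add: hopf_def)
    then have "(u z)^4 * ((Re (hopf z))\<^sup>2 + (Im (hopf z))\<^sup>2) = ((P z)\<^sup>2 + (Q z)\<^sup>2) * (u z)\<^sup>2"
      by (simp only:) (simp add: algebra_simps power2_eq_square power4_eq_xxxx)
    then show ?thesis using const[OF that] by simp
  qed
  have grad: "2 * ?N z d = - u z * Re (chi z * d)" if z: "z \<in> U" for z d
  proof -
    let ?h = "\<lambda>d. chi z * hopf z * d"
    have 0: "(hopf has_derivative ?h) (at z)" using hd[OF z] by (simp add: has_field_derivative_def)
    have 1: "((\<lambda>z. (u z)^4 * ((Re (hopf z))\<^sup>2 + (Im (hopf z))\<^sup>2)) has_derivative (\<lambda>d.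
       (u z)^4 * (2 * Re (?h d) * Re (hopf z) + 2 * Im (?h d) * Im (hopf z)) +
       4 * ?N z d * (u z)^3 * ((Re (hopf z))\<^sup>2 + (Im (hopf z))\<^sup>2))) (at z)"
      by (rule derivative_eq_intros u_deriv[OF z] 0 refl ext | simp)+
    have 2: "((\<lambda>z. (u z)^4 * ((Re (hopf z))\<^sup>2 + (Im (hopf z))\<^sup>2)) has_derivative (\<lambda>d. 0)) (at z)"
      by (rule has_derivative_transform_within_open[of "\<lambda>z. K", OF _ U z]) (auto simp: const')
    have "(u z)^4 * (2 * Re (?h d) * Re (hopf z) + 2 * Im (?h d) * Im (hopf z)) +
       4 * ?N z d * (u z)^3 * ((Re (hopf z))\<^sup>2 + (Im (hopf z))\<^sup>2) = 0"
      using fun_cong[OF has_derivative_unique[OF 1 2], of d] .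
    moreover have "2 * Re (?h d) * Re (hopf z) + 2 * Im (?h d) * Im (hopf z) =
       2 * Re (chi z * d) * ((Re (hopf z))\<^sup>2 + (Im (hopf z))\<^sup>2)"
      by (simp add: algebra_simps power2_eq_square)
    ultimately have "2 * (u z)^3 * ((Re (hopf z))\<^sup>2 + (Im (hopf z))\<^sup>2) * (u z * Re (chi z * d) + 2 * ?N z d) = 0"
      by (simp add: algebra_simps power2_eq_square power3_eq_cube power4_eq_xxxx)
    moreover have "(Re (hopf z))\<^sup>2 + (Im (hopf z))\<^sup>2 \<noteq> 0" using const'[OF z] K by auto
    ultimately have "u z * Re (chi z * d) + 2 * ?N z d = 0" using u0[OF z] by (simp only: mult_eq_0_iff) auto
    then show ?thesis by simp
  qed
  define L where "L = deriv chi z"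
  have chid: "(chi has_derivative (\<lambda>d. L * d)) (at z)"
    using holomorphic_derivI[OF hol U z] by (simp add: has_field_derivative_def L_def)
  have second: "2 * (2 * (Re b * Re b + Im b * Im b) * mink (Xi z) (lcone_axis t) + mink (D z b) (lcone_deriv t z b)) =
      - (u z * Re (L * b * b) + ?N z b * Re (chi z * b))" for b
  proof -
    have 1: "((\<lambda>z. 2 * ?N z b) has_derivative (\<lambda>d. 2 * (2 * (Re d * Re b + Im d * Im b) * mink (Xi z) (lcone_axis t)
       + mink (D z d) (lcone_deriv t z b)))) (at z)"
      using has_derivative_mult_right[OF mink.FDERIV[OF twice_diff_onD(1)[OF Xi z] lcone_deriv_has_derivative], of 2]
      by (simp add: mink_bilinear)
    have "((\<lambda>z. - u z * Re (chi z * b)) has_derivative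
       (\<lambda>d. - (u z * Re (L * d * b) + ?N z d * Re (chi z * b)))) (at z)"
      by (rule derivative_eq_intros u_deriv[OF z] chid refl ext | simp)+
    then have 2: "((\<lambda>z. 2 * ?N z b) has_derivative
       (\<lambda>d. - (u z * Re (L * d * b) + ?N z d * Re (chi z * b)))) (at z)"
      by (rule has_derivative_transform_within_open[OF _ U z]) (simp add: grad)
    show ?thesis using fun_cong[OF has_derivative_unique[OF 1 2], of b] .
  qed
  \<comment> \<open>The directions 1 and \<i> are added, as in a Laplacian: the terms with
    \<open>L\<close> cancel because \<i>^2 = -1, and those with \<open>D\<close> cancel by
    \<open>trace\<close>.\<close>
  have eight: "8 * mink (Xi z) (lcone_axis t) = - (?N z 1 * Re (chi z * 1) + ?N z \<i> * Re (chi z * \<i>))"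
    using second[of 1] second[of \<i>] trace[OF z] by simp
  have "u z * (8 * mink (Xi z) (lcone_axis t)) = ?N z 1 * (- u z * Re (chi z * 1)) + ?N z \<i> * (- u z * Re (chi z * \<i>))"
    unfolding eight by (simp add: algebra_simps)
  also have "\<dots> = 2 * (?N z 1 * ?N z 1 + ?N z \<i> * ?N z \<i>)"
    unfolding grad[OF z, symmetric] by simp
  finally have "4 * mink (Xi z) (Xi z) = 0"
    using lcone_expansion[OF t, of "Xi z" "Xi z" z] by (simp add: u_def algebra_simps)
  then show "C = 0" using norm_Xi[OF z] by simp
qed

end

subsection \<open>Fronts in a coordinate patch\<close>

lemma alternating_exp:
  fixes g :: "complex \<Rightarrow> complex \<Rightarrow> real"
  assumes "\<And>b. linear (\<lambda>a. g a b)" "\<And>a. linear (g a)" "\<And>a. g a a = 0"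
  shows "g a b = (Re a * Im b - Im a * Re b) * g 1 \<i>"
proof -
  have sw: "g \<i> 1 = - g 1 \<i>"
  proof -
    have "g (1 + \<i>) (1 + \<i>) = g 1 1 + g 1 \<i> + g \<i> 1 + g \<i> \<i>"
      by (simp add: linear_add[OF assms(1)] linear_add[OF assms(2)])
    then show ?thesis using assms(3) by simp
  qed
  have "g a b = Re a * g 1 b + Im a * g \<i> b"
    using linear_complex_exp[OF assms(1)[of b], of a] by simp
  moreover have "g 1 b = Im b * g 1 \<i>" "g \<i> b = - Re b * g 1 \<i>"
    using linear_complex_exp[OF assms(2)[of 1], of b] linear_complex_exp[OF assms(2)[of \<i>], of b] assms(3) sw by simp_all
  ultimately show ?thesis by (simp add: algebra_simps)
qed

lemma alternating_vol:
  assumes "linear L" "linear M"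
  shows "vol f n (L a) (M b) + vol f n (M a) (L b) =
    (Re a * Im b - Im a * Re b) * (vol f n (L 1) (M \<i>) + vol f n (M 1) (L \<i>))"
proof (rule alternating_exp[where g = "\<lambda>a b. vol f n (L a) (M b) + vol f n (M a) (L b)"])
  show "linear (\<lambda>a. vol f n (L a) (M b) + vol f n (M a) (L b))" for b
    by (rule linearI) (simp_all add: linear_add[OF assms(1)] linear_add[OF assms(2)] linear_scale[OF assms(1)]
      linear_scale[OF assms(2)] vol_bilinear algebra_simps)
  show "linear (\<lambda>b. vol f n (L a) (M b) + vol f n (M a) (L b))" for a
    by (rule linearI) (simp_all add: linear_add[OF assms(1)] linear_add[OF assms(2)] linear_scale[OF assms(1)]
      linear_scale[OF assms(2)] vol_bilinear algebra_simps)
  show "vol f n (L a) (M a) + vol f n (M a) (L a) = 0" for a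
    using vol_swap[of f n "L a" "M a"] by simp
qed

lemma alternating_vol_same:
  assumes "linear L"
  shows "vol f n (L a) (L b) = (Re a * Im b - Im a * Re b) * vol f n (L 1) (L \<i>)"
  using alternating_vol[OF assms assms, of f n a b] by simp

lemma linear_lincomb: "linear f \<Longrightarrow> linear g \<Longrightarrow> linear (\<lambda>d. c *\<^sub>R f d + e *\<^sub>R g d)"
  by (rule linearI) (simp_all add: linear_add linear_scale algebra_simps)

lemma twice_diff_on_subset: "twice_diff_on S f Df \<Longrightarrow> T \<subseteq> S \<Longrightarrow> twice_diff_on T f Df"
  by (auto simp: twice_diff_on_def)

lemma twice_diff_on_lincomb:
  assumes "twice_diff_on S f Df" "twice_diff_on S g Dg"
  shows "twice_diff_on S (\<lambda>p. c *\<^sub>R f p + e *\<^sub>R g p) (\<lambda>p d. c *\<^sub>R Df p d + e *\<^sub>R Dg p d)"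
  unfolding twice_diff_on_def
proof (intro ballI conjI allI)
  fix p v assume p: "p \<in> S"
  show "((\<lambda>p. c *\<^sub>R f p + e *\<^sub>R g p) has_derivative (\<lambda>d. c *\<^sub>R Df p d + e *\<^sub>R Dg p d)) (at p)"
    by (intro has_derivative_add has_derivative_scaleR_right twice_diff_onD[OF assms(1) p] twice_diff_onD[OF assms(2) p])
  show "(\<lambda>x. c *\<^sub>R Df x v + e *\<^sub>R Dg x v) differentiable (at p)"
    by (intro differentiable_add differentiable_scaleR differentiable_const twice_diff_onD[OF assms(1) p] twice_diff_onD[OF assms(2) p])
qed

lemma twice_diff_on_compose:
  assumes f: "twice_diff_on S f Df" and w: "twice_diff_on T w Dw" and sub: "w ` T \<subseteq> S" and T: "open T"
  shows "twice_diff_on T (\<lambda>z. f (w z)) (\<lambda>z d. Df (w z) (Dw z d))"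
  unfolding twice_diff_on_def
proof (intro ballI conjI allI)
  fix z v assume z: "z \<in> T"
  then have p: "w z \<in> S" using sub by blast
  show "((\<lambda>z. f (w z)) has_derivative (\<lambda>d. Df (w z) (Dw z d))) (at z)"
    by (rule has_derivative_compose[where g = f, OF twice_diff_onD(1)[OF w z] twice_diff_onD(1)[OF f p]])
  have wd: "w differentiable (at z)" using twice_diff_onD(1)[OF w z] differentiableI by blast
  have c: "(\<lambda>z. Df (w z) a) differentiable (at z)" for a
    by (rule differentiable_compose[where f = "\<lambda>p. Df p a" and g = w, OF twice_diff_onD(2)[OF f p] wd])
  have re: "(\<lambda>z. Re (Dw z v)) differentiable (at z)" "(\<lambda>z. Im (Dw z v)) differentiable (at z)"
    using twice_diff_onD(2)[OF w z, of v] has_derivative_Re has_derivative_Im unfolding differentiable_def by blast+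
  have "(\<lambda>z. Re (Dw z v) *\<^sub>R Df (w z) 1 + Im (Dw z v) *\<^sub>R Df (w z) \<i>) differentiable (at z)"
    by (intro differentiable_add differentiable_scaleR re c)
  then obtain L where L: "((\<lambda>z. Re (Dw z v) *\<^sub>R Df (w z) 1 + Im (Dw z v) *\<^sub>R Df (w z) \<i>) has_derivative L) (at z)"
    unfolding differentiable_def by blast
  have "((\<lambda>z. Df (w z) (Dw z v)) has_derivative L) (at z)"
    by (rule has_derivative_transform_within_open[OF L T z], rule linear_complex_exp[symmetric])
      (use twice_diff_onD(3)[OF f] sub in auto)
  then show "(\<lambda>z. Df (w z) (Dw z v)) differentiable (at z)"
    unfolding differentiable_def by blast
qed

lemma isCont_twice: "twice_diff_on S f Df \<Longrightarrow> open S \<Longrightarrow> continuous_on S f"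
  by (auto simp: twice_diff_on_def continuous_on_eq_continuous_at intro: has_derivative_continuous)

lemma isCont_twice_deriv: "twice_diff_on S f Df \<Longrightarrow> open S \<Longrightarrow> continuous_on S (\<lambda>p. Df p v)"
  by (auto simp: twice_diff_on_def continuous_on_eq_continuous_at intro: differentiable_imp_continuous_within)

text \<open>A co-oriented front in one coordinate domain. \<open>F\<close> itself may be singular;
  only the pair \<open>(F, V)\<close> is immersed.\<close>

locale front_patch =
  fixes S :: "complex set" and F V :: "complex \<Rightarrow> real^4" and DF DV :: "complex \<Rightarrow> complex \<Rightarrow> real^4"
  assumes S: "open S" and F: "twice_diff_on S F DF" and V: "twice_diff_on S V DV"
    and norm_F: "p \<in> S \<Longrightarrow> mink (F p) (F p) = -1" and norm_V: "p \<in> S \<Longrightarrow> mink (V p) (V p) = 1"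
    and perp_FV: "p \<in> S \<Longrightarrow> mink (F p) (V p) = 0"
    and orth: "p \<in> S \<Longrightarrow> mink (DF p d) (V p) = 0"
    and immersed: "p \<in> S \<Longrightarrow> DF p d = 0 \<Longrightarrow> DV p d = 0 \<Longrightarrow> d = 0"
begin

definition "qA p = vol (F p) (V p) (DF p 1) (DF p \<i>)"
definition "qT p = vol (F p) (V p) (DV p 1) (DV p \<i>)"
definition "qM p = mixed_vol (F p) (V p) (DF p 1) (DF p \<i>) (DV p 1) (DV p \<i>)"

lemma zero_derivative:
  assumes "p \<in> S" "(f has_derivative L) (at p)" "\<And>p. p \<in> S \<Longrightarrow> f p = (c::real)"
  shows "L d = 0"
proof -
  have "(f has_derivative (\<lambda>d. 0)) (at p)"
    by (rule has_derivative_transform_within_open[of "\<lambda>z. c", OF _ S assms(1)]) (auto simp: assms(3))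
  then show ?thesis using fun_cong[OF has_derivative_unique[OF assms(2)], of "\<lambda>d. 0" d] by simp
qed

lemmas DF = twice_diff_onD[OF F] and DV = twice_diff_onD[OF V]

lemma tangent:
  assumes p: "p \<in> S"
  shows "DF p d \<in> perp2 (F p) (V p)" "DV p d \<in> perp2 (F p) (V p)"
proof -
  have "mink (F p) (DF p d) + mink (DF p d) (F p) = 0"
    by (rule zero_derivative[OF p mink.FDERIV[OF DF(1)[OF p] DF(1)[OF p]]]) (rule norm_F)
  moreover have "mink (V p) (DV p d) + mink (DV p d) (V p) = 0"
    by (rule zero_derivative[OF p mink.FDERIV[OF DV(1)[OF p] DV(1)[OF p]]]) (rule norm_V)
  moreover have "mink (F p) (DV p d) + mink (DF p d) (V p) = 0"
    by (rule zero_derivative[OF p mink.FDERIV[OF DF(1)[OF p] DV(1)[OF p]]]) (rule perp_FV)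
  ultimately show "DF p d \<in> perp2 (F p) (V p)" "DV p d \<in> perp2 (F p) (V p)"
    using orth[OF p, of d] by (simp_all add: perp2_def mink_commute[of "F p"] mink_commute[of "V p"])
qed

text \<open>Differentiating \<open>orth\<close> reduces this to the symmetry of the second
  derivatives of \<open>F\<close>, so it holds at singular points as well.\<close>

lemma second_form_sym:
  assumes p: "p \<in> S"
  shows "mink (DF p a) (DV p b) = mink (DF p b) (DV p a)"
proof -
  have der: "((\<lambda>p. DF p a) has_derivative frechet_derivative (\<lambda>p. DF p a) (at p)) (at p)" for a
    using DF(2)[OF p] frechet_derivative_works by blast
  have 0: "mink (DF p a) (DV p b) + mink (frechet_derivative (\<lambda>p. DF p a) (at p) b) (V p) = 0" for a b
    by (rule zero_derivative[OF p mink.FDERIV[OF der DV(1)[OF p]]]) (rule orth)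
  have "frechet_derivative (\<lambda>p. DF p a) (at p) b = frechet_derivative (\<lambda>p. DF p b) (at p) a"
    by (rule symmetric_second_derivative[OF S p DF(1) der der])
  then show ?thesis using 0[of a b] 0[of b a] by simp
qed

lemma data:
  assumes p: "p \<in> S"
  shows "front_data (F p) (V p) (DF p 1) (DF p \<i>) (DV p 1) (DV p \<i>)"
  unfolding front_data_def
proof (intro conjI allI impI norm_F norm_V perp_FV tangent p second_form_sym; elim conjE)
  fix x y assume 0: "x *\<^sub>R DF p 1 + y *\<^sub>R DF p \<i> = 0" "x *\<^sub>R DV p 1 + y *\<^sub>R DV p \<i> = 0"
  have "Complex x y = 0"
    by (rule immersed[OF p]) (use 0 linear_complex_exp[OF DF(3)[OF p], of "Complex x y"]
      linear_complex_exp[OF DV(3)[OF p], of "Complex x y"] in simp_all)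
  then show "x = 0" "y = 0" by (simp_all add: complex_eq_iff)
qed

lemma cont: "continuous_on S qA" "continuous_on S qT" "continuous_on S qM"
  unfolding qA_def qT_def qM_def mixed_vol_def
  by (intro continuous_on_vol continuous_on_add isCont_twice[OF F S] isCont_twice[OF V S]
    isCont_twice_deriv[OF F S] isCont_twice_deriv[OF V S])+

text \<open>\<open>beta\<close> is the differential of the lightlike Gauss map \<open>F + V\<close>, and \<open>xi\<close> that of the companion
  \<open>(s - 1) F + (s + 1) V\<close>. The Weingarten equation \<open>weing\<close> says that their mixed area vanishes.\<close>

definition "beta p d = DF p d + DV p d"
definition "xi s p d = (s - 1) *\<^sub>R DF p d + (s + 1) *\<^sub>R DV p d"
definition "B p = qA p + qM p + qT p"
definition "weing s p \<longleftrightarrow> qA p - qT p = s * B p"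

lemma linear_beta: "p \<in> S \<Longrightarrow> linear (beta p)" "p \<in> S \<Longrightarrow> linear (xi s p)"
  unfolding beta_def xi_def using linear_lincomb[OF DF(3) DV(3), of p p 1 1] linear_lincomb[OF DF(3) DV(3), of p p] by simp_all

lemma linear_zero_iff: "linear L \<Longrightarrow> (\<forall>d. L d = 0) \<longleftrightarrow> L 1 = 0 \<and> L \<i> = (0::real^4)"
  using linear_complex_exp[of L] by (metis add_0 scaleR_zero_right)

lemma vol_beta: "p \<in> S \<Longrightarrow> vol (F p) (V p) (beta p 1) (beta p \<i>) = B p"
  using vol_lincomb[of "F p" "V p" 1 "DF p 1" 1 "DV p 1" "DF p \<i>" "DV p \<i>"]
  by (simp add: beta_def B_def qA_def qM_def qT_def)

lemma vol_xi: "p \<in> S \<Longrightarrow> vol (F p) (V p) (xi s p 1) (xi s p \<i>) =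
    (s - 1)\<^sup>2 * qA p + (s\<^sup>2 - 1) * qM p + (s + 1)\<^sup>2 * qT p"
proof -
  have "(s - 1) * (s + 1) = s\<^sup>2 - 1" by (simp add: power2_eq_square algebra_simps)
  then show ?thesis
    using vol_lincomb[of "F p" "V p" "s - 1" "DF p 1" "s + 1" "DV p 1" "DF p \<i>" "DV p \<i>"]
    by (simp add: xi_def qA_def qM_def qT_def)
qed

lemma mixed_xi_beta:
  assumes "weing s p"
  shows "vol (F p) (V p) (xi s p 1) (beta p \<i>) + vol (F p) (V p) (beta p 1) (xi s p \<i>) = 0"
proof -
  have "vol (F p) (V p) (xi s p 1) (beta p \<i>) + vol (F p) (V p) (beta p 1) (xi s p \<i>) =
    2 * (s * B p - (qA p - qT p))"
    using mixed_vol_lincomb[of "F p" "V p" 1 "DF p 1" 1 "DV p 1" "DF p \<i>" "DV p \<i>" "s - 1" "s + 1"]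
    unfolding xi_def beta_def B_def qA_def qM_def qT_def mixed_vol_def scaleR_one by (simp add: algebra_simps)
  then show ?thesis using assms by (simp add: weing_def)
qed

lemma beta_zero:
  assumes "p \<in> S" "qA p = qT p" "B p = 0"
  shows "beta p d = 0"
  using gauss_map_rank[OF data[OF assms(1)]] assms linear_zero_iff[OF linear_beta(1)[OF assms(1)]]
  by (simp add: beta_def B_def qA_def qM_def qT_def)

lemma xi_zero:
  assumes p: "p \<in> S" and "weing s p" "(s - 1)\<^sup>2 * qA p + (s\<^sup>2 - 1) * qM p + (s + 1)\<^sup>2 * qT p = 0"
  shows "xi s p d = 0"
proof -
  have "xi s p 1 = 0 \<and> xi s p \<i> = 0"
    using companion_rank[OF data[OF p], of s] assms(2,3)
    by (simp add: xi_def weing_def B_def qA_def qM_def qT_def)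
  then show ?thesis using linear_zero_iff[OF linear_beta(2)[OF p]] by blast
qed

lemma xi_beta_inj:
  assumes p: "p \<in> S" and "xi s p d = 0" "beta p d = 0"
  shows "d = 0"
proof -
  have V: "DV p d = - DF p d" using assms(3) by (simp add: beta_def eq_neg_iff_add_eq_0 add.commute)
  then have "2 *\<^sub>R DF p d = 0" using assms(2) by (simp add: xi_def algebra_simps scaleR_2)
  then show ?thesis using immersed[OF p] V by simp
qed

end

section \<open>The direction of the lightlike Gauss map as a coordinate\<close>

text \<open>Stereographic projection of a null direction. The number \<open>m\<close> vanishes only
  on the line over the pole selected by \<open>t\<close>.\<close>

lemma lightlike_eq_cone:
  assumes t: "t * t = 1" and null: "mink v v = 0" and m: "m = v $ 0 - t * v $ 3" "m \<noteq> 0"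
  shows "v = (m / 2) *\<^sub>R lcone t (Complex (v $ 1 / m) (v $ 2 / m))"
proof -
  have "t = 1 \<or> t = -1" using t by (simp add: square_eq_1_iff)
  then have "(v $ 1)\<^sup>2 + (v $ 2)\<^sup>2 = m * (v $ 0 + t * v $ 3)"
    using null by (auto simp: m(1) mink_def power2_eq_square algebra_simps)
  then have "((v $ 1)\<^sup>2 + (v $ 2)\<^sup>2) / m = v $ 0 + t * v $ 3" using m(2) by (simp add: field_simps)
  then have n: "m * ((v $ 1 / m)\<^sup>2 + (v $ 2 / m)\<^sup>2) = v $ 0 + t * v $ 3"
    using m(2) by (simp add: power2_eq_square field_simps)
  have tt: "t * (t * r) = r" for r using t by (simp flip: mult.assoc)
  have "m * (1 + ((v $ 1 / m)\<^sup>2 + (v $ 2 / m)\<^sup>2)) = 2 * v $ 0"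
    using n m(1) by (simp only: distrib_left mult_1_right)
  moreover have "m * (t * ((v $ 1 / m)\<^sup>2 + (v $ 2 / m)\<^sup>2 - 1)) = 2 * v $ 3"
  proof -
    have "m * (t * ((v $ 1 / m)\<^sup>2 + (v $ 2 / m)\<^sup>2 - 1)) = t * (m * ((v $ 1 / m)\<^sup>2 + (v $ 2 / m)\<^sup>2) - m)"
      by (simp add: algebra_simps)
    also have "\<dots> = t * (2 * (t * v $ 3))" unfolding n using m(1) by simp
    also have "\<dots> = 2 * v $ 3" using tt[of "2 * v $ 3"] by (simp add: algebra_simps)
    finally show ?thesis .
  qed
  ultimately show ?thesis using m(2)
    by (intro vec4_eqI) (simp_all add: lcone_nth)
qed

text \<open>The inverse function theorem with one more derivative: the differential of the inverse
  is rational in that of \<open>z\<close> taken along the inverse, hence differentiable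
  again.\<close>

lemma inverse_coordinates:
  fixes z :: "complex \<Rightarrow> complex"
  assumes S: "open S" and z: "twice_diff_on S z Dz" and q: "q \<in> S"
    and inj: "\<And>p d. p \<in> S \<Longrightarrow> Dz p d = 0 \<Longrightarrow> d = 0"
  obtains r w Dw where "r > 0" "w (z q) = q" "open (w ` ball (z q) r)" "w ` ball (z q) r \<subseteq> S"
    "\<And>\<zeta>. \<zeta> \<in> ball (z q) r \<Longrightarrow> z (w \<zeta>) = \<zeta>" "twice_diff_on (ball (z q) r) w Dw"
    "\<And>\<zeta> d. \<zeta> \<in> ball (z q) r \<Longrightarrow> Dz (w \<zeta>) (Dw \<zeta> d) = d"
proof -
  note zD = twice_diff_onD[OF z]
  have bl: "bounded_linear (Dz p)" if "p \<in> S" for p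
    using zD(1)[OF that] has_derivative_bounded_linear by blast
  have app: "blinfun_apply (Blinfun (Dz p)) = Dz p" if "p \<in> S" for p
    by (rule bounded_linear_Blinfun_apply[OF bl[OF that]])
  have injp: "inj (Dz p)" if "p \<in> S" for p
    using inj[OF that] linear_injective_0[OF zD(3)[OF that]] by blast
  obtain g where g: "linear g" "g \<circ> Dz q = id"
    using linear_injective_left_inverse[OF zD(3)[OF q] injp[OF q]] by blast
  have 1: "(z has_derivative blinfun_apply (Blinfun (Dz p))) (at p)" if "p \<in> S" for p
    using zD(1)[OF that] app[OF that] by simp
  have 2: "continuous_on S (\<lambda>p. Blinfun (Dz p))"
  proof (rule continuous_on_blinfun_componentwise)
    fix i :: complex
    have "continuous_on S (\<lambda>p. Dz p i)" by (rule isCont_twice_deriv[OF z S])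
    then show "continuous_on S (\<lambda>p. blinfun_apply (Blinfun (Dz p)) i)"
      by (rule continuous_on_eq) (simp add: app)
  qed
  have 3: "Blinfun g o\<^sub>L Blinfun (Dz q) = id_blinfun"
    using g app[OF q] bounded_linear_Blinfun_apply[of g]
    by (intro blinfun_eqI) (simp add: linear_conv_bounded_linear fun_eq_iff)
  obtain U' V' w w' where U': "open U'" "U' \<subseteq> S" "q \<in> U'" and V': "open V'" "z q \<in> V'"
    and hom: "homeomorphism U' V' z w"
    and w': "\<And>y. y \<in> V' \<Longrightarrow> (w has_derivative w' y) (at y)"
    and w'_inv: "\<And>y. y \<in> V' \<Longrightarrow> w' y = inv_into UNIV (blinfun_apply (Blinfun (Dz (w y))))"
    by (rule inverse_function_theorem[OF S 1 2 q 3], assumption) (rule that, assumption+)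
  obtain r where r: "r > 0" "ball (z q) r \<subseteq> V'" using V' open_contains_ball by blast
  let ?O = "ball (z q) r"
  have wU: "w y \<in> U'" "z (w y) = y" if "y \<in> V'" for y
    using hom that by (auto simp: homeomorphism_def)
  have wS: "w y \<in> S" if "y \<in> V'" for y using wU[OF that] U' by blast
  \<comment> \<open>Cramer's rule for the inverse of a real-linear \<open>L\<close>, written out so
    that differentiability of \<open>Dw\<close> can be read off from the formula.\<close>
  define E where "E L d = Complex ((Re d * Im (L \<i>) - Im d * Re (L \<i>)) / (Re (L 1) * Im (L \<i>) - Im (L 1) * Re (L \<i>)))
      ((Re (L 1) * Im d - Im (L 1) * Re d) / (Re (L 1) * Im (L \<i>) - Im (L 1) * Re (L \<i>)))" for L :: "complex \<Rightarrow> complex" and d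
  have jac: "Re (L 1) * Im (L \<i>) - Im (L 1) * Re (L \<i>) \<noteq> 0" if L: "linear L" "inj L" for L :: "complex \<Rightarrow> complex"
  proof
    assume 0: "Re (L 1) * Im (L \<i>) - Im (L 1) * Re (L \<i>) = 0"
    have "L (Complex (Re (L \<i>)) (- Re (L 1))) = 0" "L (Complex (Im (L \<i>)) (- Im (L 1))) = 0"
      using linear_complex_exp[OF L(1), of "Complex (Re (L \<i>)) (- Re (L 1))"]
        linear_complex_exp[OF L(1), of "Complex (Im (L \<i>)) (- Im (L 1))"] 0
      by (simp_all add: complex_eq_iff algebra_simps)
    then have "Complex (Re (L \<i>)) (- Re (L 1)) = 0" "Complex (Im (L \<i>)) (- Im (L 1)) = 0"
      using L linear_injective_0 by blast+
    then have "L 1 = 0" by (simp add: complex_eq_iff)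
    then show False using L linear_injective_0 zero_neq_one by metis
  qed
  have E: "L (E L d) = d" if L: "linear L" "inj L" for L d
  proof -
    define D where "D = Re (L 1) * Im (L \<i>) - Im (L 1) * Re (L \<i>)"
    have D: "D \<noteq> 0" using jac[OF L] by (simp add: D_def)
    define x y where "x = Re d * Im (L \<i>) - Im d * Re (L \<i>)" and "y = Re (L 1) * Im d - Im (L 1) * Re d"
    have xy: "x * Re (L 1) + y * Re (L \<i>) = Re d * D" "x * Im (L 1) + y * Im (L \<i>) = Im d * D"
      by (simp_all add: D_def x_def y_def algebra_simps)
    have "L (E L d) = (x / D) *\<^sub>R L 1 + (y / D) *\<^sub>R L \<i>"
      using linear_complex_exp[OF L(1), of "E L d"] by (simp add: E_def x_def y_def D_def)
    then have "Re (L (E L d)) = (x * Re (L 1) + y * Re (L \<i>)) / D" "Im (L (E L d)) = (x * Im (L 1) + y * Im (L \<i>)) / D"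
      by (simp_all add: add_divide_distrib)
    then have "Re d = Re (L (E L d))" "Im d = Im (L (E L d))"
      using D by (simp_all add: xy)
    then show ?thesis by (simp add: complex_eq_iff)
  qed
  define Dw where "Dw y = E (Dz (w y))" for y
  have Dw: "w' y = Dw y" if y: "y \<in> V'" for y
  proof
    fix d
    have "inv_into UNIV (Dz (w y)) d = Dw y d"
      using E[OF zD(3)[OF wS[OF y]] injp[OF wS[OF y]], of d] injp[OF wS[OF y]] unfolding Dw_def by (metis inv_f_f)
    then show "w' y d = Dw y d" using w'_inv[OF y] app[OF wS[OF y]] by simp
  qed
  have tw: "twice_diff_on ?O w Dw"
    unfolding twice_diff_on_def
  proof (intro ballI conjI allI)
    fix y v assume "y \<in> ?O"
    then have y: "y \<in> V'" using r(2) by blast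
    show wd: "(w has_derivative Dw y) (at y)" using w'[OF y] Dw[OF y] by simp
    have c: "(\<lambda>y. Dz (w y) a) differentiable (at y)" for a
      by (rule differentiable_compose[where f = "\<lambda>p. Dz p a" and g = w, OF zD(2)[OF wS[OF y]] differentiableI[OF wd]])
    then have ri: "(\<lambda>y. Re (Dz (w y) a)) differentiable (at y)" "(\<lambda>y. Im (Dz (w y) a)) differentiable (at y)" for a
      using has_derivative_Re has_derivative_Im unfolding differentiable_def by blast+
    have cx: "Complex a b = complex_of_real a + \<i> * complex_of_real b" for a b by (simp add: complex_eq_iff)
    have of: "(\<lambda>y. complex_of_real (f y)) differentiable (at y)" if "f differentiable (at y)" for f :: "complex \<Rightarrow> real"
      using that has_derivative_of_real unfolding differentiable_def by blast
    show "(\<lambda>y. Dw y v) differentiable (at y)"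
      unfolding Dw_def E_def cx
      by (intro differentiable_add differentiable_mult differentiable_const of differentiable_divide
        differentiable_diff ri jac zD(3) wS y injp)
  qed
  have im: "w ` ?O = U' \<inter> z -` ?O"
    using hom r(2) wU by (force simp: homeomorphism_def image_iff)
  have "continuous_on U' z" using hom by (simp add: homeomorphism_def)
  then have op: "open (w ` ?O)"
    unfolding im using U'(1) by (simp add: continuous_on_open_vimage Int_commute)
  show ?thesis
  proof (rule that[OF r(1) _ op _ _ tw])
    show "w (z q) = q" using hom U'(3) by (auto simp: homeomorphism_def)
    show "w ` ?O \<subseteq> S" using wS r(2) by blast
    show "z (w \<zeta>) = \<zeta>" if "\<zeta> \<in> ?O" for \<zeta> using wU r(2) that by blast
    show "Dz (w \<zeta>) (Dw \<zeta> d) = d" if "\<zeta> \<in> ?O" for \<zeta> d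
      unfolding Dw_def by (rule E) (use zD(3) injp wS r(2) that in blast)+
  qed
qed

context front_patch
begin

text \<open>Where \<open>B\<close> is nonzero the Gauss map \<open>F + V\<close> is immersed, and
  its null direction serves as the coordinate. In it \<open>beta\<close> is conformal modulo the
  null direction, so that \<open>mixed_xi_beta\<close> becomes the trace condition of
  \<open>dual_map\<close>. The last equation states that |hopf|^2 u^4 is -64 times the ratio of the
  areas of \<open>xi\<close> and \<open>beta\<close>.\<close>

lemma gauss_coordinates:
  assumes W: "\<And>p. p \<in> S \<Longrightarrow> weing s p" and q: "q \<in> S" and Bq: "B q \<noteq> 0"
  obtains t c r w Xi D where "r > 0" "w c = q" "open (w ` ball c r)" "w ` ball c r \<subseteq> S"
    "dual_map (ball c r) Xi D t (4 * s)" "continuous_on (ball c r) w"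
    "\<And>\<zeta>. \<zeta> \<in> ball c r \<Longrightarrow> D \<zeta> 1 = 0 \<and> D \<zeta> \<i> = 0 \<longleftrightarrow> (\<forall>d. xi s (w \<zeta>) d = 0)"
    "\<And>\<zeta>. \<zeta> \<in> ball c r \<Longrightarrow> B (w \<zeta>) \<noteq> 0"
    "\<And>\<zeta>. \<zeta> \<in> ball c r \<Longrightarrow>
      B (w \<zeta>) * (((mink (D \<zeta> 1) (lcone_deriv t \<zeta> 1))\<^sup>2 + (mink (D \<zeta> 1) (lcone_deriv t \<zeta> \<i>))\<^sup>2) * (mink (Xi \<zeta>) (lcone t \<zeta>))\<^sup>2)
      = - 64 * ((s - 1)\<^sup>2 * qA (w \<zeta>) + (s\<^sup>2 - 1) * qM (w \<zeta>) + (s + 1)\<^sup>2 * qT (w \<zeta>))"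
proof -
  define Psi where "Psi p = F p + V p" for p
  have Psi: "twice_diff_on S Psi beta"
    using twice_diff_on_lincomb[OF F V, of 1 1] by (simp add: Psi_def[abs_def] beta_def[abs_def])
  note PD = twice_diff_onD[OF Psi]
  have Psi_mink: "mink (Psi p) (Psi p) = 0" "mink (Psi p) (F p) = -1" if "p \<in> S" for p
    using norm_F[OF that] norm_V[OF that] perp_FV[OF that] by (simp_all add: Psi_def mink_bilinear mink_commute[of "V p" "F p"])
  \<comment> \<open>A null vector for which both poles fail is zero, but \<open>Psi q\<close> has
    product -1 with \<open>F q\<close>. So at least one of the two projections is available at
    \<open>q\<close>.\<close>
  have "Psi q $ 0 - Psi q $ 3 \<noteq> 0 \<or> Psi q $ 0 + Psi q $ 3 \<noteq> 0"
  proof (rule ccontr)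
    assume "\<not> ?thesis"
    then have 0: "Psi q $ 0 = 0" "Psi q $ 3 = 0" by linarith+
    then have "(Psi q $ 1)\<^sup>2 + (Psi q $ 2)\<^sup>2 = 0"
      using Psi_mink(1)[OF q] by (simp add: mink_def power2_eq_square)
    then have "Psi q = 0" using 0 by (intro vec4_eqI) (simp_all add: sum_power2_eq_zero_iff)
    then show False using Psi_mink(2)[OF q] by (simp add: mink_bilinear)
  qed
  then have "1 * 1 = (1::real) \<and> Psi q $ 0 - 1 * Psi q $ 3 \<noteq> 0 \<or> - 1 * - 1 = (1::real) \<and> Psi q $ 0 - (- 1) * Psi q $ 3 \<noteq> 0"
    by simp
  then have "\<exists>t. t * t = 1 \<and> Psi q $ 0 - t * Psi q $ 3 \<noteq> 0" by blast
  then obtain t where t: "t * t = 1" and tq: "Psi q $ 0 - t * Psi q $ 3 \<noteq> 0" by blast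
  define m where "m p = Psi p $ 0 - t * Psi p $ 3" for p
  define Dm where "Dm p d = beta p d $ 0 - t * beta p d $ 3" for p d
  have nth: "((\<lambda>p. Psi p $ i) has_derivative (\<lambda>d. beta p d $ i)) (at p)" "(\<lambda>p. beta p d $ i) differentiable (at p)" if "p \<in> S" for p i d
    using bounded_linear.has_derivative[OF bounded_linear_vec_nth PD(1)[OF that]]
      bounded_linear.has_derivative[OF bounded_linear_vec_nth] PD(2)[OF that] unfolding differentiable_def by blast+
  have mD: "(m has_derivative Dm p) (at p)" "(\<lambda>p. Dm p d) differentiable (at p)" "m differentiable (at p)" if "p \<in> S" for p d
  proof -
    show 1: "(m has_derivative Dm p) (at p)"
      unfolding m_def[abs_def] Dm_def[abs_def] by (intro has_derivative_diff has_derivative_mult_right nth that)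
    show "(\<lambda>p. Dm p d) differentiable (at p)"
      unfolding Dm_def by (intro differentiable_diff differentiable_mult differentiable_const nth that)
    show "m differentiable (at p)" using 1 differentiableI by blast
  qed
  define S' where "S' = {p \<in> S. B p \<noteq> 0 \<and> m p \<noteq> 0}"
  have S'sub: "S' \<subseteq> S" by (auto simp: S'_def)
  have S': "open S'"
  proof -
    have c: "continuous_on S (\<lambda>p. B p * m p)"
      unfolding B_def m_def using isCont_twice[OF Psi S] by (intro continuous_intros cont)
    have "S' = S \<inter> (\<lambda>p. B p * m p) -` (- {0})" by (auto simp: S'_def)
    then show ?thesis using continuous_open_preimage[OF c S, of "- {0}"] by (simp add: open_Compl)
  qed
  have q': "q \<in> S'" using q Bq tq by (simp add: S'_def m_def)
  define z where "z p = complex_of_real (Psi p $ 1 / m p) + \<i> * complex_of_real (Psi p $ 2 / m p)" for p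
  define Dq where "Dq i p d = (beta p d $ i * m p - Psi p $ i * Dm p d) / (m p * m p)" for i p d
  define Dz where "Dz p d = complex_of_real (Dq 1 p d) + \<i> * complex_of_real (Dq 2 p d)" for p d
  have z: "twice_diff_on S' z Dz"
    unfolding twice_diff_on_def
  proof (intro ballI conjI allI)
    fix p d assume p': "p \<in> S'"
    then have p: "p \<in> S" and m0: "m p \<noteq> 0" by (auto simp: S'_def)
    have of: "(\<lambda>y. complex_of_real (f y)) differentiable (at p)" if "f differentiable (at p)" for f :: "complex \<Rightarrow> real"
      using that has_derivative_of_real unfolding differentiable_def by blast
    have "((\<lambda>p. Psi p $ i / m p) has_derivative Dq i p) (at p)" for i
      unfolding Dq_def[abs_def] by (rule has_derivative_divide'[OF nth(1)[OF p] mD(1)[OF p] m0])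
    then show "(z has_derivative Dz p) (at p)"
      unfolding z_def[abs_def] Dz_def[abs_def]
      by (intro has_derivative_add has_derivative_mult_right has_derivative_of_real)
    have "(\<lambda>p. Psi p $ i) differentiable (at p)" for i using nth(1)[OF p] differentiableI by blast
    then have "(\<lambda>p. Dq i p d) differentiable (at p)" for i
      unfolding Dq_def by (intro differentiable_divide differentiable_diff differentiable_mult nth mD p no_zero_divisors m0)
    then show "(\<lambda>p. Dz p d) differentiable (at p)"
      unfolding Dz_def by (intro differentiable_add differentiable_mult differentiable_const of)
  qed
  have Psi_cone: "Psi p = (m p / 2) *\<^sub>R lcone t (z p)" if "p \<in> S'" for p
  proof -
    have "z p = Complex (Psi p $ 1 / m p) (Psi p $ 2 / m p)" by (simp add: z_def complex_eq_iff)
    then show ?thesis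
      using lightlike_eq_cone[OF t Psi_mink(1) m_def] that by (simp add: S'_def)
  qed
  have beta_cone: "beta p d = (Dm p d / 2) *\<^sub>R lcone t (z p) + (m p / 2) *\<^sub>R lcone_deriv t (z p) (Dz p d)" if p: "p \<in> S'" for p d
  proof -
    have 1: "((\<lambda>p. m p / 2) has_derivative (\<lambda>d. Dm p d / 2)) (at p)"
      using mD(1)[of p] p by (auto intro!: derivative_eq_intros simp: S'_def)
    have 2: "((\<lambda>p. lcone t (z p)) has_derivative (\<lambda>d. lcone_deriv t (z p) (Dz p d))) (at p)"
      by (rule has_derivative_compose[where g = "lcone t", OF twice_diff_onD(1)[OF z p] lcone_has_derivative])
    have "(Psi has_derivative (\<lambda>d. (m p / 2) *\<^sub>R lcone_deriv t (z p) (Dz p d) + (Dm p d / 2) *\<^sub>R lcone t (z p))) (at p)"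
      by (rule has_derivative_transform_within_open[OF has_derivative_scaleR[OF 1 2] S' p]) (simp add: Psi_cone)
    then have "beta p = (\<lambda>d. (m p / 2) *\<^sub>R lcone_deriv t (z p) (Dz p d) + (Dm p d / 2) *\<^sub>R lcone t (z p))"
      using PD(1)[of p] p has_derivative_unique by (blast dest: subsetD[OF S'sub])
    then show ?thesis by (simp add: add.commute)
  qed
  have betaE: "beta p d \<in> perp2 (F p) (V p)" "xi s p d \<in> perp2 (F p) (V p)" if "p \<in> S" for p d
    using perp2_lincomb[OF tangent[OF that], of 1 d 1 d] perp2_lincomb[OF tangent[OF that], of "s - 1" d "s + 1" d]
    by (simp_all add: beta_def xi_def)
  \<comment> \<open>A direction killed by \<open>Dz\<close> makes \<open>beta\<close> a multiple of
    \<open>Psi\<close>. Pairing with \<open>F\<close>, which gives 0 for \<open>beta\<close> and -1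
    for \<open>Psi\<close>, shows that \<open>beta\<close> kills it too, and \<open>B\<close> is
    nonzero.\<close>
  have injz: "d = 0" if p: "p \<in> S'" and 0: "Dz p d = 0" for p d
  proof -
    have pS: "p \<in> S" and Bp: "B p \<noteq> 0" and m0: "m p \<noteq> 0" using p by (auto simp: S'_def)
    have "lcone_deriv t (z p) 0 = 0" using has_derivative_linear[OF lcone_has_derivative] linear_0 by blast
    then have "beta p d = (Dm p d / 2) *\<^sub>R lcone t (z p)" using beta_cone[OF p, of d] 0 by simp
    moreover have "lcone t (z p) = (2 / m p) *\<^sub>R Psi p" using Psi_cone[OF p] m0 by simp
    ultimately have b: "beta p d = (Dm p d / m p) *\<^sub>R Psi p" by simp
    have "mink (beta p d) (F p) = 0" using betaE(1)[OF pS, of d] by (simp add: perp2_def)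
    then have "Dm p d / m p = 0" unfolding b using Psi_mink(2)[OF pS] by (simp add: mink_bilinear)
    then have "beta p d = 0" unfolding b by simp
    then have "(Re d * Im e - Im d * Re e) * B p = 0" for e
      using alternating_vol_same[OF linear_beta(1)[OF pS], of "F p" "V p" d e] vol_beta[OF pS] by (simp add: vol_bilinear)
    from this[of 1] this[of \<i>] show "d = 0" using Bp by (simp add: complex_eq_iff)
  qed
  obtain r w Dw where r: "r > 0" "w (z q) = q" "open (w ` ball (z q) r)" "w ` ball (z q) r \<subseteq> S'"
    and zw: "\<And>\<zeta>. \<zeta> \<in> ball (z q) r \<Longrightarrow> z (w \<zeta>) = \<zeta>" and tw: "twice_diff_on (ball (z q) r) w Dw"
    and Dzw: "\<And>\<zeta> d. \<zeta> \<in> ball (z q) r \<Longrightarrow> Dz (w \<zeta>) (Dw \<zeta> d) = d"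
    by (rule inverse_coordinates[OF S' z q']) (rule injz, assumption+, rule that, assumption+)
  define Xi where "Xi p = (s - 1) *\<^sub>R F p + (s + 1) *\<^sub>R V p" for p
  have Xi: "twice_diff_on S Xi (xi s)"
    using twice_diff_on_lincomb[OF F V, of "s - 1" "s + 1"] by (simp add: Xi_def[abs_def] xi_def[abs_def])
  let ?O = "ball (z q) r"
  define D where "D \<zeta> d = xi s (w \<zeta>) (Dw \<zeta> d)" for \<zeta> d
  have wS': "w \<zeta> \<in> S'" "w \<zeta> \<in> S" "m (w \<zeta>) \<noteq> 0" "B (w \<zeta>) \<noteq> 0" if "\<zeta> \<in> ?O" for \<zeta>
  proof -
    have "w \<zeta> \<in> S'" using r(4) that by blast
    then show "w \<zeta> \<in> S'" "w \<zeta> \<in> S" "m (w \<zeta>) \<noteq> 0" "B (w \<zeta>) \<noteq> 0" by (simp_all add: S'_def)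
  qed
  have TXi: "twice_diff_on ?O (\<lambda>\<zeta>. Xi (w \<zeta>)) D"
    unfolding D_def[abs_def] by (rule twice_diff_on_compose[OF Xi tw]) (use wS' in auto)
  have key: "mink (D \<zeta> d) (lcone t \<zeta>) = 0"
    "mink (D \<zeta> 1) (lcone_deriv t \<zeta> 1) + mink (D \<zeta> \<i>) (lcone_deriv t \<zeta> \<i>) = 0"
    "mink (Xi (w \<zeta>)) (lcone t \<zeta>) = 4 / m (w \<zeta>)"
    "mink (Xi (w \<zeta>)) (Xi (w \<zeta>)) = 4 * s"
    "D \<zeta> 1 = 0 \<and> D \<zeta> \<i> = 0 \<longleftrightarrow> (\<forall>d. xi s (w \<zeta>) d = 0)"
    "\<exists>k. k \<noteq> 0 \<and> k * B (w \<zeta>) = (m (w \<zeta>))\<^sup>2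
      \<and> k * ((s - 1)\<^sup>2 * qA (w \<zeta>) + (s\<^sup>2 - 1) * qM (w \<zeta>) + (s + 1)\<^sup>2 * qT (w \<zeta>)) =
        (mink (D \<zeta> 1) (lcone_deriv t \<zeta> 1) * mink (D \<zeta> \<i>) (lcone_deriv t \<zeta> \<i>)
         - mink (D \<zeta> 1) (lcone_deriv t \<zeta> \<i>) * mink (D \<zeta> \<i>) (lcone_deriv t \<zeta> 1)) / 4"
    if \<zeta>: "\<zeta> \<in> ?O" for \<zeta> d
  proof -
    define p where "p = w \<zeta>"
    have p': "p \<in> S'" and pS: "p \<in> S" and m0: "m p \<noteq> 0" and B0: "B p \<noteq> 0" using wS'[OF \<zeta>] by (auto simp: p_def)
    have zp: "z p = \<zeta>" using zw[OF \<zeta>] by (simp add: p_def)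
    have lc: "lcone t \<zeta> = (2 / m p) *\<^sub>R Psi p" using Psi_cone[OF p'] m0 by (simp add: zp)
    show XX: "mink (Xi (w \<zeta>)) (Xi (w \<zeta>)) = 4 * s"
      unfolding p_def[symmetric] Xi_def using norm_F[OF pS] norm_V[OF pS] perp_FV[OF pS]
      by (simp add: mink_bilinear mink_commute[of "V p" "F p"] algebra_simps)
    have "mink (Xi p) (Psi p) = 2"
      unfolding Xi_def Psi_def using norm_F[OF pS] norm_V[OF pS] perp_FV[OF pS]
      by (simp add: mink_bilinear mink_commute[of "V p" "F p"] algebra_simps)
    then show "mink (Xi (w \<zeta>)) (lcone t \<zeta>) = 4 / m (w \<zeta>)"
      unfolding p_def[symmetric] lc by (simp add: mink_bilinear)
    have Eperp: "mink v (lcone t \<zeta>) = 0" if "v \<in> perp2 (F p) (V p)" for v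
      using that unfolding lc by (simp add: perp2_def Psi_def mink_bilinear)
    have DE: "D \<zeta> d \<in> perp2 (F p) (V p)" for d
      using betaE(2)[OF pS] by (simp add: D_def p_def)
    show "mink (D \<zeta> d) (lcone t \<zeta>) = 0" by (rule Eperp[OF DE])
    define a b where "a = Dw \<zeta> 1" and "b = Dw \<zeta> \<i>"
    \<comment> \<open>The Jacobian determinant of \<open>w\<close>. The areas of \<open>beta\<close>
      and \<open>xi\<close> are evaluated twice, as \<open>j\<close> times their patch values and in
      an orthonormal frame; comparison gives \<open>jB\<close> and \<open>jZ\<close>.\<close>
    define j where "j = Re a * Im b - Im a * Re b"
    \<comment> \<open>Modulo \<open>lcone\<close>, \<open>beta\<close> is \<open>m p / 2\<close>
      times the derivative of \<open>lcone\<close>, whose partial derivatives are orthogonal of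
      length 2. Division by \<open>m p\<close> therefore gives an orthonormal pair.\<close>
    define e1 e2 where "e1 = (1 / m p) *\<^sub>R beta p a" and "e2 = (1 / m p) *\<^sub>R beta p b"
    have ba: "beta p a = (Dm p a / 2) *\<^sub>R lcone t \<zeta> + (m p / 2) *\<^sub>R lcone_deriv t \<zeta> 1"
      "beta p b = (Dm p b / 2) *\<^sub>R lcone t \<zeta> + (m p / 2) *\<^sub>R lcone_deriv t \<zeta> \<i>"
      using beta_cone[OF p', of a] beta_cone[OF p', of b] Dzw[OF \<zeta>, of 1] Dzw[OF \<zeta>, of \<i>] zp
      by (simp_all add: a_def b_def p_def)
    have bm: "mink v (beta p a) = (m p / 2) * mink v (lcone_deriv t \<zeta> 1)"
      "mink v (beta p b) = (m p / 2) * mink v (lcone_deriv t \<zeta> \<i>)" if "mink v (lcone t \<zeta>) = 0" for v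
      using that unfolding ba by (simp_all add: mink_bilinear)
    note mc = mink_lcone[OF t]
    have bl: "mink (beta p d) (lcone t \<zeta>) = 0" for d by (rule Eperp[OF betaE(1)[OF pS]])
    have bb: "mink (beta p a) (beta p a) = (m p)\<^sup>2" "mink (beta p b) (beta p b) = (m p)\<^sup>2" "mink (beta p a) (beta p b) = 0"
      unfolding bm(1)[OF bl] bm(2)[OF bl] unfolding ba
      by (simp_all add: mink_bilinear mc power2_eq_square)
    have fr: "frame (F p) (V p) e1 e2"
      unfolding frame_def e1_def e2_def
      using norm_F[OF pS] norm_V[OF pS] perp_FV[OF pS] betaE(1)[OF pS] bb m0
      by (simp add: mink_bilinear perp2_def power2_eq_square)
    have eb: "beta p a = m p *\<^sub>R e1" "beta p b = m p *\<^sub>R e2" using m0 by (simp_all add: e1_def e2_def)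
    have me: "mink v e1 = mink v (lcone_deriv t \<zeta> 1) / 2" "mink v e2 = mink v (lcone_deriv t \<zeta> \<i>) / 2"
      if "v \<in> perp2 (F p) (V p)" for v
      unfolding e1_def e2_def using bm[OF Eperp[OF that]] m0 by (simp_all add: mink_bilinear)
    define \<kappa> where "\<kappa> = vol (F p) (V p) e1 e2"
    have k0: "\<kappa> \<noteq> 0" using frame_vol[OF fr] by (simp add: \<kappa>_def)
    have "vol (F p) (V p) (beta p a) (beta p b) = j * B p"
      unfolding j_def using alternating_vol_same[OF linear_beta(1)[OF pS], of "F p" "V p" a b] vol_beta[OF pS] by simp
    moreover have "vol (F p) (V p) (beta p a) (beta p b) = \<kappa> * (m p)\<^sup>2"
      unfolding eb \<kappa>_def by (simp add: vol_bilinear power2_eq_square)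
    ultimately have jB: "j * B p = \<kappa> * (m p)\<^sup>2" by simp
    have j0: "j \<noteq> 0" using jB k0 m0 by auto
    have Da: "D \<zeta> 1 = xi s p a" "D \<zeta> \<i> = xi s p b" by (simp_all add: D_def a_def b_def p_def)
    have xE: "xi s p d \<in> perp2 (F p) (V p)" for d by (rule betaE(2)[OF pS])
    have eE: "e1 \<in> perp2 (F p) (V p)" "e2 \<in> perp2 (F p) (V p)" using fr by (simp_all add: frame_def)
    have ee: "mink e1 e1 = 1" "mink e2 e2 = 1" "mink e1 e2 = 0" "mink e2 e1 = 0"
      using fr by (simp_all add: frame_def mink_commute[of e2 e1])
    have "vol (F p) (V p) (xi s p a) (beta p b) + vol (F p) (V p) (beta p a) (xi s p b) = 0"
      using alternating_vol[OF linear_beta(2)[OF pS] linear_beta(1)[OF pS], of "F p" "V p" s a b]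
        mixed_xi_beta[OF W[OF pS]] by simp
    then have "m p * (\<kappa> * (mink (xi s p a) e1 + mink (xi s p b) e2)) = 0"
      unfolding eb vol_bilinear frame_vol_exp[OF fr xE eE(2)] frame_vol_exp[OF fr eE(1) xE] \<kappa>_def[symmetric]
      by (simp add: ee algebra_simps)
    then have "mink (xi s p a) e1 + mink (xi s p b) e2 = 0" using m0 k0 by simp
    then show "mink (D \<zeta> 1) (lcone_deriv t \<zeta> 1) + mink (D \<zeta> \<i>) (lcone_deriv t \<zeta> \<i>) = 0"
      unfolding me[OF xE] Da by simp
    define Z where "Z = (s - 1)\<^sup>2 * qA p + (s\<^sup>2 - 1) * qM p + (s + 1)\<^sup>2 * qT p"
    have "j * Z = vol (F p) (V p) (xi s p a) (xi s p b)"
      unfolding j_def Z_def using alternating_vol_same[OF linear_beta(2)[OF pS], of "F p" "V p" s a b] vol_xi[OF pS, of s] by simp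
    also have "\<dots> = \<kappa> * ((mink (D \<zeta> 1) (lcone_deriv t \<zeta> 1) * mink (D \<zeta> \<i>) (lcone_deriv t \<zeta> \<i>)
         - mink (D \<zeta> 1) (lcone_deriv t \<zeta> \<i>) * mink (D \<zeta> \<i>) (lcone_deriv t \<zeta> 1)) / 4)"
      unfolding frame_vol_exp[OF fr xE xE] me[OF xE] Da \<kappa>_def[symmetric] by (simp add: algebra_simps diff_divide_distrib)
    finally have jZ: "j * Z = \<kappa> * ((mink (D \<zeta> 1) (lcone_deriv t \<zeta> 1) * mink (D \<zeta> \<i>) (lcone_deriv t \<zeta> \<i>)
         - mink (D \<zeta> 1) (lcone_deriv t \<zeta> \<i>) * mink (D \<zeta> \<i>) (lcone_deriv t \<zeta> 1)) / 4)" .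
    show "\<exists>k. k \<noteq> 0 \<and> k * B (w \<zeta>) = (m (w \<zeta>))\<^sup>2
      \<and> k * ((s - 1)\<^sup>2 * qA (w \<zeta>) + (s\<^sup>2 - 1) * qM (w \<zeta>) + (s + 1)\<^sup>2 * qT (w \<zeta>)) =
        (mink (D \<zeta> 1) (lcone_deriv t \<zeta> 1) * mink (D \<zeta> \<i>) (lcone_deriv t \<zeta> \<i>)
         - mink (D \<zeta> 1) (lcone_deriv t \<zeta> \<i>) * mink (D \<zeta> \<i>) (lcone_deriv t \<zeta> 1)) / 4"
      unfolding p_def[symmetric] Z_def[symmetric]
      by (intro exI[of _ "j / \<kappa>"] conjI) (use jB jZ j0 k0 in \<open>simp_all add: field_simps\<close>)
    show "D \<zeta> 1 = 0 \<and> D \<zeta> \<i> = 0 \<longleftrightarrow> (\<forall>d. xi s (w \<zeta>) d = 0)"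
    proof
      assume "\<forall>d. xi s (w \<zeta>) d = 0" then show "D \<zeta> 1 = 0 \<and> D \<zeta> \<i> = 0" by (simp add: D_def)
    next
      assume 0: "D \<zeta> 1 = 0 \<and> D \<zeta> \<i> = 0"
      then have "j * Z = 0" unfolding jZ by (simp add: mink_bilinear)
      then have "Z = 0" using j0 by simp
      then show "\<forall>d. xi s (w \<zeta>) d = 0"
        using xi_zero[OF pS W[OF pS]] by (simp add: Z_def p_def)
    qed
  qed
  have dual: "dual_map ?O (\<lambda>\<zeta>. Xi (w \<zeta>)) D t (4 * s)"
    by unfold_locales (use TXi t key(1-4) wS' in auto)
  show ?thesis
  proof (rule that[OF r(1,2,3) _ dual])
    show "w ` ?O \<subseteq> S" using wS' by blast
    show "continuous_on ?O w" by (rule isCont_twice[OF tw]) simp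
    show "D \<zeta> 1 = 0 \<and> D \<zeta> \<i> = 0 \<longleftrightarrow> (\<forall>d. xi s (w \<zeta>) d = 0)" if "\<zeta> \<in> ?O" for \<zeta> by (rule key(5)[OF that])
    show "B (w \<zeta>) \<noteq> 0" if "\<zeta> \<in> ?O" for \<zeta> by (rule wS'(4)[OF that])
    fix \<zeta> assume \<zeta>: "\<zeta> \<in> ?O"
    define P Q Z where "P = mink (D \<zeta> 1) (lcone_deriv t \<zeta> 1)" and "Q = mink (D \<zeta> 1) (lcone_deriv t \<zeta> \<i>)"
      and "Z = (s - 1)\<^sup>2 * qA (w \<zeta>) + (s\<^sup>2 - 1) * qM (w \<zeta>) + (s + 1)\<^sup>2 * qT (w \<zeta>)"
    have P: "mink (D \<zeta> \<i>) (lcone_deriv t \<zeta> \<i>) = - P" using key(2)[OF \<zeta>] by (simp add: P_def)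
    have Q: "mink (D \<zeta> \<i>) (lcone_deriv t \<zeta> 1) = Q" using dual_map.sym[OF dual \<zeta>, of \<i> 1] by (simp add: Q_def)
    obtain k where k: "k \<noteq> 0" "k * B (w \<zeta>) = (m (w \<zeta>))\<^sup>2" "k * Z = (P * (- P) - Q * Q) / 4"
      using key(6)[OF \<zeta>] unfolding P Q P_def[symmetric] Q_def[symmetric] Z_def[symmetric] by blast
    have m0: "m (w \<zeta>) \<noteq> 0" by (rule wS'(3)[OF \<zeta>])
    have "k * (B (w \<zeta>) * ((P\<^sup>2 + Q\<^sup>2) * (4 / m (w \<zeta>))\<^sup>2)) = k * B (w \<zeta>) * ((P\<^sup>2 + Q\<^sup>2) * (4 / m (w \<zeta>))\<^sup>2)" by simp
    also have "\<dots> = 16 * (P\<^sup>2 + Q\<^sup>2)" unfolding k(2) using m0 by (simp add: field_simps)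
    also have "\<dots> = k * (- 64 * Z)" using k(3) by (simp add: power2_eq_square)
    finally have "B (w \<zeta>) * ((P\<^sup>2 + Q\<^sup>2) * (4 / m (w \<zeta>))\<^sup>2) = - 64 * Z" using mult_left_cancel[OF k(1)] by blast
    then show "B (w \<zeta>) * (((mink (D \<zeta> 1) (lcone_deriv t \<zeta> 1))\<^sup>2 + (mink (D \<zeta> 1) (lcone_deriv t \<zeta> \<i>))\<^sup>2) *
        (mink (Xi (w \<zeta>)) (lcone t \<zeta>))\<^sup>2) =
      - 64 * ((s - 1)\<^sup>2 * qA (w \<zeta>) + (s\<^sup>2 - 1) * qM (w \<zeta>) + (s + 1)\<^sup>2 * qT (w \<zeta>))"
      unfolding key(3)[OF \<zeta>] P_def Q_def Z_def .
  qed
qed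

text \<open>Where \<open>xi\<close> vanishes the Gauss map is an immersion, so that \<open>xi\<close> is governed by a holomorphic
  function of the Gauss map.\<close>

lemma unique_continuation:
  assumes W: "\<And>p. p \<in> S \<Longrightarrow> weing s p" and conn: "connected S"
    and N: "open N" "N \<noteq> {}" "N \<subseteq> S" "\<And>p d. p \<in> N \<Longrightarrow> xi s p d = 0" and p: "p \<in> S"
  shows "xi s p d = 0"
proof -
  define Z where "Z = interior {p \<in> S. \<forall>d. xi s p d = 0}"
  have NZ: "N \<subseteq> Z" unfolding Z_def using N by (intro interior_maximal) auto
  have Zsub: "Z \<subseteq> {p \<in> S. \<forall>d. xi s p d = 0}" unfolding Z_def by (rule interior_subset)
  have Zo: "open Z" by (simp add: Z_def)
  have step: "q \<in> Z" if q: "q \<in> S" "q \<in> closure Z" for q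
  proof -
    have "xi s q d = 0" for d
    proof -
      have c: "continuous_on S (\<lambda>p. xi s p d)"
        unfolding xi_def by (intro continuous_intros isCont_twice_deriv[OF F S] isCont_twice_deriv[OF V S])
      have "closedin (top_of_set S) {p \<in> S. xi s p d = 0}"
        by (rule continuous_closedin_preimage_constant[OF c])
      then obtain T where T: "closed T" "{p \<in> S. xi s p d = 0} = S \<inter> T" by (auto simp: closedin_closed)
      then have "closure Z \<subseteq> T" using Zsub by (intro closure_minimal) auto
      then show ?thesis using T q by blast
    qed
    then have x0: "\<forall>d. xi s q d = 0" by blast
    have Bq: "B q \<noteq> 0"
    proof
      assume B0: "B q = 0"
      then have "qA q = qT q" using W[OF q(1)] by (simp add: weing_def)
      then have "beta q 1 = 0" using beta_zero[OF q(1) _ B0] by blast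
      then show False using xi_beta_inj[OF q(1), of s 1] x0 by simp
    qed
    obtain t c r w Xi D where r: "r > 0" and w: "w c = q" "open (w ` ball c r)" "w ` ball c r \<subseteq> S"
      and dual: "dual_map (ball c r) Xi D t (4 * s)" and cw: "continuous_on (ball c r) w"
      and iff: "\<And>\<zeta>. \<zeta> \<in> ball c r \<Longrightarrow> D \<zeta> 1 = 0 \<and> D \<zeta> \<i> = 0 \<longleftrightarrow> (\<forall>d. xi s (w \<zeta>) d = 0)"
      by (rule gauss_coordinates[OF W q(1) Bq]) (assumption, rule that, assumption+)
    interpret d: dual_map "ball c r" Xi D t "4 * s" by (rule dual)
    have iff': "d.hopf \<zeta> = 0 \<longleftrightarrow> (\<forall>d. xi s (w \<zeta>) d = 0)" if "\<zeta> \<in> ball c r" for \<zeta>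
      using d.differential_zero_iff[OF that] iff[OF that] by simp
    define T where "T = ball c r \<inter> w -` Z"
    have To: "open T" unfolding T_def by (rule continuous_open_preimage[OF cw open_ball Zo])
    have "q \<in> w ` ball c r" using w(1) r by force
    then have "w ` ball c r \<inter> Z \<noteq> {}"
      using q(2) w(2) open_Int_closure_eq_empty[of "w ` ball c r" Z] by blast
    then have Tne: "T \<noteq> {}" by (auto simp: T_def)
    then obtain \<zeta>0 where z0: "\<zeta>0 \<in> T" by blast
    have lim: "\<zeta>0 islimpt T" by (rule interior_limit_point) (use z0 To in \<open>simp add: interior_open\<close>)
    have "d.hopf \<zeta> = 0" if "\<zeta> \<in> ball c r" for \<zeta>
      by (rule analytic_continuation[OF d.hopf_holomorphic open_ball connected_ball _ _ lim _ that])
        (use z0 iff' Zsub in \<open>auto simp: T_def\<close>)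
    then have "w ` ball c r \<subseteq> {p \<in> S. \<forall>d. xi s p d = 0}" using iff' w(3) by blast
    then have "w ` ball c r \<subseteq> Z" unfolding Z_def using w(2) by (rule interior_maximal)
    then show ?thesis using \<open>q \<in> w ` ball c r\<close> by blast
  qed
  have "S \<subseteq> Z"
  proof (rule ccontr)
    assume "\<not> S \<subseteq> Z"
    then have "S \<inter> - closure Z \<noteq> {}" using step by blast
    moreover have "S \<inter> Z \<noteq> {}" using NZ N(2,3) by blast
    moreover have "S \<subseteq> Z \<union> - closure Z" using step by blast
    moreover have "Z \<inter> - closure Z \<inter> S = {}" using closure_subset by blast
    ultimately show False using conn Zo open_Compl[OF closed_closure, of Z] unfolding connected_def by blast
  qed
  then show ?thesis using p Zsub by blast
qed

text \<open>A constant ratio \<open>r\<close> makes |hopf|^2 u^4 constant by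
  \<open>gauss_coordinates\<close>. If \<open>r\<close> were nonzero,
  \<open>lightlike_if_constant\<close> would make the companion lightlike, while its Minkowski
  square is \<open>4 * s\<close>.\<close>

lemma constant_ratio_zero:
  assumes W: "\<And>p. p \<in> S \<Longrightarrow> weing s p" and s: "s \<noteq> 0" and q: "q \<in> S" and Bq: "B q \<noteq> 0"
    and r: "\<And>p. p \<in> S \<Longrightarrow> (s - 1)\<^sup>2 * qA p + (s\<^sup>2 - 1) * qM p + (s + 1)\<^sup>2 * qT p = r * B p"
  shows "r = 0"
proof (rule ccontr)
  assume r0: "r \<noteq> 0"
  obtain t c \<rho> w Xi D where "\<rho> > 0" and w: "w c = q" "open (w ` ball c \<rho>)" "w ` ball c \<rho> \<subseteq> S"
      and dual: "dual_map (ball c \<rho>) Xi D t (4 * s)" and cw: "continuous_on (ball c \<rho>) w"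
      and iff: "\<And>\<zeta>. \<zeta> \<in> ball c \<rho> \<Longrightarrow> D \<zeta> 1 = 0 \<and> D \<zeta> \<i> = 0 \<longleftrightarrow> (\<forall>d. xi s (w \<zeta>) d = 0)"
      and B: "\<And>\<zeta>. \<zeta> \<in> ball c \<rho> \<Longrightarrow> B (w \<zeta>) \<noteq> 0"
      and eq: "\<And>\<zeta>. \<zeta> \<in> ball c \<rho> \<Longrightarrow>
      B (w \<zeta>) * (((mink (D \<zeta> 1) (lcone_deriv t \<zeta> 1))\<^sup>2 + (mink (D \<zeta> 1) (lcone_deriv t \<zeta> \<i>))\<^sup>2) * (mink (Xi \<zeta>) (lcone t \<zeta>))\<^sup>2)
      = - 64 * ((s - 1)\<^sup>2 * qA (w \<zeta>) + (s\<^sup>2 - 1) * qM (w \<zeta>) + (s + 1)\<^sup>2 * qT (w \<zeta>))"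
    by (rule gauss_coordinates[OF W q Bq]) (assumption, rule that, assumption+)
  interpret d: dual_map "ball c \<rho>" Xi D t "4 * s" by (rule dual)
  have "4 * s = 0"
  proof (rule d.lightlike_if_constant[of c "- 64 * r"])
    show "c \<in> ball c \<rho>" using \<open>\<rho> > 0\<close> by simp
    show "- 64 * r \<noteq> 0" using r0 by simp
    fix \<zeta> assume z: "\<zeta> \<in> ball c \<rho>"
    have "w \<zeta> \<in> S" using w(3) z by blast
    have "B (w \<zeta>) * (((d.P \<zeta>)\<^sup>2 + (d.Q \<zeta>)\<^sup>2) * (d.u \<zeta>)\<^sup>2) = B (w \<zeta>) * (- 64 * r)"
      using eq[OF z] unfolding r[OF \<open>w \<zeta> \<in> S\<close>] d.P_def d.Q_def d.u_def by simp
    then show "((d.P \<zeta>)\<^sup>2 + (d.Q \<zeta>)\<^sup>2) * (d.u \<zeta>)\<^sup>2 = - 64 * r" using mult_left_cancel[OF B[OF z]] by blast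
  qed
  then show False using s by simp
qed

end

lemma connected_clopen_zero_set:
  fixes g h :: "complex \<Rightarrow> real"
  assumes S: "connected S" and g: "continuous_on S g" "continuous_on S h"
    and ne: "p \<in> S" "g p = 0" "h p = 0"
    and op: "\<And>p. p \<in> S \<Longrightarrow> g p = 0 \<Longrightarrow> h p = 0 \<Longrightarrow>
      \<exists>N. open N \<and> p \<in> N \<and> (\<forall>x\<in>N \<inter> S. g x = 0 \<and> h x = 0)"
    and x: "x \<in> S"
  shows "g x = 0 \<and> h x = 0"
proof -
  define Y where "Y = {p \<in> S. g p = 0} \<inter> {p \<in> S. h p = 0}"
  have "closedin (top_of_set S) Y"
    unfolding Y_def by (intro closedin_Int continuous_closedin_preimage_constant g)
  moreover have "openin (top_of_set S) Y"
  proof (subst openin_subopen, intro ballI)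
    fix p assume "p \<in> Y"
    then obtain N where N: "open N" "p \<in> N" "\<forall>x\<in>N \<inter> S. g x = 0 \<and> h x = 0" and "p \<in> S"
      using op[of p] by (auto simp: Y_def)
    then show "\<exists>T. openin (top_of_set S) T \<and> p \<in> T \<and> T \<subseteq> Y"
      by (intro exI[of _ "S \<inter> N"]) (auto simp: Y_def openin_open)
  qed
  moreover have "Y \<noteq> {}" using ne by (auto simp: Y_def)
  ultimately have "Y = S" using S unfolding connected_clopen by blast
  then show ?thesis using x by (auto simp: Y_def)
qed

section \<open>Propagation of the Weingarten equation across singular points\<close>

context front_patch
begin

lemma restrict:
  assumes "open N" "N \<subseteq> S"
  shows "front_patch N F V DF DV"
proof
  show "twice_diff_on N F DF" "twice_diff_on N V DV"
    using twice_diff_on_subset[OF F assms(2)] twice_diff_on_subset[OF V assms(2)] .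
qed (use assms norm_F norm_V perp_FV orth immersed in \<open>auto simp: subset_iff\<close>)

lemma opposite: "front_patch S F (\<lambda>p. - V p) DF (\<lambda>p d. - DV p d)"
proof
  have "twice_diff_on S (\<lambda>p. (- 1) *\<^sub>R V p + 0 *\<^sub>R V p) (\<lambda>p d. (- 1) *\<^sub>R DV p d + 0 *\<^sub>R DV p d)"
    by (rule twice_diff_on_lincomb[OF V V])
  then show "twice_diff_on S (\<lambda>p. - V p) (\<lambda>p d. - DV p d)" by simp
  show "d = 0" if "p \<in> S" "DF p d = 0" "- DV p d = 0" for p d
    using immersed[OF that(1,2)] that(3) by simp
qed (simp_all add: S F norm_F norm_V perp_FV orth mink.minus_left mink.minus_right)

lemma not_all_zero:
  assumes "p \<in> S" "qA p = qT p" "qA p = 0" shows "qM p \<noteq> 0"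
  using maslov_nonzero[OF data[OF assms(1)]] assms by (simp add: qA_def qT_def qM_def)

lemma orientation:
  assumes "p \<in> S" "weing s p" shows "qM p + s * (qA p - qT p) \<noteq> 0"
  using orientation_nonzero[OF data[OF assms(1)], of s] assms(2)
  by (simp add: weing_def B_def qA_def qT_def qM_def)

text \<open>Under \<open>W\<close> and \<open>k\<close> all three forms are constant multiples of
  \<open>B\<close>, and the area of the companion is \<open>(4 * k - (s + 1)^2) * B\<close>. By
  \<open>constant_ratio_zero\<close> the factor must vanish.\<close>

lemma isoparametric:
  assumes N: "open N" "N \<noteq> {}" "N \<subseteq> S" and s: "s \<noteq> 0"
    and W: "\<And>p. p \<in> N \<Longrightarrow> weing s p" and B0: "\<And>p. p \<in> N \<Longrightarrow> B p \<noteq> 0"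
    and k: "\<And>p. p \<in> N \<Longrightarrow> qA p = k * B p"
  shows "4 * k = (s + 1)\<^sup>2"
proof -
  interpret N: front_patch N F V DF DV by (rule restrict[OF N(1,3)])
  obtain q where q: "q \<in> N" using N(2) by blast
  have "4 * k - (s + 1)\<^sup>2 = 0"
  proof (rule N.constant_ratio_zero[OF _ s q])
    show "N.weing s p" if "p \<in> N" for p using W[OF that] .
    show "N.B q \<noteq> 0" using B0[OF q] .
    fix p assume p: "p \<in> N"
    have T: "qT p = qA p - s * B p" and M: "qM p = (1 + s) * B p - 2 * qA p"
      using W[OF p] by (simp_all add: weing_def B_def algebra_simps)
    show "(s - 1)\<^sup>2 * N.qA p + (s\<^sup>2 - 1) * N.qM p + (s + 1)\<^sup>2 * N.qT p = (4 * k - (s + 1)\<^sup>2) * N.B p"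
      unfolding T M unfolding k[OF p] by (simp add: algebra_simps power2_eq_square)
  qed
  then show ?thesis by simp
qed

text \<open>The relation \<open>rel\<close> may belong to the other normal. Then the front is isoparametric on \<open>N0\<close>, which
  by rigidity makes the companion for the opposite normal constant there, and unique continuation spreads this
  from \<open>N0\<close> to \<open>S\<close>. In the remaining cases \<open>rel\<close> is either the Weingarten equation itself or
  independent of it, and then the set of common zeros of the two forms in \<open>rel\<close> is both open and closed.\<close>

lemma weingarten_propagates:
  assumes conn: "connected S" and ad: "a \<noteq> 0 \<or> d \<noteq> 0" and sg: "sg = 1 \<or> sg = -1"
    and rel: "\<And>p. p \<in> S \<Longrightarrow> a * (qA p + sg * qM p + qT p) + d * (qA p - qT p) = 0"
    and reg: "\<And>p. p \<in> S \<Longrightarrow> qA p \<noteq> 0 \<Longrightarrow> \<exists>N t. open N \<and> p \<in> N \<and> (t = 1 \<or> t = -1) \<and>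
      (\<forall>x\<in>N \<inter> S. qA x - qT x = s * (qA x + t * qM x + qT x))"
    and N0: "open N0" "N0 \<noteq> {}" "N0 \<subseteq> S" "\<And>p. p \<in> N0 \<Longrightarrow> weing s p"
    and p: "p \<in> S"
  shows "weing s p"
proof -
  obtain p0 where p0: "p0 \<in> N0" using N0(2) by blast
  have p0S: "p0 \<in> S" using p0 N0(3) by blast
  have cX: "continuous_on S (\<lambda>p. qA p - qT p)" by (intro continuous_intros cont)
  have cB: "continuous_on S (\<lambda>p. qA p + e * qM p + qT p)" for e by (intro continuous_intros cont)
  show ?thesis
  proof (cases "s = 0")
    \<comment> \<open>For \<open>s = 0\<close> the equation is \<open>qA = qT\<close> for either
      normal, so \<open>reg\<close> yields it without regard to the sign \<open>t\<close>.\<close>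
    case s: True
    show ?thesis
    proof (cases "a = 0")
      case True
      then show ?thesis using rel[OF p] ad s by (simp add: weing_def)
    next
      case a: False
      have "qA p - qT p = 0 \<and> qA p + sg * qM p + qT p = 0"
      proof (rule connected_clopen_zero_set[OF conn cX cB p0S _ _ _ p])
        show X0: "qA p0 - qT p0 = 0" using N0(4)[OF p0] s by (simp add: weing_def)
        show "qA p0 + sg * qM p0 + qT p0 = 0" using rel[OF p0S] X0 a by simp
        fix p assume p: "p \<in> S" "qA p - qT p = 0" "qA p + sg * qM p + qT p = 0"
        \<comment> \<open>At a common zero with \<open>qA p = 0\<close> all three forms would
          vanish, which \<open>not_all_zero\<close> excludes. So \<open>reg\<close> applies at
          \<open>p\<close>.\<close>
        have "qA p \<noteq> 0" using not_all_zero[of p] p sg by auto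
        then obtain N t where N: "open N" "p \<in> N" "\<forall>x\<in>N \<inter> S. qA x - qT x = s * (qA x + t * qM x + qT x)"
          using reg[OF p(1)] by blast
        have "qA x - qT x = 0 \<and> qA x + sg * qM x + qT x = 0" if x: "x \<in> N \<inter> S" for x
        proof -
          have X: "qA x - qT x = 0" using N(3) x s by simp
          then have "a * (qA x + sg * qM x + qT x) = 0" using rel[of x] x unfolding X by simp
          then show ?thesis using a X by simp
        qed
        then show "\<exists>N. open N \<and> p \<in> N \<and> (\<forall>x\<in>N \<inter> S. qA x - qT x = 0 \<and> qA x + sg * qM x + qT x = 0)"
          using N(1,2) by blast
      qed
      then show ?thesis using s by (simp add: weing_def)
    qed
  next
    case s: False
    consider (same) "sg = 1" "a + d * s = 0" | (degenerate) "sg = 1 \<and> a + d * s \<noteq> 0 \<or> a = 0" | (opp) "sg = -1" "a \<noteq> 0"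
      using sg by blast
    then show ?thesis
    proof cases
      case same
      then have "a = - d * s" "d \<noteq> 0" using ad by auto
      moreover have "d * (qA p - qT p - s * B p) = 0"
        using rel[OF p] same(1) \<open>a = - d * s\<close> by (simp add: B_def algebra_simps)
      ultimately show ?thesis by (simp add: weing_def)
    next
      case degenerate
      \<comment> \<open>Here \<open>rel\<close> and the Weingarten equation are independent linear
        equations for \<open>qA - qT\<close> and \<open>B\<close>, so both quantities vanish where
        both equations hold.\<close>
      have B0: "B x = 0" if "x \<in> S" "weing s x" for x
      proof -
        have X: "qA x - qT x = s * B x" using that(2) by (simp add: weing_def)
        show ?thesis
        proof (cases "a = 0")
          case True
          then show ?thesis using rel[OF that(1)] X s ad by simp
        next
          case False
          then have "sg = 1" "a + d * s \<noteq> 0" using degenerate by auto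
          moreover have "(a + d * s) * B x = 0"
            using rel[OF that(1)] \<open>sg = 1\<close> unfolding X by (simp add: B_def algebra_simps)
          ultimately show ?thesis by simp
        qed
      qed
      have "qA p - qT p = 0 \<and> qA p + 1 * qM p + qT p = 0"
      proof (rule connected_clopen_zero_set[OF conn cX cB p0S _ _ _ p])
        have "B p0 = 0" by (rule B0[OF p0S N0(4)[OF p0]])
        then show "qA p0 - qT p0 = 0" "qA p0 + 1 * qM p0 + qT p0 = 0"
          using N0(4)[OF p0] by (simp_all add: weing_def B_def)
        fix p assume p: "p \<in> S" "qA p - qT p = 0" "qA p + 1 * qM p + qT p = 0"
        have A0: "qA p \<noteq> 0" using not_all_zero[of p] p by auto
        then obtain N t where N: "open N" "p \<in> N" "\<forall>x\<in>N \<inter> S. qA x - qT x = s * (qA x + t * qM x + qT x)"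
          and t: "t = 1 \<or> t = -1"
          using reg[OF p(1)] by blast
        \<comment> \<open>At \<open>p\<close> one has \<open>qT = qA\<close> and
          \<open>qM = - 2 qA\<close>; with \<open>t = -1\<close> the equation would read
          \<open>0 = 4 s qA\<close>.\<close>
        have "t = 1"
        proof (rule ccontr)
          assume "t \<noteq> 1"
          then have "s * (qA p - qM p + qT p) = 0" using N p t by auto
          then show False using s p A0 by auto
        qed
        then have "weing s x" if "x \<in> N \<inter> S" for x using N(3) that by (simp add: weing_def B_def)
        then have "qA x - qT x = 0 \<and> B x = 0" if "x \<in> N \<inter> S" for x
          using B0[of x] that by (simp add: weing_def)
        then show "\<exists>N. open N \<and> p \<in> N \<and> (\<forall>x\<in>N \<inter> S. qA x - qT x = 0 \<and> qA x + 1 * qM x + qT x = 0)"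
          using N by (intro exI[of _ N]) (auto simp: B_def)
      qed
      then show ?thesis by (simp add: weing_def B_def)
    next
      case opp
      \<comment> \<open>Eliminating \<open>qT\<close> and \<open>qM\<close> by the Weingarten
        equation leaves \<open>rel\<close> linear in \<open>qA\<close> and \<open>B\<close>;
        \<open>k\<close> is the ratio that it prescribes.\<close>
      define k where "k = ((1 + 2 * s) - d * s / a) / 4"
      have on: "qA x = k * B x" "B x \<noteq> 0" if x: "x \<in> S" "weing s x" for x
      proof -
        have T: "qT x = qA x - s * B x" and M: "qM x = (1 + s) * B x - 2 * qA x"
          using x(2) by (simp_all add: weing_def B_def algebra_simps)
        have "a * (4 * qA x - (1 + 2 * s) * B x) + d * s * B x = 0"
          using rel[OF x(1)] opp(1) unfolding T M by (simp add: algebra_simps)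
        moreover have "4 * (a * k) = a * (1 + 2 * s) - d * s"
          using opp(2) by (simp add: k_def field_simps)
        moreover have "a * (4 * (k * B x)) = (4 * (a * k)) * B x" by simp
        ultimately have "a * (4 * qA x) = a * (4 * (k * B x))"
          by (simp only:) (simp add: algebra_simps)
        then show 1: "qA x = k * B x" using opp(2) by simp
        show "B x \<noteq> 0"
        proof
          assume "B x = 0"
          then have "qA x = 0" "qA x = qT x" "qM x = 0" using 1 T M by auto
          then show False using not_all_zero[OF x(1)] by simp
        qed
      qed
      have k: "4 * k = (s + 1)\<^sup>2"
        by (rule isoparametric[OF N0(1-3) s N0(4)]) (use on N0 in blast)+
      \<comment> \<open>For \<open>d = 0\<close> the constant would satisfy
        \<open>4 k = 1 + 2 s\<close>, and comparison with \<open>(s + 1)^2\<close> gives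
        \<open>s = 0\<close>.\<close>
      have d: "d \<noteq> 0"
      proof
        assume "d = 0"
        then have "s * s = 0" using k by (simp add: k_def power2_eq_square algebra_simps)
        then show False using s by simp
      qed
      \<comment> \<open>Solved for \<open>qA - qT\<close>, \<open>rel\<close> is the Weingarten
        equation of the opposite normal with this parameter. The identity \<open>s' * s = 1\<close>
        found below makes the companions of the two normals proportional.\<close>
      define s' where "s' = - a / d"
      have rel': "qA x - qT x = s' * (qA x - qM x + qT x)" if "x \<in> S" for x
        using rel[OF that] opp(1) d by (simp add: s'_def field_simps)
      have ss: "s' * s = 1" and Bm: "qA x - qM x + qT x = s\<^sup>2 * B x" if x: "x \<in> N0" for x
      proof -
        have xS: "x \<in> S" and Wx: "weing s x" using x N0 by auto
        have T: "qT x = qA x - s * B x" and M: "qM x = (1 + s) * B x - 2 * qA x"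
          using Wx by (simp_all add: weing_def B_def algebra_simps)
        have A: "4 * qA x = (s + 1)\<^sup>2 * B x" using on(1)[OF xS Wx] k by (metis mult.assoc)
        show Bm: "qA x - qM x + qT x = s\<^sup>2 * B x"
          unfolding T M using A by (simp add: power2_eq_square algebra_simps)
        have "s * B x = s' * (s\<^sup>2 * B x)" using rel'[OF xS] unfolding Bm using T by simp
        then have "(s' * s) * (s * B x) = 1 * (s * B x)" by (simp add: power2_eq_square algebra_simps)
        then show "s' * s = 1" using s on(2)[OF xS Wx] mult_right_cancel[of "s * B x"] by (metis mult_eq_0_iff)
      qed
      have ss: "s' * s = 1" by (rule ss[OF p0])
      interpret m: front_patch S F "\<lambda>p. - V p" DF "\<lambda>p d. - DV p d" by (rule opposite)
      \<comment> \<open>The area form and \<open>DV\<close> both change sign: \<open>qA\<close> and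
        \<open>qT\<close> are negated, while \<open>qM\<close>, which is linear in
        \<open>DV\<close>, is unchanged.\<close>
      have mq: "m.qA x = - qA x" "m.qT x = - qT x" "m.qM x = qM x" for x
        unfolding m.qA_def m.qT_def m.qM_def qA_def qT_def qM_def mixed_vol_def
        by (simp_all add: vol_minus_normal vol_minus)
      have mB: "m.B x = - (qA x - qM x + qT x)" for x by (simp add: m.B_def mq)
      have mW: "m.weing s' x" if "x \<in> S" for x
        using rel'[OF that] unfolding m.weing_def mB mq by (simp add: algebra_simps)
      have Zm: "(s' - 1)\<^sup>2 * m.qA x + (s'\<^sup>2 - 1) * m.qM x + (s' + 1)\<^sup>2 * m.qT x =
          - (4 * qA x - (s' + 1)\<^sup>2 * (qA x - qM x + qT x))" if "x \<in> S" for x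
      proof -
        define b where "b = qA x - qM x + qT x"
        have T: "qT x = qA x - s' * b" and M: "qM x = 2 * qA x - (1 + s') * b"
          using rel'[OF that] by (simp_all add: b_def algebra_simps)
        show ?thesis unfolding b_def[symmetric] mq unfolding T M by (simp add: power2_eq_square algebra_simps)
      qed
      have zero: "m.xi s' x e = 0" if x: "x \<in> N0" for x e
      proof (rule m.xi_zero)
        show xS: "x \<in> S" using x N0(3) by blast
        then show "m.weing s' x" by (rule mW)
        have A: "4 * qA x = (s + 1)\<^sup>2 * B x" using on(1)[OF xS N0(4)[OF x]] k by (metis mult.assoc)
        have "(s' + 1)\<^sup>2 * (s\<^sup>2 * B x) = (s' * s + s)\<^sup>2 * B x" by (simp add: power2_eq_square algebra_simps)
        then show "(s' - 1)\<^sup>2 * m.qA x + (s'\<^sup>2 - 1) * m.qM x + (s' + 1)\<^sup>2 * m.qT x = 0"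
          unfolding Zm[OF xS] Bm[OF x] A ss by (simp add: algebra_simps)
      qed
      \<comment> \<open>Only the equation of the opposite normal is known on all of
        \<open>S\<close>, so the continuation is made with \<open>m\<close>. The vanishing companion
        ties \<open>qA\<close> to \<open>b\<close>, and together with \<open>s' * s = 1\<close> this
        gives back the equation of the original normal.\<close>
      have "m.xi s' p e = 0" for e
        by (rule m.unique_continuation[OF mW conn N0(1-3) zero p])
      then have "4 * qA p = (s' + 1)\<^sup>2 * (qA p - qM p + qT p)"
        using m.vol_xi[OF p, of s'] Zm[OF p] by (simp add: vol_bilinear)
      moreover define b where "b = qA p - qM p + qT p"
      moreover have T: "qT p = qA p - s' * b" and M: "qM p = 2 * qA p - (1 + s') * b"
        using rel'[OF p] by (simp_all add: b_def algebra_simps)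
      ultimately have "B p = s'\<^sup>2 * b"
        unfolding B_def T M by (simp add: power2_eq_square algebra_simps)
      then have "s * B p = (s' * s) * s' * b" by (simp add: power2_eq_square)
      then show ?thesis using ss T by (simp add: weing_def)
    qed
  qed
qed

lemma weingarten_propagates_sign:
  assumes conn: "connected S" and ad: "a \<noteq> 0 \<or> d \<noteq> 0" and sg: "sg = 1 \<or> sg = -1" and e: "e = 1 \<or> e = -1"
    and rel: "\<And>p. p \<in> S \<Longrightarrow> a * (qA p + sg * qM p + qT p) + d * (qA p - qT p) = 0"
    and reg: "\<And>p. p \<in> S \<Longrightarrow> qA p \<noteq> 0 \<Longrightarrow> \<exists>N t. open N \<and> p \<in> N \<and> (t = 1 \<or> t = -1) \<and>
      (\<forall>x\<in>N \<inter> S. qA x - qT x = s * (qA x + t * qM x + qT x))"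
    and N0: "open N0" "N0 \<noteq> {}" "N0 \<subseteq> S" "\<And>p. p \<in> N0 \<Longrightarrow> qA p - qT p = s * (qA p + e * qM p + qT p)"
    and p: "p \<in> S"
  shows "qA p - qT p = s * (qA p + e * qM p + qT p)"
proof (cases "e = 1")
  case True
  have "weing s p"
    by (rule weingarten_propagates[OF conn ad sg rel reg N0(1-3) _ p])
      (use N0(4) True in \<open>simp_all add: weing_def B_def\<close>)
  then show ?thesis using True by (simp add: weing_def B_def)
next
  case False
  then have e: "e = -1" using e by simp
  interpret m: front_patch S F "\<lambda>p. - V p" DF "\<lambda>p d. - DV p d" by (rule opposite)
  have mq: "m.qA x = - qA x" "m.qT x = - qT x" "m.qM x = qM x" for x
    unfolding m.qA_def m.qT_def m.qM_def qA_def qT_def qM_def mixed_vol_def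
    by (simp_all add: vol_minus_normal vol_minus)
  have eq: "m.qA x - m.qT x = s * (m.qA x + (- t) * m.qM x + m.qT x) \<longleftrightarrow>
      qA x - qT x = s * (qA x + t * qM x + qT x)" for x t
    unfolding mq by (auto simp: algebra_simps)
  have "m.weing s p"
  proof (rule m.weingarten_propagates[OF conn ad, of "- sg"])
    show "- sg = 1 \<or> - sg = -1" using sg by auto
    show "a * (m.qA p + - sg * m.qM p + m.qT p) + d * (m.qA p - m.qT p) = 0" if "p \<in> S" for p
      using rel[OF that] unfolding mq by (simp add: algebra_simps)
    show "\<exists>N t. open N \<and> p \<in> N \<and> (t = 1 \<or> t = -1) \<and>
      (\<forall>x\<in>N \<inter> S. m.qA x - m.qT x = s * (m.qA x + t * m.qM x + m.qT x))" if p: "p \<in> S" "m.qA p \<noteq> 0" for p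
    proof -
      obtain N t where N: "open N" "p \<in> N" "t = 1 \<or> t = -1"
        "\<forall>x\<in>N \<inter> S. qA x - qT x = s * (qA x + t * qM x + qT x)"
        using reg[OF p(1)] p(2) mq by auto
      then show ?thesis using eq[of _ t] by (intro exI[of _ N] exI[of _ "- t"]) auto
    qed
    show "m.weing s p" if "p \<in> N0" for p
      using N0(4)[OF that] eq[of p "-1"] e by (simp add: m.weing_def m.B_def)
  qed (rule N0 p)+
  then show ?thesis using eq[of p "-1"] e by (simp add: m.weing_def m.B_def)
qed

end

subsection \<open>Charts\<close>

text \<open>Charts take values in \<open>real^2\<close>, the patches live in the complex plane;
  \<open>cvec\<close> and \<open>vecc\<close> identify the two.\<close>

definition cvec :: "complex \<Rightarrow> real^2" where "cvec z = (\<chi> i. if i = 1 then Re z else Im z)"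
definition vecc :: "real^2 \<Rightarrow> complex" where "vecc v = Complex (v $ 1) (v $ 2)"

lemma cvec_nth [simp]: "cvec z $ 1 = Re z" "cvec z $ 2 = Im z"
  by (simp_all add: cvec_def)

lemma cvec_vecc [simp]: "cvec (vecc v) = v" "vecc (cvec z) = z"
  by (simp_all add: vecc_def vec_eq_iff forall_2)

lemma linear_cvec: "linear cvec" "linear vecc"
  by (rule linearI; simp add: vec_eq_iff forall_2 vecc_def complex_eq_iff)+

lemma bounded_linear_cvec: "bounded_linear cvec" "bounded_linear vecc"
  using linear_cvec by (simp_all add: linear_conv_bounded_linear)

lemma cvec_axis: "cvec 1 = axis 1 1" "cvec \<i> = axis 2 1"
  by (simp_all add: vec_eq_iff forall_2 axis_def)

lemma smooth_onD:
  assumes "smooth_on S g" "x \<in> S"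
  shows "(g has_derivative frechet_derivative g (at x)) (at x)"
    "(\<lambda>x. frechet_derivative g (at x) v) differentiable (at x)"
proof -
  have "Ck_on (Suc (Suc 0)) S g" using assms(1) by (simp add: smooth_on_def del: Ck_on.simps)
  then show "(g has_derivative frechet_derivative g (at x)) (at x)"
    "(\<lambda>x. frechet_derivative g (at x) v) differentiable (at x)"
    using assms(2) frechet_derivative_works by auto
qed

text \<open>\<open>differential\<close> uses a preferred chart that may jump from point to point, so
  it need not vary continuously. Calculus on a patch requires one fixed chart
  \<open>c\<close>.\<close>

definition chart_diff :: "'a chart \<Rightarrow> ('a \<Rightarrow> 'b::real_normed_vector) \<Rightarrow> 'a \<Rightarrow> real^2 \<Rightarrow> 'b" where
  "chart_diff c f p = frechet_derivative (f \<circ> inv_into (fst c) (snd c)) (at (snd c p))"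

lemma differential_chart_diff: "differential A f p = chart_diff (chart_at A p) f p"
  by (simp add: differential_def chart_diff_def Let_def)

locale surface =
  fixes M :: "'a topology" and A :: "'a atlas"
  assumes surface: "smooth_surface M A"
begin

lemma is_chart: "c \<in> A \<Longrightarrow> is_chart M c"
  using surface by (simp add: smooth_surface_def smooth_atlas_def)

lemma chart_at: "p \<in> topspace M \<Longrightarrow> chart_at A p \<in> A \<and> p \<in> fst (chart_at A p)"
proof -
  assume "p \<in> topspace M"
  moreover have "topspace M = (\<Union>c\<in>A. fst c)"
    using surface by (simp add: smooth_surface_def smooth_atlas_def)
  ultimately have "\<exists>c. c \<in> A \<and> p \<in> fst c" by blast
  then show ?thesis unfolding chart_at_def by (rule someI_ex)
qed

lemma chart_open:
  assumes "c \<in> A"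
  shows "openin M (fst c)" "open (snd c ` fst c)" "fst c \<subseteq> topspace M"
  using is_chart[OF assms] openin_subset[of M "fst c"] by (simp_all add: is_chart_def)

lemma open_chart_Int: "c \<in> A \<Longrightarrow> d \<in> A \<Longrightarrow> openin M (fst c \<inter> fst d)"
  by (intro openin_Int chart_open)

lemma chart_homeo: "c \<in> A \<Longrightarrow> homeomorphic_map (subtopology M (fst c)) (top_of_set (snd c ` fst c)) (snd c)"
  using is_chart by (simp add: is_chart_def)

lemma chart_inj: "c \<in> A \<Longrightarrow> inj_on (snd c) (fst c)"
  using homeomorphic_imp_injective_map[OF chart_homeo] chart_open(3)
  by (metis Int_absorb1 topspace_subtopology)

lemma chart_inv: "c \<in> A \<Longrightarrow> p \<in> fst c \<Longrightarrow> inv_into (fst c) (snd c) (snd c p) = p"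
  using chart_inj by simp

lemma open_chart_image:
  assumes "c \<in> A" "openin M U" "U \<subseteq> fst c"
  shows "open (snd c ` U)"
proof -
  have "openin (subtopology M (fst c)) U" using assms by (metis openin_subtopology inf.absorb1)
  then have "openin (top_of_set (snd c ` fst c)) (snd c ` U)"
    using homeomorphic_imp_open_map[OF chart_homeo[OF assms(1)]] by (simp add: open_map_def)
  then show ?thesis using chart_open(2)[OF assms(1)] openin_open_trans by blast
qed

lemma open_chart_preimage:
  assumes "c \<in> A" "open T"
  shows "openin M {p \<in> fst c. snd c p \<in> T}"
proof -
  have "continuous_map (subtopology M (fst c)) (top_of_set (snd c ` fst c)) (snd c)"
    by (rule homeomorphic_imp_continuous_map[OF chart_homeo[OF assms(1)]])
  then have "continuous_map (subtopology M (fst c)) euclidean (snd c)"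
    by (simp add: continuous_map_in_subtopology)
  then have "openin (subtopology M (fst c)) {p \<in> topspace (subtopology M (fst c)). snd c p \<in> T}"
    using assms(2) by (simp add: continuous_map_def)
  moreover have "topspace (subtopology M (fst c)) = fst c" using chart_open(3)[OF assms(1)] by auto
  ultimately have "openin (subtopology M (fst c)) {p \<in> fst c. snd c p \<in> T}" by (simp only:)
  then show ?thesis by (rule openin_trans_full[OF _ chart_open(1)[OF assms(1)]])
qed

lemma smooth_mapD:
  assumes f: "smooth_map_on A U f" and c: "c \<in> A" and p: "p \<in> fst c" "p \<in> U"
  shows "((f \<circ> inv_into (fst c) (snd c)) has_derivative chart_diff c f p) (at (snd c p))"
    "(\<lambda>x. frechet_derivative (f \<circ> inv_into (fst c) (snd c)) (at x) v) differentiable (at (snd c p))"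
proof -
  have "smooth_on (snd c ` (fst c \<inter> U)) (f \<circ> inv_into (fst c) (snd c))"
    using f c by (simp add: smooth_map_on_def)
  moreover have "snd c p \<in> snd c ` (fst c \<inter> U)" using p by blast
  ultimately show "((f \<circ> inv_into (fst c) (snd c)) has_derivative chart_diff c f p) (at (snd c p))"
    "(\<lambda>x. frechet_derivative (f \<circ> inv_into (fst c) (snd c)) (at x) v) differentiable (at (snd c p))"
    unfolding chart_diff_def by (rule smooth_onD)+
qed

lemma chart_diff_cong:
  assumes U: "openin M U" "p \<in> U" and c: "c \<in> A" "p \<in> fst c" and eq: "\<And>q. q \<in> U \<Longrightarrow> g q = h q"
    and L: "((h \<circ> inv_into (fst c) (snd c)) has_derivative L) (at (snd c p))"
  shows "chart_diff c g p = L"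
proof -
  have op: "open (snd c ` (fst c \<inter> U))"
    by (rule open_chart_image[OF c(1)]) (use U chart_open[OF c(1)] in \<open>auto intro!: openin_Int\<close>)
  have "((g \<circ> inv_into (fst c) (snd c)) has_derivative L) (at (snd c p))"
    by (rule has_derivative_transform_within_open[OF L op]) (use U c eq chart_inv[OF c(1)] in auto)
  then show ?thesis unfolding chart_diff_def by (rule frechet_derivative_at[symmetric])
qed

definition trans_deriv :: "'a chart \<Rightarrow> 'a chart \<Rightarrow> 'a \<Rightarrow> real^2 \<Rightarrow> real^2" where
  "trans_deriv c d p = frechet_derivative (transition c d) (at (snd c p))"

lemma trans_deriv:
  assumes "c \<in> A" "d \<in> A" "p \<in> fst c" "p \<in> fst d"
  shows "(transition c d has_derivative trans_deriv c d p) (at (snd c p))"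
proof -
  have "smooth_on (snd c ` (fst c \<inter> fst d)) (transition c d)"
    using surface assms by (simp add: smooth_surface_def smooth_atlas_def)
  then show ?thesis unfolding trans_deriv_def by (rule smooth_onD) (use assms in blast)
qed

lemma chart_diff_change:
  assumes f: "((f \<circ> inv_into (fst d) (snd d)) has_derivative chart_diff d f p) (at (snd d p))"
    and cd: "c \<in> A" "d \<in> A" "p \<in> fst c" "p \<in> fst d"
  shows "chart_diff c f p v = chart_diff d f p (trans_deriv c d p v)"
    "((f \<circ> inv_into (fst c) (snd c)) has_derivative chart_diff c f p) (at (snd c p))"
proof -
  have tp: "transition c d (snd c p) = snd d p" using chart_inv cd by (simp add: transition_def)
  have 1: "((\<lambda>x. (f \<circ> inv_into (fst d) (snd d)) (transition c d x)) has_derivative (\<lambda>v. chart_diff d f p (trans_deriv c d p v)))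
      (at (snd c p))"
    by (rule has_derivative_compose[OF trans_deriv[OF cd], where g = "f \<circ> inv_into (fst d) (snd d)" and g' = "chart_diff d f p"])
      (unfold tp, rule f)
  have op: "open (snd c ` (fst c \<inter> fst d))"
    by (rule open_chart_image[OF cd(1) open_chart_Int[OF cd(1,2)]]) blast
  have 2: "((f \<circ> inv_into (fst c) (snd c)) has_derivative (\<lambda>v. chart_diff d f p (trans_deriv c d p v))) (at (snd c p))"
    by (rule has_derivative_transform_within_open[OF 1 op])
      (use cd chart_inv in \<open>auto simp: transition_def\<close>)
  then have "chart_diff c f p = (\<lambda>v. chart_diff d f p (trans_deriv c d p v))"
    unfolding chart_diff_def[of c] by (rule frechet_derivative_at[symmetric])
  then show "chart_diff c f p v = chart_diff d f p (trans_deriv c d p v)"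
    "((f \<circ> inv_into (fst c) (snd c)) has_derivative chart_diff c f p) (at (snd c p))"
    using 2 by simp_all
qed

lemma trans_deriv_inverse:
  assumes cd: "c \<in> A" "d \<in> A" "p \<in> fst c" "p \<in> fst d"
  shows "trans_deriv d c p (trans_deriv c d p v) = v"
proof -
  have tp: "transition c d (snd c p) = snd d p" using chart_inv cd by (simp add: transition_def)
  have 1: "((\<lambda>x. transition d c (transition c d x)) has_derivative (\<lambda>v. trans_deriv d c p (trans_deriv c d p v))) (at (snd c p))"
    by (rule has_derivative_compose[OF trans_deriv[OF cd]]) (unfold tp, rule trans_deriv[OF cd(2,1,4,3)])
  have op: "open (snd c ` (fst c \<inter> fst d))"
    by (rule open_chart_image[OF cd(1) open_chart_Int[OF cd(1,2)]]) blast
  have "((\<lambda>x. x) has_derivative (\<lambda>v. trans_deriv d c p (trans_deriv c d p v))) (at (snd c p))"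
    by (rule has_derivative_transform_within_open[OF 1 op])
      (use cd chart_inv in \<open>auto simp: transition_def\<close>)
  then show ?thesis using has_derivative_unique[OF has_derivative_ident] by metis
qed

lemma trans_deriv_det:
  assumes cd: "c \<in> A" "d \<in> A" "p \<in> fst c" "p \<in> fst d"
  shows "det (matrix (trans_deriv c d p)) \<noteq> 0"
proof -
  have l: "linear (trans_deriv c d p)" using trans_deriv[OF cd] has_derivative_linear by blast
  have "inj (trans_deriv c d p)" by (rule inj_on_inverseI) (rule trans_deriv_inverse[OF cd])
  then show ?thesis using det_nz_iff_inj[OF l] by blast
qed

lemma differential_eq:
  assumes f: "smooth_map_on A U f" and p: "p \<in> U" and c: "c \<in> A" "p \<in> fst c"
  shows "differential A f p v = chart_diff c f p (trans_deriv (chart_at A p) c p v)"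
    and "linear (differential A f p)"
proof -
  have "p \<in> topspace M" using c chart_open(3) by blast
  note ca = chart_at[OF this]
  show "differential A f p v = chart_diff c f p (trans_deriv (chart_at A p) c p v)"
    unfolding differential_chart_diff
    by (rule chart_diff_change(1)[OF smooth_mapD(1)[OF f c p]]) (use ca c in auto)
  show "linear (differential A f p)"
    unfolding differential_chart_diff using smooth_mapD(1)[OF f] ca p has_derivative_linear by blast
qed

lemma differential_lincomb:
  assumes f: "smooth_map_on A V f" "p \<in> V" and g: "smooth_map_on A V' g" "p \<in> V'"
    and U: "openin M U" "p \<in> U" and eq: "\<And>q. q \<in> U \<Longrightarrow> h q = x *\<^sub>R f q + y *\<^sub>R g q"
  shows "differential A h p = (\<lambda>v. x *\<^sub>R differential A f p v + y *\<^sub>R differential A g p v)"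
proof -
  have "p \<in> topspace M" using U openin_subset by blast
  note ca = chart_at[OF this]
  show ?thesis
    unfolding differential_chart_diff
  proof (rule chart_diff_cong[OF U])
    have "((\<lambda>z. x *\<^sub>R (f \<circ> inv_into (fst (chart_at A p)) (snd (chart_at A p))) z
        + y *\<^sub>R (g \<circ> inv_into (fst (chart_at A p)) (snd (chart_at A p))) z) has_derivative
       (\<lambda>v. x *\<^sub>R chart_diff (chart_at A p) f p v + y *\<^sub>R chart_diff (chart_at A p) g p v)) (at (snd (chart_at A p) p))"
      by (intro has_derivative_add has_derivative_scaleR_right smooth_mapD(1)[OF f(1)] smooth_mapD(1)[OF g(1)]) (use ca f g in auto)
    then show "((\<lambda>q. x *\<^sub>R f q + y *\<^sub>R g q) \<circ> inv_into (fst (chart_at A p)) (snd (chart_at A p)) has_derivative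
       (\<lambda>v. x *\<^sub>R chart_diff (chart_at A p) f p v + y *\<^sub>R chart_diff (chart_at A p) g p v)) (at (snd (chart_at A p) p))"
      by (simp add: o_def)
  qed (use ca eq in auto)
qed

definition phi :: "'a chart \<Rightarrow> 'a \<Rightarrow> complex" where "phi c p = vecc (snd c p)"
definition psi :: "'a chart \<Rightarrow> complex \<Rightarrow> 'a" where "psi c z = inv_into (fst c) (snd c) (cvec z)"
definition dom_of :: "'a chart \<Rightarrow> complex set" where "dom_of c = phi c ` fst c"

lemma psi_phi: "c \<in> A \<Longrightarrow> p \<in> fst c \<Longrightarrow> psi c (phi c p) = p"
  by (simp add: psi_def phi_def chart_inv)

lemma phi_psi: "c \<in> A \<Longrightarrow> z \<in> dom_of c \<Longrightarrow> phi c (psi c z) = z \<and> psi c z \<in> fst c"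
  by (auto simp: dom_of_def psi_phi)

lemma snd_psi: "c \<in> A \<Longrightarrow> z \<in> dom_of c \<Longrightarrow> snd c (psi c z) = cvec z"
  using phi_psi[of c z] cvec_vecc(1)[of "snd c (psi c z)"] by (simp add: phi_def del: cvec_vecc)

lemma open_vecc_image: "open T \<Longrightarrow> open (vecc ` T)"
proof -
  assume "open T"
  moreover have "vecc ` T = cvec -` T" by force
  ultimately show ?thesis
    using open_vimage[of T cvec] linear_continuous_on[OF bounded_linear_cvec(1), of UNIV]
    by (simp add: continuous_on_open_vimage)
qed

lemma open_phi_image: "c \<in> A \<Longrightarrow> openin M U \<Longrightarrow> U \<subseteq> fst c \<Longrightarrow> open (phi c ` U)"
  using open_vecc_image[OF open_chart_image] by (simp add: phi_def[abs_def] image_image)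

lemma open_dom: "c \<in> A \<Longrightarrow> open (dom_of c)"
  unfolding dom_of_def by (rule open_phi_image) (auto simp: chart_open)

lemma open_psi_image:
  assumes c: "c \<in> A" and S: "open S" "S \<subseteq> dom_of c"
  shows "openin M (psi c ` S)"
proof -
  have "open (vecc -` S)"
    using open_vimage[OF S(1)] linear_continuous_on[OF bounded_linear_cvec(2), of UNIV] by blast
  then have "openin M {p \<in> fst c. snd c p \<in> vecc -` S}" by (rule open_chart_preimage[OF c])
  moreover have "{p \<in> fst c. snd c p \<in> vecc -` S} = psi c ` S"
    using S(2) phi_psi[OF c] psi_phi[OF c] by (force simp: phi_def image_iff)
  ultimately show ?thesis by simp
qed

lemma coordinate_ball:
  assumes U: "openin M U" "p \<in> U"
  obtains c r where "c \<in> A" "p \<in> fst c" "r > 0" "ball (phi c p) r \<subseteq> dom_of c" "psi c ` ball (phi c p) r \<subseteq> U"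
    "openin M (psi c ` ball (phi c p) r)" "p \<in> psi c ` ball (phi c p) r"
proof -
  have "p \<in> topspace M" using U openin_subset by blast
  then obtain c where c: "c \<in> A" "p \<in> fst c" using chart_at by blast
  have "open (phi c ` (U \<inter> fst c))" by (rule open_phi_image[OF c(1)]) (use openin_Int[OF U(1) chart_open(1)[OF c(1)]] in auto)
  then obtain r where r: "r > 0" "ball (phi c p) r \<subseteq> phi c ` (U \<inter> fst c)"
    using c U unfolding open_contains_ball by (metis IntI imageI)
  have "ball (phi c p) r \<subseteq> dom_of c" using r by (auto simp: dom_of_def)
  moreover have "psi c ` ball (phi c p) r \<subseteq> U"
  proof
    fix q assume "q \<in> psi c ` ball (phi c p) r"
    then obtain x where "x \<in> U" "x \<in> fst c" "q = psi c (phi c x)" using r(2) by blast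
    then show "q \<in> U" using psi_phi[OF c(1)] by simp
  qed
  moreover have "p \<in> psi c ` ball (phi c p) r" using psi_phi[OF c] r(1) by (metis centre_in_ball imageI)
  ultimately show ?thesis using that[OF c r(1)] open_psi_image[OF c(1)] open_ball by blast
qed

lemma twice_diff_chart:
  assumes f: "smooth_map_on A U f" and c: "c \<in> A" and S: "S \<subseteq> dom_of c" "psi c ` S \<subseteq> U"
  shows "twice_diff_on S (\<lambda>z. f (psi c z)) (\<lambda>z d. chart_diff c f (psi c z) (cvec d))"
  unfolding twice_diff_on_def
proof (intro ballI conjI allI)
  fix z v assume z: "z \<in> S"
  let ?g = "f \<circ> inv_into (fst c) (snd c)"
  have p: "psi c z \<in> fst c" "psi c z \<in> U" and sz: "snd c (psi c z) = cvec z"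
    using phi_psi[OF c, of z] snd_psi[OF c, of z] z S by auto
  have 1: "(?g has_derivative chart_diff c f (psi c z)) (at (cvec z))"
    using smooth_mapD(1)[OF f c p] sz by simp
  show "((\<lambda>z. f (psi c z)) has_derivative (\<lambda>d. chart_diff c f (psi c z) (cvec d))) (at z)"
    using has_derivative_compose[OF bounded_linear_imp_has_derivative[OF bounded_linear_cvec(1)] 1]
    by (simp add: psi_def o_def)
  have 2: "(\<lambda>x. frechet_derivative ?g (at x) (cvec v)) differentiable (at (cvec z))"
    using smooth_mapD(2)[OF f c p] sz by simp
  obtain L where L: "((\<lambda>x. frechet_derivative ?g (at x) (cvec v)) has_derivative L) (at (cvec z))"
    using 2 by (auto simp: differentiable_def)
  show "(\<lambda>z. chart_diff c f (psi c z) (cvec v)) differentiable (at z)"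
  proof -
    have "((\<lambda>z. frechet_derivative ?g (at (cvec z)) (cvec v)) has_derivative (\<lambda>d. L (cvec d))) (at z)"
      by (rule has_derivative_compose[OF bounded_linear_imp_has_derivative[OF bounded_linear_cvec(1)] L])
    then have "((\<lambda>z. chart_diff c f (psi c z) (cvec v)) has_derivative (\<lambda>d. L (cvec d))) (at z)"
    proof (rule has_derivative_transform_within_open)
      show "open (dom_of c)" by (rule open_dom[OF c])
      show "z \<in> dom_of c" using z S by blast
      fix y assume "y \<in> dom_of c"
      then have "snd c (psi c y) = cvec y" by (rule snd_psi[OF c])
      then show "frechet_derivative ?g (at (cvec y)) (cvec v) = chart_diff c f (psi c y) (cvec v)"
        by (simp add: chart_diff_def)
    qed
    then show ?thesis by (auto simp: differentiable_def)
  qed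
qed

end

subsection \<open>Principal curvatures\<close>

definition cross2 :: "real^2 \<Rightarrow> real^2 \<Rightarrow> real" where
  "cross2 v w = v $ 1 * w $ 2 - v $ 2 * w $ 1"

lemma tangent_basis_iff: "tangent_basis b \<longleftrightarrow> cross2 (b 1) (b 2) \<noteq> 0"
proof
  have r: "range b = {b 1, b 2}" using UNIV_2 by (metis image_empty image_insert)
  {
    assume tb: "tangent_basis b"
    then have "inj b" by (simp add: tangent_basis_def)
    moreover have "(1::2) \<noteq> 2" by simp
    ultimately have ne: "b 1 \<noteq> b 2" by (metis injD)
    have ind: "x = 0 \<and> y = 0" if "x *\<^sub>R b 1 + y *\<^sub>R b 2 = 0" for x y
    proof -
      have i: "independent {b 1, b 2}" using tb r by (simp add: tangent_basis_def)
      have *: "(if v = b 1 then x else y) = 0" if "v \<in> {b 1, b 2}" for v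
        using independentD[OF i, of "{b 1, b 2}" "\<lambda>v. if v = b 1 then x else y" v]
          \<open>x *\<^sub>R b 1 + y *\<^sub>R b 2 = 0\<close> ne that by auto
      from *[of "b 1"] *[of "b 2"] ne show ?thesis by simp
    qed
    show "cross2 (b 1) (b 2) \<noteq> 0"
    proof
      assume 0: "cross2 (b 1) (b 2) = 0"
      have "b 2 $ 1 *\<^sub>R b 1 + (- b 1 $ 1) *\<^sub>R b 2 = 0" "b 2 $ 2 *\<^sub>R b 1 + (- b 1 $ 2) *\<^sub>R b 2 = 0"
        using 0 by (simp_all add: vec_eq_iff forall_2 cross2_def algebra_simps)
      from ind[OF this(1)] ind[OF this(2)] have "b 1 = 0" by (simp add: vec_eq_iff forall_2)
      then show False using ind[of 1 0] by simp
    qed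
  }
  {
    assume c: "cross2 (b 1) (b 2) \<noteq> 0"
    then have ne: "b 1 \<noteq> b 2" by (auto simp: cross2_def)
    have ind: "x = 0 \<and> y = 0" if "x *\<^sub>R b 1 + y *\<^sub>R b 2 = 0" for x y
    proof -
      have e: "x * b 1 $ 1 + y * b 2 $ 1 = 0" "x * b 1 $ 2 + y * b 2 $ 2 = 0"
        using that by (simp_all add: vec_eq_iff forall_2)
      have "x * cross2 (b 1) (b 2) = (x * b 1 $ 1 + y * b 2 $ 1) * b 2 $ 2 - (x * b 1 $ 2 + y * b 2 $ 2) * b 2 $ 1"
        "y * cross2 (b 1) (b 2) = (x * b 1 $ 2 + y * b 2 $ 2) * b 1 $ 1 - (x * b 1 $ 1 + y * b 2 $ 1) * b 1 $ 2"
        by (simp_all add: cross2_def algebra_simps)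
      then show ?thesis using c unfolding e by simp
    qed
    have "independent {b 1, b 2}"
    proof (rule independent_if_scalars_zero)
      fix f :: "real^2 \<Rightarrow> real" and x assume "(\<Sum>x\<in>{b 1, b 2}. f x *\<^sub>R x) = 0" "x \<in> {b 1, b 2}"
      then show "f x = 0" using ind[of "f (b 1)" "f (b 2)"] ne by auto
    qed simp
    moreover have "inj b"
    proof (rule injI)
      fix x y :: 2 assume "b x = b y"
      then show "x = y" using ne exhaust_2[of x] exhaust_2[of y] by auto
    qed
    ultimately show "tangent_basis b" using r by (simp add: tangent_basis_def)
  }
qed

lemma vol_change:
  fixes L M :: "real^2 \<Rightarrow> real^4"
  assumes "linear L" "linear M"
  shows "vol f n (L v) (L w) = cross2 v w * vol f n (L (axis 1 1)) (L (axis 2 1))"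
    "mixed_vol f n (L v) (L w) (M v) (M w) = cross2 v w * mixed_vol f n (L (axis 1 1)) (L (axis 2 1)) (M (axis 1 1)) (M (axis 2 1))"
proof -
  have l: "linear (\<lambda>z. L (cvec z))" "linear (\<lambda>z. M (cvec z))"
    using linear_compose[OF linear_cvec(1)] assms by (simp_all add: o_def)
  show "vol f n (L v) (L w) = cross2 v w * vol f n (L (axis 1 1)) (L (axis 2 1))"
    using alternating_vol_same[OF l(1), of f n "vecc v" "vecc w"]
    by (simp add: cvec_axis cross2_def vecc_def[of v, symmetric]) (simp add: vecc_def)
  show "mixed_vol f n (L v) (L w) (M v) (M w) = cross2 v w * mixed_vol f n (L (axis 1 1)) (L (axis 2 1)) (M (axis 1 1)) (M (axis 2 1))"
    using alternating_vol[OF l, of f n "vecc v" "vecc w"]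
    by (simp add: cvec_axis cross2_def mixed_vol_def vecc_def[of v, symmetric]) (simp add: vecc_def)
qed

lemma cross2_matrix: "cross2 (K (axis 1 1)) (K (axis 2 1)) = det (matrix K)"
  by (simp add: cross2_def det_2 matrix_def algebra_simps)

text \<open>The eigenvalues are \<open>(p + r) / 2\<close> plus or minus \<open>d\<close>, and for
  an eigenvalue k the vector (q, k - p) is an eigenvector. For \<open>q = 0\<close> this vector may
  be zero, but then the coordinate axes serve.\<close>

lemma symmetric_eigenbasis:
  fixes p q r :: real
  obtains u v k l where "cross2 u v \<noteq> 0"
    "p * u $ 1 + q * u $ 2 = k * u $ 1" "q * u $ 1 + r * u $ 2 = k * u $ 2"
    "p * v $ 1 + q * v $ 2 = l * v $ 1" "q * v $ 1 + r * v $ 2 = l * v $ 2"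
proof (cases "q = 0")
  case True
  then show ?thesis using that[of "axis 1 1" "axis 2 1" p r] by (simp add: cross2_def axis_def)
next
  case False
  define d where "d = sqrt (((p - r) / 2)\<^sup>2 + q\<^sup>2)"
  have dd: "d * d = ((p - r) / 2)\<^sup>2 + q\<^sup>2" by (simp add: d_def)
  have d0: "d \<noteq> 0" using False by (simp add: d_def sum_power2_eq_zero_iff)
  have e: "q * q + r * (e * d - (p - r) / 2) = ((p + r) / 2 + e * d) * (e * d - (p - r) / 2)" if "e * e = 1" for e
  proof -
    have "((p + r) / 2 + e * d) * (e * d - (p - r) / 2) = (e * e) * (d * d) + r * (e * d) - (p + r) * (p - r) / 4"
      by (simp add: field_simps)
    also have "\<dots> = q * q + r * (e * d - (p - r) / 2)"
      unfolding that dd by (simp add: power2_eq_square field_simps)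
    finally show ?thesis by simp
  qed
  show ?thesis
  proof (rule that[of "cvec (Complex q (d - (p - r) / 2))" "cvec (Complex q (- d - (p - r) / 2))" "(p + r) / 2 + d" "(p + r) / 2 - d"])
    show "cross2 (cvec (Complex q (d - (p - r) / 2))) (cvec (Complex q (- d - (p - r) / 2))) \<noteq> 0"
      using False d0 by (simp add: cross2_def algebra_simps)
  qed (use e[of 1] e[of "-1"] in \<open>simp_all add: field_simps\<close>)
qed

text \<open>With dm = - dg S, the area of dm is det S times that of dg, and the mixed area is -
  trace S times it. An eigenbasis has to be produced because the curvatures are definite
  descriptions over principal curvatures. The plane is that of \<open>f\<close> and \<open>n\<close>
  rather than of \<open>g\<close> and \<open>m\<close>, which makes the lemma fit parallel
  fronts.\<close>

lemma curvatures:
  assumes fr: "frame f n e1 e2"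
    and lin: "linear (differential A g p)" "linear (differential A m p)"
    and E: "\<And>v. differential A g p v \<in> perp2 f n" "\<And>v. differential A m p v \<in> perp2 f n"
    and inj: "inj (differential A g p)"
    and sym: "\<And>v w. mink (differential A g p v) (differential A m p w) = mink (differential A g p w) (differential A m p v)"
  defines "a1 \<equiv> differential A g p (axis 1 1)" and "a2 \<equiv> differential A g p (axis 2 1)"
    and "t1 \<equiv> differential A m p (axis 1 1)" and "t2 \<equiv> differential A m p (axis 2 1)"
  shows "2 * vol f n a1 a2 * mean_curvature A g m p = - mixed_vol f n a1 a2 t1 t2"
    "vol f n a1 a2 * (gauss_curvature A g m p + 1) = vol f n t1 t2"
    "vol f n a1 a2 \<noteq> 0"
proof -
  let ?al = "differential A g p" and ?th = "differential A m p"
  \<comment> \<open>Coordinates in the normal plane. Through them dg becomes an invertible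
    endomorphism \<open>a\<close> of \<open>real^2\<close>, and the shape operator is minus its
    inverse applied to dm.\<close>
  define co where "co v = cvec (Complex (mink v e1) (mink v e2))" for v
  have co_lin: "linear co"
    by (rule linearI) (simp_all add: co_def vec_eq_iff forall_2 mink_bilinear)
  have co_eq: "v = w" if "co v = co w" "v \<in> perp2 f n" "w \<in> perp2 f n" for v w
  proof -
    have "mink v e1 = mink w e1" "mink v e2 = mink w e2" using that(1) by (simp_all add: co_def vec_eq_iff forall_2)
    then show ?thesis using frame_exp[OF fr that(2)] frame_exp[OF fr that(3)] by simp
  qed
  define a where "a v = co (?al v)" for v
  have a_lin: "linear a" using linear_compose[OF lin(1) co_lin] by (simp add: a_def[abs_def] o_def)
  have a_inj: "inj a"
    by (rule injI) (use co_eq E inj in \<open>auto simp: a_def inj_def\<close>)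
  obtain g' where g': "linear g'" "g' \<circ> a = id" using linear_injective_left_inverse[OF a_lin a_inj] by blast
  have ag: "a (g' v) = v" for v
    using linear_injective_imp_surjective[OF a_lin a_inj] g'(2) by (metis comp_apply id_apply surjD)
  define S where "S v = - g' (co (?th v))" for v
  have S_lin: "linear S"
    using linear_compose_neg[OF linear_compose[OF linear_compose[OF lin(2) co_lin] g'(1)]]
    by (simp add: S_def[abs_def] o_def)
  have S: "?th v = - ?al (S v)" for v
  proof (rule co_eq)
    show "?th v \<in> perp2 f n" by (rule E)
    show "- ?al (S v) \<in> perp2 f n" using subspace_neg[OF subspace_perp2 E(1)] .
    have "co (- ?al (S v)) = - a (S v)" by (simp add: a_def linear_neg[OF co_lin])
    also have "\<dots> = a (g' (co (?th v)))" by (simp add: S_def linear_neg[OF a_lin])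
    finally show "co (?th v) = co (- ?al (S v))" by (simp add: ag)
  qed
  have shape: "shape_operator A g m p = S"
    unfolding shape_operator_def
  proof (rule the_equality)
    show "linear S \<and> (\<forall>X. ?th X = - ?al (S X))" using S_lin S by blast
    fix S' assume "linear S' \<and> (\<forall>X. ?th X = - ?al (S' X))"
    then have "?al (S' X) = ?al (S X)" for X using S[of X] by (metis neg_equal_iff_equal)
    then show "S' = S" using inj by (auto simp: inj_def)
  qed
  have A0: "vol f n a1 a2 \<noteq> 0"
  proof
    assume 0: "vol f n a1 a2 = 0"
    then have "vol f n (?al v) (?al w) = 0" for v w
      using vol_change(1)[OF lin(1) lin(1), of f n v w] by (simp add: a1_def a2_def)
    moreover have e: "?al (g' (axis 1 1)) = e1" "?al (g' (axis 2 1)) = e2"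
    proof -
      have ee: "e1 \<in> perp2 f n" "e2 \<in> perp2 f n" "co e1 = axis 1 1" "co e2 = axis 2 1"
        using fr by (simp_all add: frame_def co_def vec_eq_iff forall_2 axis_def mink_commute[of e2 e1])
      then show "?al (g' (axis 1 1)) = e1" "?al (g' (axis 2 1)) = e2"
        using co_eq[OF _ E(1)] ag by (metis a_def)+
    qed
    ultimately show False using frame_vol[OF fr] by metis
  qed
  have pc: "vol f n a1 a2 * (k1 * k2) = vol f n t1 t2 \<and> vol f n a1 a2 * (k1 + k2) = - mixed_vol f n a1 a2 t1 t2"
    if pc: "principal_curvatures A g m p k1 k2" for k1 k2
  proof -
    obtain b :: "2 \<Rightarrow> real^2" where b: "cross2 (b 1) (b 2) \<noteq> 0" "S (b 1) = k1 *\<^sub>R b 1" "S (b 2) = k2 *\<^sub>R b 2"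
      using pc unfolding principal_curvatures_def shape tangent_basis_iff by blast
    have th: "?th (b 1) = - (k1 *\<^sub>R ?al (b 1))" "?th (b 2) = - (k2 *\<^sub>R ?al (b 2))"
      using S[of "b 1"] S[of "b 2"] b(2,3) by (simp_all add: linear_scale[OF lin(1)])
    let ?c = "cross2 (b 1) (b 2)"
    have "?c * vol f n t1 t2 = ?c * (vol f n a1 a2 * (k1 * k2))"
      using vol_change(1)[OF lin(2) lin(2), of f n "b 1" "b 2"] vol_change(1)[OF lin(1) lin(1), of f n "b 1" "b 2"]
      unfolding th by (auto simp: vol_bilinear a1_def a2_def t1_def t2_def mult.commute mult.left_commute)
    moreover have "?c * mixed_vol f n a1 a2 t1 t2 = ?c * - (vol f n a1 a2 * (k1 + k2))"
      using vol_change(2)[OF lin, of f n "b 1" "b 2"] vol_change(1)[OF lin(1) lin(1), of f n "b 1" "b 2"]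
      unfolding th by (simp add: mixed_vol_def vol_bilinear a1_def a2_def t1_def t2_def algebra_simps)
    ultimately show ?thesis using mult_left_cancel[OF b(1)] by (metis minus_minus)
  qed
  have ex: "\<exists>k1 k2. principal_curvatures A g m p k1 k2"
  proof -
    \<comment> \<open>The shape operator transported to the normal plane. There it is symmetric for
      the Euclidean inner product, which is what \<open>symmetric_eigenbasis\<close> needs.\<close>
    define h where "h v = a (S (g' v))" for v
    have h_lin: "linear h"
      using linear_compose[OF linear_compose[OF g'(1) S_lin] a_lin] by (simp add: h_def[abs_def] o_def)
    have ip: "co v \<bullet> co w = mink v w" if "v \<in> perp2 f n" for v w
      using frame_mink[OF fr that, of w] by (simp add: co_def inner_vec_def sum_2)
    have hs: "h v \<bullet> w = - mink (?th (g' v)) (?al (g' w))" for v w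
    proof -
      have "h v \<bullet> w = co (?al (S (g' v))) \<bullet> co (?al (g' w))"
        using ag[of w] by (simp add: h_def a_def)
      also have "\<dots> = - mink (?th (g' v)) (?al (g' w))"
        unfolding ip[OF E(1)] S[of "g' v"] by (simp add: mink_bilinear)
      finally show ?thesis .
    qed
    have hsym: "h v \<bullet> w = h w \<bullet> v" for v w
      unfolding hs using sym[of "g' v" "g' w"] sym[of "g' w" "g' v"] by (simp add: mink_commute)
    define P Q R where "P = h (axis 1 1) $ 1" and "Q = h (axis 2 1) $ 1" and "R = h (axis 2 1) $ 2"
    have Q: "h (axis 1 1) $ 2 = Q" using hsym[of "axis 1 1" "axis 2 1"] by (simp add: Q_def inner_axis)
    have hv: "h v $ 1 = P * v $ 1 + Q * v $ 2" "h v $ 2 = Q * v $ 1 + R * v $ 2" for v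
    proof -
      have "v = v $ 1 *\<^sub>R axis 1 1 + v $ 2 *\<^sub>R axis 2 1" by (simp add: vec_eq_iff forall_2 axis_def)
      then have "h v = h (v $ 1 *\<^sub>R axis 1 1 + v $ 2 *\<^sub>R axis 2 1)" by simp
      then have "h v = v $ 1 *\<^sub>R h (axis 1 1) + v $ 2 *\<^sub>R h (axis 2 1)"
        by (simp only: linear_add[OF h_lin] linear_scale[OF h_lin])
      then show "h v $ 1 = P * v $ 1 + Q * v $ 2" "h v $ 2 = Q * v $ 1 + R * v $ 2"
        using Q by (simp_all add: P_def Q_def R_def)
    qed
    obtain u v k l where uv: "cross2 u v \<noteq> 0"
      "P * u $ 1 + Q * u $ 2 = k * u $ 1" "Q * u $ 1 + R * u $ 2 = k * u $ 2"
      "P * v $ 1 + Q * v $ 2 = l * v $ 1" "Q * v $ 1 + R * v $ 2 = l * v $ 2"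
      using symmetric_eigenbasis[of P Q R] by metis
    have huv: "h u = k *\<^sub>R u" "h v = l *\<^sub>R v" using uv hv by (simp_all add: vec_eq_iff forall_2)
    have Sg: "S (g' w) = g' (h w)" for w using g'(2) unfolding h_def by (metis comp_apply id_apply)
    define b :: "2 \<Rightarrow> real^2" where "b i = (if i = 1 then g' u else g' v)" for i
    have "S (b 1) = k *\<^sub>R b 1" "S (b 2) = l *\<^sub>R b 2"
      by (simp_all add: b_def Sg huv linear_scale[OF g'(1)])
    moreover have "cross2 (b 1) (b 2) \<noteq> 0"
    proof
      assume "cross2 (b 1) (b 2) = 0"
      then have "vol f n (?al (g' u)) (?al (g' v)) = 0"
        using vol_change(1)[OF lin(1) lin(1), of f n "g' u" "g' v"] by (simp add: b_def)
      then have "mink (?al (g' u)) e1 * mink (?al (g' v)) e2 - mink (?al (g' u)) e2 * mink (?al (g' v)) e1 = 0"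
        using frame_vol_exp[OF fr E(1) E(1)] frame_vol[OF fr] by simp
      moreover have "co (?al (g' w)) = w" for w using ag[of w] by (simp add: a_def)
      then have "mink (?al (g' w)) e1 = w $ 1" "mink (?al (g' w)) e2 = w $ 2" for w
        by (metis co_def cvec_nth(1) complex.sel(1), metis co_def cvec_nth(2) complex.sel(2))
      ultimately show False using uv(1) by (simp add: cross2_def)
    qed
    ultimately have "principal_curvatures A g m p k l"
      unfolding principal_curvatures_def shape tangent_basis_iff by blast
    then show ?thesis by blast
  qed
  then obtain k1 k2 where k: "principal_curvatures A g m p k1 k2" by blast
  have uniq: "j1 + j2 = k1 + k2 \<and> j1 * j2 = k1 * k2" if "principal_curvatures A g m p j1 j2" for j1 j2
  proof -
    have "vol f n a1 a2 * (j1 + j2) = vol f n a1 a2 * (k1 + k2)" "vol f n a1 a2 * (j1 * j2) = vol f n a1 a2 * (k1 * k2)"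
      using pc[OF k] pc[OF that] by simp_all
    then show ?thesis using mult_left_cancel[OF A0] by blast
  qed
  have mc: "mean_curvature A g m p = (k1 + k2) / 2"
    unfolding mean_curvature_def by (rule the_equality) (use k uniq in blast, use uniq in fastforce)
  have "2 * vol f n a1 a2 * mean_curvature A g m p = vol f n a1 a2 * (k1 + k2)" unfolding mc by simp
  then show "2 * vol f n a1 a2 * mean_curvature A g m p = - mixed_vol f n a1 a2 t1 t2"
    using pc[OF k] by simp
  have "gauss_curvature A g m p = k1 * k2 - 1"
    unfolding gauss_curvature_def by (rule the_equality) (use k uniq in blast, use uniq in fastforce)
  then show "vol f n a1 a2 * (gauss_curvature A g m p + 1) = vol f n t1 t2"
    using pc[OF k] by simp
  show "vol f n a1 a2 \<noteq> 0" by (rule A0)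
qed

subsection \<open>Co-oriented fronts on surfaces\<close>

lemma span_unit_eq:
  assumes "span {x} = span {y::real^4}" "mink x x = e" "mink y y = e" "e \<noteq> 0"
  shows "x = y \<or> x = - y"
proof -
  have "x \<in> span {y}" using assms(1) span_base[of x "{x}"] by auto
  then obtain k where k: "x = k *\<^sub>R y" by (auto simp: span_singleton)
  then have "k * k * e = 1 * e" using assms(2,3) by (simp add: mink_bilinear)
  then have "k = 1 \<or> k = -1" using assms(4) by (simp add: square_eq_1_iff)
  then show ?thesis using k by auto
qed

text \<open>The sign relating \<open>g\<close> and \<open>h\<close> is a continuous function with
  finite range, hence constant on a connected set.\<close>

lemma constant_sign:
  fixes g h :: "complex \<Rightarrow> real^4"
  assumes S: "connected S" and c: "continuous_on S g" "continuous_on S h"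
    and pm: "\<And>z. z \<in> S \<Longrightarrow> g z = h z \<or> g z = - h z" and unit: "\<And>z. z \<in> S \<Longrightarrow> mink (h z) (h z) = 1 \<or> mink (h z) (h z) = -1"
  obtains t where "t = 1 \<or> t = -1" "\<And>z. z \<in> S \<Longrightarrow> g z = t *\<^sub>R h z"
proof (cases "S = {}")
  case True then show ?thesis using that[of 1] by simp
next
  case False
  then obtain z0 where z0: "z0 \<in> S" by blast
  \<comment> \<open>The second factor corrects for the causal type of \<open>h z\<close>, so that
    \<open>k\<close> is the sign itself for timelike and spacelike vectors alike.\<close>
  define k where "k z = mink (g z) (h z) * mink (h z) (h z)" for z
  have k: "k z = (if g z = h z then 1 else -1)" if "z \<in> S" for z
    using pm[OF that] unit[OF that] by (auto simp: k_def mink_bilinear)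
  have "continuous_on S k"
    unfolding k_def by (intro continuous_on_mult mink.continuous_on c)
  moreover have "finite (k ` S)"
    by (rule finite_subset[of _ "{1, -1}"]) (use k in auto)
  ultimately have "k constant_on S"
    by (rule continuous_finite_range_constant[OF S])
  then have kc: "k z = k z0" if "z \<in> S" for z using that z0 by (auto simp: constant_on_def)
  show ?thesis
  proof (rule that[of "k z0"])
    show "k z0 = 1 \<or> k z0 = -1" using k[OF z0] by simp
    show "g z = k z0 *\<^sub>R h z" if "z \<in> S" for z
    proof (cases "g z = h z")
      case True then show ?thesis using kc[OF that] k[OF that] by simp
    next
      case False
      then have "k z0 = -1" using kc[OF that] k[OF that] by simp
      then show ?thesis using pm[OF that] False by simp
    qed
  qed
qed

locale cooriented_front = surface M A for M :: "'a topology" and A :: "'a atlas" +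
  fixes f \<nu> :: "'a \<Rightarrow> real^4"
  assumes smooth_f: "smooth_map_on A (topspace M) f" and smooth_n: "smooth_map_on A (topspace M) \<nu>"
    and norm_f: "p \<in> topspace M \<Longrightarrow> mink (f p) (f p) = -1" and norm_n: "p \<in> topspace M \<Longrightarrow> mink (\<nu> p) (\<nu> p) = 1"
    and perp_fn: "p \<in> topspace M \<Longrightarrow> mink (f p) (\<nu> p) = 0"
    and orthogonal: "p \<in> topspace M \<Longrightarrow> mink (differential A f p X) (\<nu> p) = 0"
    and immersion: "p \<in> topspace M \<Longrightarrow> differential A f p X = 0 \<Longrightarrow> differential A \<nu> p X = 0 \<Longrightarrow> X = 0"
begin

text \<open>The three areas in the preferred chart at \<open>p\<close>. A change of chart multiplies
  them by a common factor, so only homogeneous relations among \<open>gA\<close>, \<open>gT\<close>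
  and \<open>gM\<close> have a meaning; \<open>patch_forms\<close> compares them with the areas in a
  fixed chart.\<close>

definition "gA p = vol (f p) (\<nu> p) (differential A f p (axis 1 1)) (differential A f p (axis 2 1))"
definition "gT p = vol (f p) (\<nu> p) (differential A \<nu> p (axis 1 1)) (differential A \<nu> p (axis 2 1))"
definition "gM p = mixed_vol (f p) (\<nu> p) (differential A f p (axis 1 1)) (differential A f p (axis 2 1))
  (differential A \<nu> p (axis 1 1)) (differential A \<nu> p (axis 2 1))"

lemma differential_chart:
  assumes c: "c \<in> A" "p \<in> fst c"
  shows "chart_diff c f p v = differential A f p (trans_deriv c (chart_at A p) p v)"
    "chart_diff c \<nu> p v = differential A \<nu> p (trans_deriv c (chart_at A p) p v)"
proof -
  have p: "p \<in> topspace M" using c chart_open(3) by blast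
  note ca = chart_at[OF p]
  show "chart_diff c f p v = differential A f p (trans_deriv c (chart_at A p) p v)"
    "chart_diff c \<nu> p v = differential A \<nu> p (trans_deriv c (chart_at A p) p v)"
    unfolding differential_chart_diff
    by (rule chart_diff_change(1)[OF smooth_mapD(1)[OF smooth_f]] chart_diff_change(1)[OF smooth_mapD(1)[OF smooth_n]];
      use ca c p in blast)+
qed

lemma linear_differential:
  assumes "p \<in> topspace M" shows "linear (differential A f p)" "linear (differential A \<nu> p)"
  using differential_eq(2)[OF smooth_f] differential_eq(2)[OF smooth_n] chart_at[OF assms] assms by blast+

lemma patch:
  assumes c: "c \<in> A" and S: "open S" "S \<subseteq> dom_of c"
  shows "front_patch S (\<lambda>z. f (psi c z)) (\<lambda>z. \<nu> (psi c z)) (\<lambda>z d. chart_diff c f (psi c z) (cvec d))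
    (\<lambda>z d. chart_diff c \<nu> (psi c z) (cvec d))"
proof -
  have pc: "psi c z \<in> fst c" "psi c z \<in> topspace M" if "z \<in> S" for z
    using phi_psi[OF c] S(2) that chart_open(3)[OF c] by blast+
  show ?thesis
  proof
    show "open S" by (rule S)
    show "twice_diff_on S (\<lambda>z. f (psi c z)) (\<lambda>z d. chart_diff c f (psi c z) (cvec d))"
      by (rule twice_diff_chart[OF smooth_f c S(2)]) (use pc in blast)
    show "twice_diff_on S (\<lambda>z. \<nu> (psi c z)) (\<lambda>z d. chart_diff c \<nu> (psi c z) (cvec d))"
      by (rule twice_diff_chart[OF smooth_n c S(2)]) (use pc in blast)
    fix z d assume z: "z \<in> S"
    note p = pc[OF z]
    show "mink (f (psi c z)) (f (psi c z)) = - 1" "mink (\<nu> (psi c z)) (\<nu> (psi c z)) = 1"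
      "mink (f (psi c z)) (\<nu> (psi c z)) = 0"
      using p norm_f norm_n perp_fn by blast+
    show "mink (chart_diff c f (psi c z) (cvec d)) (\<nu> (psi c z)) = 0"
      unfolding differential_chart[OF c p(1)] by (rule orthogonal[OF p(2)])
    assume 0: "chart_diff c f (psi c z) (cvec d) = 0" "chart_diff c \<nu> (psi c z) (cvec d) = 0"
    have "trans_deriv c (chart_at A (psi c z)) (psi c z) (cvec d) = 0"
      by (rule immersion[OF p(2)]) (use 0 differential_chart[OF c p(1)] in auto)
    moreover note ca = chart_at[OF p(2)]
    moreover have "trans_deriv (chart_at A (psi c z)) c (psi c z) 0 = 0"
      using trans_deriv[of "chart_at A (psi c z)" c "psi c z"] ca c p has_derivative_linear linear_0 by blast
    ultimately have "cvec d = 0"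
      using trans_deriv_inverse[of c "chart_at A (psi c z)" "psi c z" "cvec d"] c p by simp
    then show "d = 0" by (metis cvec_vecc(2) linear_0 linear_cvec(2))
  qed
qed

lemma patch_forms:
  assumes c: "c \<in> A" and z: "z \<in> dom_of c"
  defines "k \<equiv> det (matrix (trans_deriv c (chart_at A (psi c z)) (psi c z)))"
  shows "k \<noteq> 0"
    "vol (f (psi c z)) (\<nu> (psi c z)) (chart_diff c f (psi c z) (cvec 1)) (chart_diff c f (psi c z) (cvec \<i>)) = k * gA (psi c z)"
    "vol (f (psi c z)) (\<nu> (psi c z)) (chart_diff c \<nu> (psi c z) (cvec 1)) (chart_diff c \<nu> (psi c z) (cvec \<i>)) = k * gT (psi c z)"
    "mixed_vol (f (psi c z)) (\<nu> (psi c z)) (chart_diff c f (psi c z) (cvec 1)) (chart_diff c f (psi c z) (cvec \<i>))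
       (chart_diff c \<nu> (psi c z) (cvec 1)) (chart_diff c \<nu> (psi c z) (cvec \<i>)) = k * gM (psi c z)"
proof -
  have p: "psi c z \<in> fst c" "psi c z \<in> topspace M"
    using phi_psi[OF c z] chart_open(3)[OF c] by blast+
  note ca = chart_at[OF p(2)]
  note l = linear_differential[OF p(2)]
  show "k \<noteq> 0" unfolding k_def by (rule trans_deriv_det) (use c ca p in auto)
  show "vol (f (psi c z)) (\<nu> (psi c z)) (chart_diff c f (psi c z) (cvec 1)) (chart_diff c f (psi c z) (cvec \<i>)) = k * gA (psi c z)"
    "vol (f (psi c z)) (\<nu> (psi c z)) (chart_diff c \<nu> (psi c z) (cvec 1)) (chart_diff c \<nu> (psi c z) (cvec \<i>)) = k * gT (psi c z)"
    "mixed_vol (f (psi c z)) (\<nu> (psi c z)) (chart_diff c f (psi c z) (cvec 1)) (chart_diff c f (psi c z) (cvec \<i>))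
       (chart_diff c \<nu> (psi c z) (cvec 1)) (chart_diff c \<nu> (psi c z) (cvec \<i>)) = k * gM (psi c z)"
    unfolding differential_chart[OF c p(1)] k_def cross2_matrix[symmetric] gA_def gT_def gM_def cvec_axis
    by (rule vol_change[OF l(1) l(1)] vol_change[OF l(2) l(2)] vol_change[OF l])+
qed

lemma point_data:
  assumes p: "p \<in> topspace M"
  shows "differential A f p v \<in> perp2 (f p) (\<nu> p)" "differential A \<nu> p v \<in> perp2 (f p) (\<nu> p)"
    "mink (differential A f p v) (differential A \<nu> p w) = mink (differential A f p w) (differential A \<nu> p v)"
    "front_data (f p) (\<nu> p) (differential A f p (axis 1 1)) (differential A f p (axis 2 1))
      (differential A \<nu> p (axis 1 1)) (differential A \<nu> p (axis 2 1))"
proof -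
  define c where "c = chart_at A p"
  have c: "c \<in> A" "p \<in> fst c" using chart_at[OF p] by (simp_all add: c_def)
  interpret P: front_patch "dom_of c" "\<lambda>z. f (psi c z)" "\<lambda>z. \<nu> (psi c z)" "\<lambda>z d. chart_diff c f (psi c z) (cvec d)"
    "\<lambda>z d. chart_diff c \<nu> (psi c z) (cvec d)"
    by (rule patch[OF c(1) open_dom[OF c(1)]]) simp
  have z: "phi c p \<in> dom_of c" "psi c (phi c p) = p" using c psi_phi by (auto simp: dom_of_def)
  have d: "differential A f p v = chart_diff c f p (cvec (vecc v))" "differential A \<nu> p v = chart_diff c \<nu> p (cvec (vecc v))" for v
    by (simp_all add: differential_chart_diff c_def)
  show "differential A f p v \<in> perp2 (f p) (\<nu> p)" "differential A \<nu> p v \<in> perp2 (f p) (\<nu> p)"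
    "mink (differential A f p v) (differential A \<nu> p w) = mink (differential A f p w) (differential A \<nu> p v)"
    unfolding d using P.tangent[OF z(1), of "vecc v"] P.second_form_sym[OF z(1), of "vecc v" "vecc w"] unfolding z(2) by auto
  show "front_data (f p) (\<nu> p) (differential A f p (axis 1 1)) (differential A f p (axis 2 1))
      (differential A \<nu> p (axis 1 1)) (differential A \<nu> p (axis 2 1))"
    using P.data[OF z(1)] unfolding z(2) d cvec_axis[symmetric] cvec_vecc(2) .
qed

lemma regular_iff:
  assumes p: "p \<in> topspace M"
  shows "regular_point A f p \<longleftrightarrow> gA p \<noteq> 0"
proof
  assume r: "regular_point A f p"
  obtain e1 e2 where fr: "frame (f p) (\<nu> p) e1 e2" using frame_exists[OF norm_f[OF p] norm_n[OF p] perp_fn[OF p]] by blast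
  have "inj (differential A f p)" using r by (simp add: regular_point_def)
  then show "gA p \<noteq> 0"
    using curvatures(3)[OF fr, of A f p f] linear_differential[OF p] point_data(1)[OF p] by (simp add: gA_def mink_commute)
next
  assume g: "gA p \<noteq> 0"
  note l = linear_differential(1)[OF p]
  have "v = 0" if "differential A f p v = 0" for v
  proof -
    have "cross2 v w * gA p = 0" for w
      using vol_change(1)[OF l l, of "f p" "\<nu> p" v w] that by (simp add: gA_def vol_bilinear)
    then have "cross2 v w = 0" for w using g by simp
    from this[of "axis 1 1"] this[of "axis 2 1"] show "v = 0" by (simp add: cross2_def vec_eq_iff forall_2 axis_def)
  qed
  then show "regular_point A f p" unfolding regular_point_def using linear_injective_0[OF l] by blast
qed

lemma openin_regular:
  assumes "p \<in> topspace M" "gA p \<noteq> 0"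
  obtains U where "openin M U" "p \<in> U" "\<And>q. q \<in> U \<Longrightarrow> gA q \<noteq> 0"
proof -
  obtain c where c: "c \<in> A" "p \<in> fst c" using chart_at[OF assms(1)] by blast
  interpret P: front_patch "dom_of c" "\<lambda>z. f (psi c z)" "\<lambda>z. \<nu> (psi c z)" "\<lambda>z d. chart_diff c f (psi c z) (cvec d)"
    "\<lambda>z d. chart_diff c \<nu> (psi c z) (cvec d)"
    by (rule patch[OF c(1) open_dom[OF c(1)]]) simp
  have iff: "P.qA z = 0 \<longleftrightarrow> gA (psi c z) = 0" if "z \<in> dom_of c" for z
    using patch_forms[OF c(1) that] by (simp add: P.qA_def)
  define T where "T = dom_of c \<inter> P.qA -` (- {0})"
  have "open T" unfolding T_def by (rule continuous_open_preimage[OF P.cont(1) open_dom[OF c(1)]]) (simp add: open_Compl)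
  then have "openin M (psi c ` T)" by (rule open_psi_image[OF c(1)]) (simp add: T_def)
  moreover have "phi c p \<in> T" using iff[of "phi c p"] c psi_phi[OF c] assms(2) by (auto simp: T_def dom_of_def)
  then have "p \<in> psi c ` T" using psi_phi[OF c] by (metis imageI)
  moreover have "gA q \<noteq> 0" if "q \<in> psi c ` T" for q using that iff by (auto simp: T_def)
  ultimately show ?thesis using that by blast
qed

section \<open>From curvature equations to relations between areas\<close>

text \<open>The pair \<open>(g, m)\<close> is a hyperbolic rotation of \<open>f\<close> and
  \<open>sg\<close> times the normal. It leaves the difference of the areas unchanged (fact
  \<open>2\<close>), and as \<open>g + m\<close> is \<open>c + sg * s\<close> times the sum of the
  original pair, the area of the Gauss map is multiplied by the square of that number (fact
  \<open>3\<close>). The curvature equation times \<open>2 * A'\<close> is linear in these two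
  quantities.\<close>

lemma parallel_relation:
  assumes U: "openin M U" "p \<in> U" and g: "\<And>q. q \<in> U \<Longrightarrow> g q = c *\<^sub>R f q + s *\<^sub>R \<nu> q"
    and m: "\<And>q. q \<in> U \<Longrightarrow> m q = (sg * s) *\<^sub>R f q + (sg * c) *\<^sub>R \<nu> q"
    and cs: "c\<^sup>2 - s\<^sup>2 = 1" and sg: "sg = 1 \<or> sg = -1" and reg: "regular_point A g p"
    and rel: "a * (mean_curvature A g m p - 1) + b * gauss_curvature A g m p = 0"
  shows "(a * (c + sg * s)\<^sup>2) * (gA p + sg * gM p + gT p) + (a + 2 * b) * (gA p - gT p) = 0"
proof -
  have p: "p \<in> topspace M" using U openin_subset by blast
  obtain e1 e2 where fr: "frame (f p) (\<nu> p) e1 e2" using frame_exists[OF norm_f[OF p] norm_n[OF p] perp_fn[OF p]] by blast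
  have dg: "differential A g p = (\<lambda>v. c *\<^sub>R differential A f p v + s *\<^sub>R differential A \<nu> p v)"
    by (rule differential_lincomb[OF smooth_f p smooth_n p U g])
  have dm: "differential A m p = (\<lambda>v. (sg * s) *\<^sub>R differential A f p v + (sg * c) *\<^sub>R differential A \<nu> p v)"
    by (rule differential_lincomb[OF smooth_f p smooth_n p U m])
  note l = linear_differential[OF p] and pd = point_data[OF p]
  have lin: "linear (differential A g p)" "linear (differential A m p)"
    unfolding dg dm by (rule linear_compose_add linear_compose_scale_right l)+
  have inj: "inj (differential A g p)" using reg by (simp add: regular_point_def)
  have E: "differential A g p v \<in> perp2 (f p) (\<nu> p)" "differential A m p v \<in> perp2 (f p) (\<nu> p)" for v
    unfolding dg dm by (rule perp2_lincomb[OF pd(1,2)])+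
  have sym: "mink (differential A g p v) (differential A m p w) = mink (differential A g p w) (differential A m p v)" for v w
    unfolding dg dm using pd(3)[of v w] by (simp add: mink_bilinear mink_commute algebra_simps)
  note cv = curvatures[OF fr lin E inj sym]
  define A' T' M' where "A' = c\<^sup>2 * gA p + c * s * gM p + s\<^sup>2 * gT p"
    and "T' = s\<^sup>2 * gA p + c * s * gM p + c\<^sup>2 * gT p"
    and "M' = sg * (2 * c * s * gA p + (c\<^sup>2 + s\<^sup>2) * gM p + 2 * c * s * gT p)"
  have sg2: "sg * sg = 1" using sg by auto
  have sg3: "sg * (sg * r) = r" for r using sg2 by (simp flip: mult.assoc)
  have A': "vol (f p) (\<nu> p) (differential A g p (axis 1 1)) (differential A g p (axis 2 1)) = A'"
    unfolding dg vol_lincomb A'_def gA_def gT_def gM_def by simp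
  have T': "vol (f p) (\<nu> p) (differential A m p (axis 1 1)) (differential A m p (axis 2 1)) = T'"
    unfolding dm vol_lincomb T'_def gA_def gT_def gM_def using sg2 by (simp add: power2_eq_square algebra_simps sg3)
  have M': "mixed_vol (f p) (\<nu> p) (differential A g p (axis 1 1)) (differential A g p (axis 2 1))
      (differential A m p (axis 1 1)) (differential A m p (axis 2 1)) = M'"
    unfolding dg dm mixed_vol_lincomb M'_def gA_def gT_def gM_def by (simp add: power2_eq_square algebra_simps)
  have H: "2 * A' * mean_curvature A g m p = - M'" and K: "A' * (gauss_curvature A g m p + 1) = T'"
    using cv unfolding A' T' M' by simp_all
  have "2 * A' * (a * (mean_curvature A g m p - 1) + b * gauss_curvature A g m p) =
      a * (2 * A' * mean_curvature A g m p - 2 * A') + 2 * b * (A' * (gauss_curvature A g m p + 1) - A')"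
    by (simp add: algebra_simps)
  then have 1: "a * (- M' - 2 * A') + 2 * b * (T' - A') = 0" unfolding H K rel by simp
  have 2: "gA p - gT p = A' - T'"
  proof -
    have "A' - T' = (c\<^sup>2 - s\<^sup>2) * (gA p - gT p)" by (simp add: A'_def T'_def algebra_simps)
    then show ?thesis using cs by simp
  qed
  have 3: "(c + sg * s)\<^sup>2 * (gA p + sg * gM p + gT p) = A' + T' + M'"
    unfolding A'_def T'_def M'_def using sg2 by (simp add: power2_eq_square algebra_simps sg3)
  have 4: "a * (A' + T' + M') + (a + 2 * b) * (A' - T') = - (a * (- M' - 2 * A') + 2 * b * (T' - A'))"
    by (simp add: algebra_simps)
  have "a * (A' + T' + M') + (a + 2 * b) * (A' - T') = 0" unfolding 4 1 by simp
  then show ?thesis unfolding 2 3[symmetric] by (simp only: mult.assoc)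
qed

lemma local_normal_sign:
  assumes U: "openin M U" "p \<in> U" and n: "smooth_map_on A U n" "\<And>q. q \<in> U \<Longrightarrow> mink (n q) (n q) = 1"
    and L: "\<And>q. q \<in> U \<Longrightarrow> span {n q} = span {\<nu> q}"
  obtains c r t where "c \<in> A" "p \<in> fst c" "r > 0" "ball (phi c p) r \<subseteq> dom_of c" "psi c ` ball (phi c p) r \<subseteq> U"
    "openin M (psi c ` ball (phi c p) r)" "p \<in> psi c ` ball (phi c p) r" "t = 1 \<or> t = -1"
    "\<And>q. q \<in> psi c ` ball (phi c p) r \<Longrightarrow> n q = t *\<^sub>R \<nu> q"
proof -
  obtain c r where c: "c \<in> A" "p \<in> fst c" "r > 0" "ball (phi c p) r \<subseteq> dom_of c" "psi c ` ball (phi c p) r \<subseteq> U"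
    "openin M (psi c ` ball (phi c p) r)" "p \<in> psi c ` ball (phi c p) r"
    by (rule coordinate_ball[OF U])
  let ?S = "ball (phi c p) r"
  have UM: "U \<subseteq> topspace M" using U openin_subset by blast
  have "continuous_on ?S (\<lambda>z. n (psi c z))"
    by (rule isCont_twice[OF twice_diff_chart[OF n(1) c(1,4,5)]]) simp
  moreover have "continuous_on ?S (\<lambda>z. \<nu> (psi c z))"
    by (rule isCont_twice[OF twice_diff_chart[OF smooth_n c(1,4)]]) (use c(5) UM in auto)
  moreover have "n (psi c z) = \<nu> (psi c z) \<or> n (psi c z) = - \<nu> (psi c z)" "mink (\<nu> (psi c z)) (\<nu> (psi c z)) = 1 \<or> mink (\<nu> (psi c z)) (\<nu> (psi c z)) = -1"
    if "z \<in> ?S" for z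
  proof -
    have q: "psi c z \<in> U" "psi c z \<in> topspace M" using that c(5) UM by blast+
    show "n (psi c z) = \<nu> (psi c z) \<or> n (psi c z) = - \<nu> (psi c z)"
      by (rule span_unit_eq[OF L[OF q(1)] n(2)[OF q(1)] norm_n[OF q(2)]]) simp
    show "mink (\<nu> (psi c z)) (\<nu> (psi c z)) = 1 \<or> mink (\<nu> (psi c z)) (\<nu> (psi c z)) = -1" using norm_n[OF q(2)] by simp
  qed
  ultimately obtain t where "t = 1 \<or> t = -1" "\<And>z. z \<in> ?S \<Longrightarrow> n (psi c z) = t *\<^sub>R \<nu> (psi c z)"
    by (rule constant_sign[OF connected_ball]) (assumption, assumption, rule that, assumption+)
  then show ?thesis using that[OF c] by blast
qed

text \<open>At a regular point of \<open>g\<close> its differential fills the normal plane of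
  \<open>f\<close> and \<nu>. Hence \<open>n\<close> lies in the Lorentzian plane spanned by these
  two, where a unit vector orthogonal to \<open>g p\<close> is determined up to sign.\<close>

lemma normal_of_parallel:
  assumes p: "p \<in> topspace M" and U: "openin M U" "p \<in> U" and g: "\<And>q. q \<in> U \<Longrightarrow> g q = c *\<^sub>R f q + s *\<^sub>R \<nu> q"
    and cs: "c\<^sup>2 - s\<^sup>2 = 1" and reg: "regular_point A g p"
    and n: "mink (g p) n = 0" "\<And>X. mink (differential A g p X) n = 0" "mink n n = 1"
  shows "n = s *\<^sub>R f p + c *\<^sub>R \<nu> p \<or> n = - (s *\<^sub>R f p + c *\<^sub>R \<nu> p)"
proof -
  note nf = norm_f[OF p] and nn = norm_n[OF p] and fn = perp_fn[OF p]
  have nuf: "mink (\<nu> p) (f p) = 0" using fn by (simp add: mink_commute)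
  obtain e1 e2 where fr: "frame (f p) (\<nu> p) e1 e2" using frame_exists[OF nf nn fn] by blast
  have dg: "differential A g p = (\<lambda>v. c *\<^sub>R differential A f p v + s *\<^sub>R differential A \<nu> p v)"
    by (rule differential_lincomb[OF smooth_f p smooth_n p U g])
  have E: "differential A g p v \<in> perp2 (f p) (\<nu> p)" for v
    unfolding dg by (rule perp2_lincomb[OF point_data(1,2)[OF p]])
  have lin: "linear (differential A g p)"
    unfolding dg by (rule linear_compose_add linear_compose_scale_right linear_differential[OF p])+
  have inj: "inj (differential A g p)" using reg by (simp add: regular_point_def)
  let ?a = "differential A g p (axis 1 1)" and ?b = "differential A g p (axis 2 1)"
  have V: "vol (f p) (\<nu> p) ?a ?b \<noteq> 0"
    by (rule curvatures(3)[OF fr lin lin E E inj]) (simp add: mink_commute)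
  define x y where "x = - mink n (f p)" and "y = mink n (\<nu> p)"
  define r where "r = n - (x *\<^sub>R f p + y *\<^sub>R \<nu> p)"
  have rE: "r \<in> perp2 (f p) (\<nu> p)"
    by (simp add: r_def perp2_def mink_bilinear nf nn fn nuf x_def y_def)
  have "mink r ?a = 0" "mink r ?b = 0"
    using E[of "axis 1 1"] E[of "axis 2 1"] n(2)[of "axis 1 1"] n(2)[of "axis 2 1"]
    by (simp_all add: r_def perp2_def mink_bilinear mink_commute[of "f p"] mink_commute[of "\<nu> p"] mink_commute[of n])
  then have e: "mink ?a e1 * mink r e1 + mink ?a e2 * mink r e2 = 0" "mink ?b e1 * mink r e1 + mink ?b e2 * mink r e2 = 0"
    using frame_mink[OF fr E, of _ r] by (simp_all add: mink_commute[of r])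
  have d: "mink ?a e1 * mink ?b e2 - mink ?a e2 * mink ?b e1 \<noteq> 0"
    using V frame_vol_exp[OF fr E E] by auto
  have "(mink ?a e1 * mink ?b e2 - mink ?a e2 * mink ?b e1) * mink r e1 =
      (mink ?a e1 * mink r e1 + mink ?a e2 * mink r e2) * mink ?b e2 - (mink ?b e1 * mink r e1 + mink ?b e2 * mink r e2) * mink ?a e2"
    "(mink ?a e1 * mink ?b e2 - mink ?a e2 * mink ?b e1) * mink r e2 =
      (mink ?b e1 * mink r e1 + mink ?b e2 * mink r e2) * mink ?a e1 - (mink ?a e1 * mink r e1 + mink ?a e2 * mink r e2) * mink ?b e1"
    by (simp_all add: algebra_simps)
  then have "mink r e1 = 0" "mink r e2 = 0" unfolding e using d by simp_all
  then have "r = 0" using frame_exp[OF fr rE] by simp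
  then have nxy: "n = x *\<^sub>R f p + y *\<^sub>R \<nu> p" by (simp add: r_def)
  have 1: "c * x = s * y" using n(1) unfolding g[OF U(2)] nxy by (auto simp: mink_bilinear nf nn fn nuf mult.commute)
  have 2: "y * y - x * x = 1" using n(3) unfolding nxy by (simp add: mink_bilinear nf nn fn nuf)
  have "(c\<^sup>2 - s\<^sup>2) * (y * y) = c\<^sup>2 * (y * y - x * x) + (c * x) * (c * x) - (s * y) * (s * y)"
    by (simp add: power2_eq_square algebra_simps)
  then have "y\<^sup>2 = c\<^sup>2" unfolding 1 2 cs by (simp add: power2_eq_square)
  then have y: "y = c \<or> y = - c" by (simp add: power2_eq_iff)
  have c0: "c \<noteq> 0" using cs by (auto simp: power2_eq_square) (smt (verit) zero_le_square)
  show ?thesis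
  proof (cases "y = c")
    case True
    then have "x = s" using 1 c0 by simp
    then show ?thesis using True nxy by simp
  next
    case False
    then have yc: "y = - c" using y by simp
    then have "c * x = c * (- s)" using 1 by simp
    then have "x = - s" using mult_left_cancel[OF c0] by blast
    then show ?thesis using yc nxy by simp
  qed
qed

definition satisfies :: "real \<Rightarrow> real \<Rightarrow> 'a \<Rightarrow> bool" where
  "satisfies s t p \<longleftrightarrow> gA p - gT p = s * (gA p + t * gM p + gT p)"

text \<open>The coefficients, the distance \<delta> and the sign of the normal all depend on the
  neighbourhood. On a coordinate ball the signs are constant, and one linear relation remains, valid
  also at singular points of \<open>f\<close> because it is read off from a regular parallel
  front.\<close>

lemma horospherical_relation:
  assumes h: "horospherical_LW_front M A f L" and rep: "represents (topspace M) \<nu> L" and p: "p \<in> topspace M"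
  obtains c r a d sg where "c \<in> A" "p \<in> fst c" "r > 0" "ball (phi c p) r \<subseteq> dom_of c"
    "a \<noteq> 0 \<or> d \<noteq> 0" "sg = 1 \<or> sg = -1"
    "\<And>q. q \<in> psi c ` ball (phi c p) r \<Longrightarrow> a * (gA q + sg * gM q + gT q) + d * (gA q - gT q) = 0"
proof -
  obtain U n \<delta> where U: "openin M U" "p \<in> U" and un: "unit_normal A S31 U f n" "represents U n L"
    and g: "horospherical_LW_immersion A U (parallel_front f n \<delta>)"
    using h p unfolding horospherical_LW_front_def by blast
  have UM: "U \<subseteq> topspace M" using U openin_subset by blast
  have n: "smooth_map_on A U n" "\<And>q. q \<in> U \<Longrightarrow> mink (n q) (n q) = 1"
    using un by (auto simp: unit_normal_def conormal_field_def S31_def)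
  have Ls: "span {n q} = span {\<nu> q}" if "q \<in> U" for q
    using un(2) rep that UM by (auto simp: represents_def)
  obtain c r t where c: "c \<in> A" "p \<in> fst c" "r > 0" "ball (phi c p) r \<subseteq> dom_of c" "psi c ` ball (phi c p) r \<subseteq> U"
    "openin M (psi c ` ball (phi c p) r)" "p \<in> psi c ` ball (phi c p) r" and t: "t = 1 \<or> t = -1"
    and nt: "\<And>q. q \<in> psi c ` ball (phi c p) r \<Longrightarrow> n q = t *\<^sub>R \<nu> q"
    by (rule local_normal_sign[OF U n Ls]) blast+
  let ?B = "psi c ` ball (phi c p) r" and ?g = "parallel_front f n \<delta>"
  define C Z where "C = cosh \<delta>" and "Z = t * sinh \<delta>"
  have CZ: "C\<^sup>2 - Z\<^sup>2 = 1" using t cosh_square_eq[of \<delta>] by (auto simp: C_def Z_def power_mult_distrib)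
  have gq: "?g q = C *\<^sub>R f q + Z *\<^sub>R \<nu> q" if "q \<in> ?B" for q
    using nt[OF that] by (simp add: parallel_front_def C_def Z_def mult.commute)
  obtain m a b where m: "unit_normal A S31 U ?g m" and ab: "a\<^sup>2 + b\<^sup>2 \<noteq> 0"
    and rel: "\<And>q. q \<in> U \<Longrightarrow> a * (mean_curvature A ?g m q - 1) + b * gauss_curvature A ?g m q = 0"
    and reg: "\<And>q. q \<in> U \<Longrightarrow> regular_point A ?g q"
    using g unfolding horospherical_LW_immersion_def by blast
  have mq: "m q = Z *\<^sub>R f q + C *\<^sub>R \<nu> q \<or> m q = - (Z *\<^sub>R f q + C *\<^sub>R \<nu> q)" if q: "q \<in> ?B" for q
  proof (rule normal_of_parallel[OF _ c(6) q gq CZ])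
    show "q \<in> topspace M" using q c(5) UM by blast
    have qU: "q \<in> U" using q c(5) by blast
    show "regular_point A ?g q" by (rule reg[OF qU])
    show "mink (?g q) (m q) = 0" "mink (differential A ?g q X) (m q) = 0" "mink (m q) (m q) = 1" for X
      using m qU by (auto simp: unit_normal_def conormal_field_def S31_def)
  qed
  have cm: "continuous_on (ball (phi c p) r) (\<lambda>z. m (psi c z))"
    by (rule isCont_twice[OF twice_diff_chart[OF _ c(1,4,5)]]) (use m in \<open>simp_all add: unit_normal_def conormal_field_def\<close>)
  have ch: "continuous_on (ball (phi c p) r) (\<lambda>z. Z *\<^sub>R f (psi c z) + C *\<^sub>R \<nu> (psi c z))"
    by (intro continuous_intros isCont_twice[OF twice_diff_chart[OF smooth_f c(1,4)]] isCont_twice[OF twice_diff_chart[OF smooth_n c(1,4)]])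
      (use c(5) UM in auto)
  have un1: "mink (Z *\<^sub>R f q + C *\<^sub>R \<nu> q) (Z *\<^sub>R f q + C *\<^sub>R \<nu> q) = 1" if "q \<in> ?B" for q
  proof -
    have q: "q \<in> topspace M" using that c(5) UM by blast
    have "mink (\<nu> q) (f q) = 0" using perp_fn[OF q] by (simp add: mink_commute)
    then show ?thesis using CZ norm_f[OF q] norm_n[OF q] perp_fn[OF q] by (simp add: mink_bilinear power2_eq_square)
  qed
  obtain sg where sg: "sg = 1 \<or> sg = -1" and msg: "\<And>z. z \<in> ball (phi c p) r \<Longrightarrow> m (psi c z) = sg *\<^sub>R (Z *\<^sub>R f (psi c z) + C *\<^sub>R \<nu> (psi c z))"
    by (rule constant_sign[OF connected_ball cm ch]) (use mq un1 in blast)+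
  have rel': "(a * (C + sg * Z)\<^sup>2) * (gA q + sg * gM q + gT q) + (a + 2 * b) * (gA q - gT q) = 0" if q: "q \<in> ?B" for q
  proof (rule parallel_relation[OF c(6) q gq _ CZ sg])
    show "m x = (sg * Z) *\<^sub>R f x + (sg * C) *\<^sub>R \<nu> x" if "x \<in> ?B" for x
      using that msg by (auto simp: scaleR_add_right)
    show "regular_point A ?g q" "a * (mean_curvature A ?g m q - 1) + b * gauss_curvature A ?g m q = 0"
      using q c(5) reg rel by blast+
  qed
  \<comment> \<open>The rescaling factor of the Gauss map is invertible, so the relation is
    nontrivial: \<open>a = 0\<close> leaves the coefficient \<open>2 * b\<close>, which is then
    nonzero.\<close>
  have "(C + Z) * (C - Z) = 1" using CZ by (simp add: power2_eq_square algebra_simps)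
  then have "C + sg * Z \<noteq> 0" using sg by auto
  then have "a * (C + sg * Z)\<^sup>2 \<noteq> 0 \<or> a + 2 * b \<noteq> 0" using ab by auto
  then show ?thesis using that[OF c(1-4) _ sg rel'] by blast
qed

lemma weingarten_relation:
  assumes W: "(f, L) \<in> W M A \<epsilon>" and rep: "represents (topspace M) \<nu> L" and p: "p \<in> topspace M" "gA p \<noteq> 0"
  obtains U t where "openin M U" "p \<in> U" "t = 1 \<or> t = -1" "\<And>q. q \<in> U \<Longrightarrow> satisfies (- \<epsilon>) t q"
proof -
  obtain U1 n where U1: "openin M U1" "p \<in> U1" and un: "unit_normal A S31 U1 f n" "represents U1 n L"
    and rel: "\<And>q. q \<in> U1 \<Longrightarrow> regular_point A f q \<Longrightarrow>
      2 * \<epsilon> * (mean_curvature A f n q - 1) + (1 - \<epsilon>) * gauss_curvature A f n q = 0"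
    using W p regular_iff[OF p(1)] unfolding W_def by blast
  have UM: "U1 \<subseteq> topspace M" using U1 openin_subset by blast
  obtain U2 where U2: "openin M U2" "p \<in> U2" "\<And>q. q \<in> U2 \<Longrightarrow> gA q \<noteq> 0" by (rule openin_regular[OF p]) blast
  have n: "smooth_map_on A U1 n" "\<And>q. q \<in> U1 \<Longrightarrow> mink (n q) (n q) = 1"
    using un by (auto simp: unit_normal_def conormal_field_def S31_def)
  have Ls: "span {n q} = span {\<nu> q}" if "q \<in> U1" for q
    using un(2) rep that UM by (auto simp: represents_def)
  obtain c r t where c: "c \<in> A" "p \<in> fst c" "r > 0" "ball (phi c p) r \<subseteq> dom_of c" "psi c ` ball (phi c p) r \<subseteq> U1"
    "openin M (psi c ` ball (phi c p) r)" "p \<in> psi c ` ball (phi c p) r" and t: "t = 1 \<or> t = -1"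
    and nt: "\<And>q. q \<in> psi c ` ball (phi c p) r \<Longrightarrow> n q = t *\<^sub>R \<nu> q"
    by (rule local_normal_sign[OF U1 n Ls]) blast+
  let ?B = "psi c ` ball (phi c p) r"
  show ?thesis
  proof (rule that[of "?B \<inter> U2" t])
    show "openin M (?B \<inter> U2)" "p \<in> ?B \<inter> U2" using c U2 by auto
    show "t = 1 \<or> t = -1" by (rule t)
    fix q assume "q \<in> ?B \<inter> U2"
    then have q: "q \<in> ?B" "q \<in> U2" "q \<in> topspace M" "q \<in> U1" using c(5) UM by auto
    have r: "regular_point A f q" using U2(3)[OF q(2)] regular_iff[OF q(3)] by simp
    \<comment> \<open>The front is its own parallel front with \<open>c = 1\<close> and
      \<open>s = 0\<close>. Here \<open>a = 2 * \<epsilon>\<close> and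
      \<open>b = 1 - \<epsilon>\<close>, so the second coefficient \<open>a + 2 * b\<close> equals
      2, whence the parameter \<open>- \<epsilon>\<close>.\<close>
    have "(2 * \<epsilon> * (1 + t * 0)\<^sup>2) * (gA q + t * gM q + gT q) + (2 * \<epsilon> + 2 * (1 - \<epsilon>)) * (gA q - gT q) = 0"
      by (rule parallel_relation[OF c(6) q(1) _ _ _ t r rel[OF q(4) r]]) (simp_all add: nt)
    then show "satisfies (- \<epsilon>) t q" by (simp add: satisfies_def algebra_simps)
  qed
qed

text \<open>One regular point fixes the sign \<open>t\<close>. The largest open set \<open>V\<close>
  on which the equation holds with this sign is also closed: if a coordinate ball around a point
  outside \<open>V\<close> met \<open>V\<close>, then \<open>weingarten_propagates_sign\<close>
  would put the whole ball into \<open>V\<close>.\<close>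

theorem weingarten_everywhere:
  assumes conn: "connected_space M" and W: "(f, L) \<in> W M A \<epsilon>" and rep: "represents (topspace M) \<nu> L"
    and p0: "p0 \<in> topspace M" "regular_point A f p0"
  obtains t where "t = 1 \<or> t = -1" "\<And>p. p \<in> topspace M \<Longrightarrow> satisfies (- \<epsilon>) t p"
proof -
  have h: "horospherical_LW_front M A f L" using W by (simp add: W_def)
  have g0: "gA p0 \<noteq> 0" using p0 regular_iff by blast
  obtain U0 t where U0: "openin M U0" "p0 \<in> U0" and t: "t = 1 \<or> t = -1" and sat0: "\<And>q. q \<in> U0 \<Longrightarrow> satisfies (- \<epsilon>) t q"
    by (rule weingarten_relation[OF W rep p0(1) g0]) blast
  define V where "V = \<Union>{U. openin M U \<and> (\<forall>q\<in>U. satisfies (- \<epsilon>) t q)}"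
  have Vo: "openin M V" unfolding V_def by blast
  have Vsat: "satisfies (- \<epsilon>) t q" if "q \<in> V" for q using that by (auto simp: V_def)
  have "openin M (topspace M - V)"
  proof (subst openin_subopen, intro ballI)
    fix q assume q: "q \<in> topspace M - V"
    then have qM: "q \<in> topspace M" by blast
    obtain c r a d sg where c: "c \<in> A" "q \<in> fst c" "r > 0" "ball (phi c q) r \<subseteq> dom_of c"
      and ad: "a \<noteq> 0 \<or> d \<noteq> 0" and sg: "sg = 1 \<or> sg = -1"
      and rel: "\<And>x. x \<in> psi c ` ball (phi c q) r \<Longrightarrow> a * (gA x + sg * gM x + gT x) + d * (gA x - gT x) = 0"
      by (rule horospherical_relation[OF h rep qM]) blast
    let ?S = "ball (phi c q) r"
    have op: "openin M (psi c ` ?S)" by (rule open_psi_image[OF c(1) open_ball c(4)])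
    have qB: "q \<in> psi c ` ?S" using psi_phi[OF c(1,2)] c(3) by (metis centre_in_ball imageI)
    have "psi c ` ?S \<inter> V = {}"
    proof (rule ccontr)
      assume ne: "psi c ` ?S \<inter> V \<noteq> {}"
      interpret P: front_patch ?S "\<lambda>z. f (psi c z)" "\<lambda>z. \<nu> (psi c z)" "\<lambda>z d. chart_diff c f (psi c z) (cvec d)"
        "\<lambda>z d. chart_diff c \<nu> (psi c z) (cvec d)"
        by (rule patch[OF c(1) open_ball c(4)])
      define k where "k z = det (matrix (trans_deriv c (chart_at A (psi c z)) (psi c z)))" for z
      have pf: "k z \<noteq> 0" "P.qA z = k z * gA (psi c z)" "P.qT z = k z * gT (psi c z)" "P.qM z = k z * gM (psi c z)" if "z \<in> ?S" for z
        using patch_forms[OF c(1), of z] that c(4) unfolding k_def P.qA_def P.qT_def P.qM_def by blast+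
      have iff: "P.qA z - P.qT z = - \<epsilon> * (P.qA z + e * P.qM z + P.qT z) \<longleftrightarrow> satisfies (- \<epsilon>) e (psi c z)" if "z \<in> ?S" for z e
      proof -
        have "P.qA z - P.qT z = - \<epsilon> * (P.qA z + e * P.qM z + P.qT z) \<longleftrightarrow>
          k z * (gA (psi c z) - gT (psi c z)) = k z * (- \<epsilon> * (gA (psi c z) + e * gM (psi c z) + gT (psi c z)))"
          unfolding pf[OF that] by (simp add: algebra_simps)
        also have "\<dots> \<longleftrightarrow> satisfies (- \<epsilon>) e (psi c z)"
          unfolding satisfies_def by (rule mult_left_cancel[OF pf(1)[OF that]])
        finally show ?thesis .
      qed
      have op_img: "open (?S \<inter> phi c ` (U \<inter> fst c))" if "openin M U" for U
        by (intro open_Int open_ball open_phi_image[OF c(1)] openin_Int that chart_open[OF c(1)]) blast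
      have mem: "z \<in> phi c ` (U \<inter> fst c) \<longleftrightarrow> psi c z \<in> U" if "z \<in> ?S" for U z
        using phi_psi[OF c(1), of z] psi_phi[OF c(1)] that c(4) by (force simp: image_iff)
      define N0 where "N0 = ?S \<inter> phi c ` (V \<inter> fst c)"
      have all: "satisfies (- \<epsilon>) t (psi c z)" if z: "z \<in> ?S" for z
      proof (subst iff[OF z, symmetric], rule P.weingarten_propagates_sign[OF connected_ball ad sg t])
        show "a * (P.qA p + sg * P.qM p + P.qT p) + d * (P.qA p - P.qT p) = 0" if "p \<in> ?S" for p
        proof -
          have "a * (P.qA p + sg * P.qM p + P.qT p) + d * (P.qA p - P.qT p) =
            k p * (a * (gA (psi c p) + sg * gM (psi c p) + gT (psi c p)) + d * (gA (psi c p) - gT (psi c p)))"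
            unfolding pf[OF that] by (simp add: algebra_simps)
          then show ?thesis using rel that by simp
        qed
        show "\<exists>N e. open N \<and> p \<in> N \<and> (e = 1 \<or> e = -1) \<and>
          (\<forall>x\<in>N \<inter> ?S. P.qA x - P.qT x = - \<epsilon> * (P.qA x + e * P.qM x + P.qT x))" if p: "p \<in> ?S" "P.qA p \<noteq> 0" for p
        proof -
          have pc: "psi c p \<in> topspace M" using phi_psi[OF c(1)] p(1) c(4) chart_open(3)[OF c(1)] by blast
          have "gA (psi c p) \<noteq> 0" using p pf(2) by auto
          then obtain U e where U: "openin M U" "psi c p \<in> U" "e = 1 \<or> e = -1" "\<And>q. q \<in> U \<Longrightarrow> satisfies (- \<epsilon>) e q"
            using weingarten_relation[OF W rep pc] by metis
          let ?N = "?S \<inter> phi c ` (U \<inter> fst c)"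
          have "P.qA x - P.qT x = - \<epsilon> * (P.qA x + e * P.qM x + P.qT x)" if x: "x \<in> ?N \<inter> ?S" for x
          proof -
            have "x \<in> ?S" "psi c x \<in> U" using x mem by blast+
            then show ?thesis using iff U(4) by blast
          qed
          moreover have "p \<in> ?N" using mem[OF p(1)] U(2) p(1) by blast
          ultimately show ?thesis using op_img[OF U(1)] U(3) by blast
        qed
        show "open N0" unfolding N0_def by (rule op_img[OF Vo])
        show "N0 \<noteq> {}" using ne mem[of _ V] unfolding N0_def by blast
        show "N0 \<subseteq> ?S" by (simp add: N0_def)
        show "P.qA p - P.qT p = - \<epsilon> * (P.qA p + t * P.qM p + P.qT p)" if "p \<in> N0" for p
          using that iff[of p t] mem[of p V] Vsat by (auto simp: N0_def)
      qed (rule z)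
      then have "psi c ` ?S \<subseteq> V" using op unfolding V_def by blast
      then show False using qB q by blast
    qed
    then show "\<exists>T. openin M T \<and> q \<in> T \<and> T \<subseteq> topspace M - V"
      using op qB openin_subset[OF op] by blast
  qed
  then have "closedin M V" using openin_subset[OF Vo] by (simp add: closedin_def)
  moreover have "p0 \<in> V" using U0 sat0 by (auto simp: V_def)
  ultimately have "V = topspace M" using conn Vo unfolding connected_space_clopen_in by blast
  then show ?thesis using that[OF t] Vsat by blast
qed

end

subsection \<open>The oriented atlas\<close>

lemma Ck_on_cong:
  assumes "open T" "Ck_on k T g" "\<And>x. x \<in> T \<Longrightarrow> g x = h x"
  shows "Ck_on k T h"
  using assms(2,3)
proof (induction k arbitrary: g h)
  case 0
  then show ?case by (simp cong: continuous_on_cong)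
next
  case (Suc k)
  have d: "(h has_derivative frechet_derivative g (at x)) (at x)" if "x \<in> T" for x
  proof -
    have "(g has_derivative frechet_derivative g (at x)) (at x)"
      using Suc.prems(1) that frechet_derivative_works by auto
    then show ?thesis
      by (rule has_derivative_transform_within_open[OF _ assms(1) that]) (rule Suc.prems(2))
  qed
  have eq: "frechet_derivative g (at x) = frechet_derivative h (at x)" if "x \<in> T" for x
    by (rule frechet_derivative_at[OF d[OF that]])
  have "Ck_on k T (\<lambda>x. frechet_derivative h (at x) v)" for v
    by (rule Suc.IH[of "\<lambda>x. frechet_derivative g (at x) v"]) (use Suc.prems eq in auto)
  moreover have "h differentiable (at x)" if "x \<in> T" for x by (rule differentiableI[OF d[OF that]])
  ultimately show ?case by simp
qed

lemma Ck_on_linear: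
  assumes L: "bounded_linear L" and E: "bounded_linear E" and S: "open S" and f: "Ck_on k S f"
  shows "Ck_on k (E -` S) (\<lambda>x. L (f (E x)))"
  using f
proof (induction k arbitrary: f)
  case 0
  have "continuous_on (E -` S) (\<lambda>x. f (E x))"
    by (rule continuous_on_compose2[of S f]) (use 0 linear_continuous_on[OF E] in auto)
  then show ?case using linear_continuous_on_compose bounded_linear.continuous_on[OF L] by simp
next
  case (Suc k)
  have op: "open (E -` S)" by (rule open_vimage[OF S]) (rule linear_continuous_on[OF E])
  have d: "((\<lambda>x. L (f (E x))) has_derivative (\<lambda>v. L (frechet_derivative f (at (E x)) (E v)))) (at x)" if "x \<in> E -` S" for x
  proof -
    have "(f has_derivative frechet_derivative f (at (E x))) (at (E x))"
      using Suc.prems that frechet_derivative_works by auto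
    from has_derivative_compose[OF bounded_linear_imp_has_derivative[OF E] this]
    show ?thesis by (rule bounded_linear.has_derivative[OF L])
  qed
  have "Ck_on k (E -` S) (\<lambda>x. frechet_derivative (\<lambda>x. L (f (E x))) (at x) v)" for v
  proof (rule Ck_on_cong[OF op])
    show "Ck_on k (E -` S) (\<lambda>x. L (frechet_derivative f (at (E x)) (E v)))"
      by (rule Suc.IH[of "\<lambda>x. frechet_derivative f (at x) (E v)"]) (use Suc.prems in simp)
    show "L (frechet_derivative f (at (E x)) (E v)) = frechet_derivative (\<lambda>x. L (f (E x))) (at x) v" if "x \<in> E -` S" for x
      using fun_cong[OF frechet_derivative_at[OF d[OF that]], of v] .
  qed
  moreover have "(\<lambda>x. L (f (E x))) differentiable (at x)" if "x \<in> E -` S" for x by (rule differentiableI[OF d[OF that]])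
  ultimately show ?case by simp
qed

definition reflect :: "real \<Rightarrow> real^2 \<Rightarrow> real^2" where
  "reflect e v = (\<chi> i. if i = 1 then v $ 1 else e * v $ 2)"

lemma reflect_simps [simp]: "reflect e v $ 1 = v $ 1" "reflect e v $ 2 = e * v $ 2" "reflect 1 v = v"
  by (simp_all add: reflect_def vec_eq_iff forall_2)

lemma reflect_reflect: "e * e = 1 \<Longrightarrow> reflect e (reflect e v) = v"
  by (simp add: vec_eq_iff forall_2 flip: mult.assoc)

lemma bounded_linear_reflect: "bounded_linear (reflect e)"
proof -
  have "linear (reflect e)" by (rule linearI) (simp_all add: vec_eq_iff forall_2 algebra_simps)
  then show ?thesis by (simp add: linear_conv_bounded_linear)
qed

lemma det_reflect: "det (matrix (reflect e)) = e"
  by (simp add: det_2 matrix_def axis_def)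

lemma reflect_image: "e * e = 1 \<Longrightarrow> reflect e ` T = reflect e -` T"
  by (auto simp: reflect_reflect) (metis imageI reflect_reflect)

lemma open_reflect_image: "e * e = 1 \<Longrightarrow> open T \<Longrightarrow> open (reflect e ` T)"
  unfolding reflect_image by (rule open_vimage, assumption, rule linear_continuous_on[OF bounded_linear_reflect])

definition subchart :: "'a set \<Rightarrow> real \<Rightarrow> 'a chart \<Rightarrow> 'a chart" where
  "subchart U e c = (U, reflect e \<circ> snd c)"

context surface
begin

lemma is_chart_subchart:
  assumes c: "c \<in> A" and e: "e * e = 1" and U: "openin M U" "U \<subseteq> fst c"
  shows "is_chart M (subchart U e c)"
proof -
  have UM: "U \<subseteq> topspace M" using U openin_subset by blast
  let ?g = "reflect e \<circ> snd c"
  have op: "open (?g ` W)" if "openin M W" "W \<subseteq> fst c" for W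
    using open_reflect_image[OF e open_chart_image[OF c that]] by (simp add: image_comp)
  have "homeomorphic_map (subtopology M U) (top_of_set (?g ` U)) ?g"
  proof (rule bijective_open_imp_homeomorphic_map)
    have "openin (subtopology M U) {x \<in> U. ?g x \<in> T}" if "open T" for T
    proof -
      have "open (reflect e -` T)" by (rule open_vimage[OF that]) (rule linear_continuous_on[OF bounded_linear_reflect])
      then have "openin M {p \<in> fst c. snd c p \<in> reflect e -` T}" by (rule open_chart_preimage[OF c])
      moreover have "{x \<in> U. ?g x \<in> T} = {p \<in> fst c. snd c p \<in> reflect e -` T} \<inter> U" using U(2) by auto
      ultimately show ?thesis using openin_subtopology_Int by fastforce
    qed
    then have "continuous_map (subtopology M U) euclidean ?g"
      using UM by (simp add: continuous_map_def Int_absorb1)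
    then show "continuous_map (subtopology M U) (top_of_set (?g ` U)) ?g"
      by (simp add: continuous_map_in_subtopology)
    show "open_map (subtopology M U) (top_of_set (?g ` U)) ?g"
      unfolding open_map_def
    proof (intro allI impI)
      fix W assume "openin (subtopology M U) W"
      then have W: "openin M W" "W \<subseteq> U"
        using openin_trans_full[OF _ U(1)] openin_subset[of "subtopology M U" W] by simp_all
      then have "open (?g ` W)" using op U(2) by blast
      then show "openin (top_of_set (?g ` U)) (?g ` W)" using W(2) by (meson image_mono open_subset)
    qed
    show "?g ` topspace (subtopology M U) = topspace (top_of_set (?g ` U))" using UM by auto
    have "inj_on (snd c) U" using chart_inj[OF c] U(2) inj_on_subset by blast
    moreover have "inj (reflect e)" by (rule inj_on_inverseI) (rule reflect_reflect[OF e])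
    ultimately have "inj_on ?g U" by (meson comp_inj_on inj_on_subset subset_UNIV)
    then show "inj_on ?g (topspace (subtopology M U))" using UM by (simp add: Int_absorb1)
  qed
  then show ?thesis using U(1) op[OF U] by (simp add: is_chart_def subchart_def)
qed

lemma subchart_inv:
  assumes c: "c \<in> A" and e: "e * e = 1" and U: "U \<subseteq> fst c" and p: "p \<in> U"
  shows "inv_into U (reflect e \<circ> snd c) (reflect e (snd c p)) = p"
proof -
  have "inj_on (snd c) U" using chart_inj[OF c] U inj_on_subset by blast
  moreover have "inj (reflect e)" by (rule inj_on_inverseI) (rule reflect_reflect[OF e])
  ultimately have "inj_on (reflect e \<circ> snd c) U" by (meson comp_inj_on inj_on_subset subset_UNIV)
  then show ?thesis using p inv_into_f_f[of "reflect e \<circ> snd c" U p] by simp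
qed

lemma subchart_transition:
  assumes c: "c \<in> A" "e * e = 1" "openin M U" "U \<subseteq> fst c" and d: "d \<in> A" "e' * e' = 1" "openin M U'" "U' \<subseteq> fst d"
  defines "S \<equiv> snd (subchart U e c) ` (fst (subchart U e c) \<inter> fst (subchart U' e' d))"
  shows "smooth_on S (transition (subchart U e c) (subchart U' e' d))"
    "\<And>p. p \<in> U \<inter> U' \<Longrightarrow> (transition (subchart U e c) (subchart U' e' d) has_derivative
       (\<lambda>v. reflect e' (trans_deriv c d p (reflect e v)))) (at (snd (subchart U e c) p))"
proof -
  let ?T = "transition (subchart U e c) (subchart U' e' d)"
  have op: "open (snd c ` (U \<inter> U'))" by (rule open_chart_image[OF c(1)]) (use c d in auto)
  have S: "S = reflect e -` (snd c ` (U \<inter> U'))"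
    unfolding S_def subchart_def fst_conv snd_conv image_comp[symmetric] by (rule reflect_image[OF c(2)])
  have oS: "open S" unfolding S by (rule open_vimage[OF op]) (rule linear_continuous_on[OF bounded_linear_reflect])
  have eq: "reflect e' (transition c d (reflect e x)) = ?T x" if x: "x \<in> S" for x
  proof -
    obtain p where p: "p \<in> U" "p \<in> U'" "reflect e x = snd c p" using x unfolding S by blast
    then have x: "x = reflect e (snd c p)" using reflect_reflect[OF c(2), of x] by simp
    have "p \<in> fst c" using p c by blast
    then show ?thesis
      using subchart_inv[OF c(1,2,4) p(1)] chart_inv[OF c(1)]
      by (simp add: transition_def subchart_def x reflect_reflect[OF c(2)])
  qed
  have sm: "smooth_on (snd c ` (fst c \<inter> fst d)) (transition c d)"
    using surface c d by (simp add: smooth_surface_def smooth_atlas_def)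
  have mono: "Ck_on k T g" if "Ck_on k T' g" "T \<subseteq> T'" for k T T' and g :: "real^2 \<Rightarrow> real^2"
    using that by (induction k arbitrary: g) (auto intro: continuous_on_subset)
  show "smooth_on S ?T"
    unfolding smooth_on_def
  proof
    fix k
    have "Ck_on k (snd c ` (U \<inter> U')) (transition c d)"
      by (rule mono[of _ "snd c ` (fst c \<inter> fst d)"]) (use sm c d in \<open>auto simp: smooth_on_def\<close>)
    then have "Ck_on k S (\<lambda>x. reflect e' (transition c d (reflect e x)))"
      unfolding S by (rule Ck_on_linear[OF bounded_linear_reflect bounded_linear_reflect op])
    then show "Ck_on k S ?T" by (rule Ck_on_cong[OF oS]) (rule eq)
  qed
  fix p assume p: "p \<in> U \<inter> U'"
  have pc: "p \<in> fst c" "p \<in> fst d" using p c d by auto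
  have pS: "snd (subchart U e c) p \<in> S" using p by (simp add: S_def subchart_def)
  have "(transition c d has_derivative trans_deriv c d p) (at (reflect e (snd (subchart U e c) p)))"
    using trans_deriv[OF c(1) d(1) pc] by (simp add: subchart_def reflect_reflect[OF c(2)])
  from has_derivative_compose[OF bounded_linear_imp_has_derivative[OF bounded_linear_reflect] this]
  have "((\<lambda>x. reflect e' (transition c d (reflect e x))) has_derivative (\<lambda>v. reflect e' (trans_deriv c d p (reflect e v))))
      (at (snd (subchart U e c) p))"
    by (rule bounded_linear.has_derivative[OF bounded_linear_reflect])
  then show "(?T has_derivative (\<lambda>v. reflect e' (trans_deriv c d p (reflect e v)))) (at (snd (subchart U e c) p))"
    by (rule has_derivative_transform_within_open[OF _ oS pS]) (rule eq)
qed

text \<open>The oriented atlas consists of the charts cut down to the sets where the density has constant sign,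
  and reflected where it is negative.\<close>

lemma orientable_if_density:
  assumes nz: "\<And>c p. c \<in> A \<Longrightarrow> p \<in> fst c \<Longrightarrow> w c p \<noteq> (0::real)"
    and op: "\<And>c e. c \<in> A \<Longrightarrow> openin M {p \<in> fst c. e * w c p > 0}"
    and change: "\<And>c d p. c \<in> A \<Longrightarrow> d \<in> A \<Longrightarrow> p \<in> fst c \<Longrightarrow> p \<in> fst d \<Longrightarrow> w c p = det (matrix (trans_deriv c d p)) * w d p"
  shows "orientable_surface M A"
proof -
  define B where "B = {subchart {p \<in> fst c. e * w c p > 0} e c | c e. c \<in> A \<and> (e = 1 \<or> e = -1)}"
  \<comment> \<open>A common supply of charts containing both \<open>A\<close> and \<open>B\<close>;
    compatibility is checked once for \<open>G\<close> and serves for \<open>B\<close> and for the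
    union.\<close>
  define G where "G = {subchart U e c | U e c. c \<in> A \<and> e * e = 1 \<and> openin M U \<and> U \<subseteq> fst c}"
  have BG: "B \<subseteq> G"
  proof
    fix b assume "b \<in> B"
    then obtain c e where b: "b = subchart {p \<in> fst c. e * w c p > 0} e c" "c \<in> A" "e = 1 \<or> e = -1" unfolding B_def by blast
    have "e * e = 1" using b(3) by auto
    then show "b \<in> G" using b(1,2) op[OF b(2), of e] unfolding G_def by blast
  qed
  have AG: "A \<subseteq> G"
  proof
    fix c assume c: "c \<in> A"
    have "c = subchart (fst c) 1 c" by (simp add: subchart_def prod_eq_iff fun_eq_iff)
    then show "c \<in> G" using c chart_open[OF c] unfolding G_def by fastforce
  qed
  have atlas: "smooth_atlas M C" if CG: "C \<subseteq> G" and cov: "(\<Union>c\<in>C. fst c) = topspace M" for C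
    unfolding smooth_atlas_def
  proof (intro conjI ballI cov)
    fix c assume "c \<in> C"
    then obtain U e c' where c: "c = subchart U e c'" "c' \<in> A" "e * e = 1" "openin M U" "U \<subseteq> fst c'" using CG unfolding G_def by blast
    then show "is_chart M c" using is_chart_subchart by blast
    fix d assume "d \<in> C"
    then obtain U' e' d' where d: "d = subchart U' e' d'" "d' \<in> A" "e' * e' = 1" "openin M U'" "U' \<subseteq> fst d'" using CG unfolding G_def by blast
    show "smooth_on (snd c ` (fst c \<inter> fst d)) (transition c d)"
      unfolding c(1) d(1) by (rule subchart_transition(1)[OF c(2-5) d(2-5)])
  qed
  have covA: "(\<Union>c\<in>A. fst c) = topspace M" using surface by (simp add: smooth_surface_def smooth_atlas_def)
  have covB: "(\<Union>c\<in>B. fst c) = topspace M"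
  proof
    show "(\<Union>c\<in>B. fst c) \<subseteq> topspace M"
    proof
      fix p assume "p \<in> (\<Union>c\<in>B. fst c)"
      then obtain b where b: "b \<in> B" "p \<in> fst b" by blast
      then obtain c e where c: "b = subchart {p \<in> fst c. e * w c p > 0} e c" "c \<in> A" unfolding B_def by blast
      then have "p \<in> fst c" using b(2) by (simp add: subchart_def)
      then show "p \<in> topspace M" using chart_open(3)[OF c(2)] by blast
    qed
    show "topspace M \<subseteq> (\<Union>c\<in>B. fst c)"
    proof
      fix p assume "p \<in> topspace M"
      then obtain c where c: "c \<in> A" "p \<in> fst c" using chart_at by blast
      define e where "e = sgn (w c p)"
      have "e * w c p > 0" "e = 1 \<or> e = -1" using nz[OF c] by (auto simp: e_def sgn_real_def)
      then have "subchart {p \<in> fst c. e * w c p > 0} e c \<in> B" using c(1) unfolding B_def by blast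
      moreover have "p \<in> fst (subchart {p \<in> fst c. e * w c p > 0} e c)"
        using c(2) \<open>e * w c p > 0\<close> by (simp add: subchart_def)
      ultimately show "p \<in> (\<Union>c\<in>B. fst c)" by blast
    qed
  qed
  have "det (matrix (frechet_derivative (transition b b') (at (snd b p)))) > 0"
    if bb: "b \<in> B" "b' \<in> B" "p \<in> fst b \<inter> fst b'" for b b' p
  proof -
    obtain c e where b: "b = subchart {p \<in> fst c. e * w c p > 0} e c" and c: "c \<in> A" and e: "e = 1 \<or> e = -1"
      using bb(1) unfolding B_def by blast
    obtain d e' where b': "b' = subchart {p \<in> fst d. e' * w d p > 0} e' d" and d: "d \<in> A" and e': "e' = 1 \<or> e' = -1"
      using bb(2) unfolding B_def by blast
    have ee: "e * e = 1" "e' * e' = 1" using e e' by auto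
    have p: "p \<in> fst c" "p \<in> fst d" "e * w c p > 0" "e' * w d p > 0" using bb(3) by (auto simp: b b' subchart_def)
    have l: "linear (trans_deriv c d p)" using trans_deriv[OF c d p(1,2)] has_derivative_linear by blast
    have lr: "linear (reflect x)" for x using bounded_linear_reflect by (simp add: linear_conv_bounded_linear)
    have "(transition b b' has_derivative (\<lambda>v. reflect e' (trans_deriv c d p (reflect e v)))) (at (snd b p))"
      unfolding b b' by (rule subchart_transition(2)[OF c ee(1) op[OF c] _ d ee(2) op[OF d]]) (use p in auto)
    then have "frechet_derivative (transition b b') (at (snd b p)) = reflect e' \<circ> (trans_deriv c d p \<circ> reflect e)"
      by (simp only: o_def frechet_derivative_at[symmetric])
    moreover have "det (matrix (reflect e' \<circ> (trans_deriv c d p \<circ> reflect e))) = e' * (det (matrix (trans_deriv c d p)) * e)"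
      by (simp add: matrix_compose l lr linear_compose det_mul det_reflect)
    moreover have "e' * (det (matrix (trans_deriv c d p)) * e) > 0"
    proof -
      \<comment> \<open>The determinant of the transition between reflected charts is the quotient
        of two densities that are positive by the choice of the reflections.\<close>
      have "(e' * (det (matrix (trans_deriv c d p)) * e)) * (e' * w d p) = e * w c p"
        unfolding change[OF c d p(1,2)] using ee(2) by (simp add: algebra_simps)
      then show ?thesis using p(3,4) by (metis zero_less_mult_pos2)
    qed
    ultimately show ?thesis by simp
  qed
  moreover have "smooth_atlas M B" by (rule atlas[OF BG covB])
  moreover have "smooth_atlas M (A \<union> B)" by (rule atlas) (use AG BG covA covB in auto)
  ultimately show ?thesis unfolding orientable_surface_def by blast
qed

end

subsection \<open>The Maslov map\<close>

text \<open>Multiplication by \<open>c\<close> carries the path into the plane slit along the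
  nonpositive reals, which is simply connected and omits the origin.\<close>

lemma winding_number_avoiding_ray:
  assumes g: "path g" "pathfinish g = pathstart g" and c: "c \<noteq> 0"
    and av: "\<And>x. x \<in> path_image g \<Longrightarrow> x * c \<notin> complex_of_real ` {..0}"
  shows "winding_number g 0 = 0"
proof -
  define S1 where "S1 = - (complex_of_real ` {..0})"
  define S where "S = (\<lambda>y. y / c) ` S1"
  have "homeomorphism S1 S (\<lambda>y. y / c) (\<lambda>y. y * c)"
    by (rule homeomorphismI) (use c in \<open>auto simp: S_def intro!: continuous_intros\<close>)
  moreover have "simply_connected S1"
    unfolding S1_def by (intro starlike_imp_simply_connected starlike_slotted_complex_plane_left)
  ultimately have "simply_connected S" using homeomorphic_simply_connected homeomorphic_def by blast
  moreover have "path_image g \<subseteq> S"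
  proof
    fix x assume "x \<in> path_image g"
    then have "x * c \<in> S1" using av by (simp add: S1_def)
    then have "x * c / c \<in> S" unfolding S_def by (rule imageI)
    then show "x \<in> S" using c by simp
  qed
  moreover have "0 \<notin> S"
  proof
    assume "0 \<in> S"
    then have "0 \<in> S1" using c by (auto simp: S_def)
    then show False unfolding S1_def by (metis ComplD atMost_iff imageI of_real_0 order_refl)
  qed
  ultimately show ?thesis using simply_connected_imp_winding_number_zero g by blast
qed

lemma square_avoids_ray: "Re z \<noteq> 0 \<Longrightarrow> z\<^sup>2 \<notin> complex_of_real ` {..0}"
proof
  assume z: "Re z \<noteq> 0" and "z\<^sup>2 \<in> complex_of_real ` {..0}"
  then obtain r where r: "z\<^sup>2 = complex_of_real r" "r \<le> 0" by auto
  have "Im (z\<^sup>2) = 0" "Re (z\<^sup>2) = r" by (simp_all add: r(1))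
  then have "Re z * Im z = 0" "(Re z)\<^sup>2 - (Im z)\<^sup>2 = r" by (auto simp: power2_eq_square)
  then have "(Re z)\<^sup>2 = r" using z by simp
  then show False using z r(2) by (metis not_le zero_less_power2)
qed

lemma (in front_patch) density_sign:
  assumes "p \<in> S" "t = 1 \<or> t = -1" "qA p - qT p = s * (qA p + t * qM p + qT p)"
  shows "t * qM p + s * (qA p - qT p) \<noteq> 0"
proof (cases "t = 1")
  case True
  then show ?thesis using orientation[OF assms(1), of s] assms(3) by (simp add: weing_def B_def)
next
  case False
  then have t: "t = -1" using assms(2) by simp
  interpret m: front_patch S F "\<lambda>p. - V p" DF "\<lambda>p d. - DV p d" by (rule opposite)
  have mq: "m.qA x = - qA x" "m.qT x = - qT x" "m.qM x = qM x" for x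
    unfolding m.qA_def m.qT_def m.qM_def qA_def qT_def qM_def mixed_vol_def
    by (simp_all add: vol_minus_normal vol_minus)
  have "m.weing s p" unfolding m.weing_def m.B_def mq using assms(3) t by (simp add: algebra_simps)
  from m.orientation[OF assms(1) this] show ?thesis unfolding mq t by (simp add: algebra_simps)
qed

context cooriented_front
begin

text \<open>The determinant of df + i d\<nu> up to a nonzero real factor, which disappears in the
  quotient of the square by the squared modulus.\<close>

definition maslov_vec :: "'a \<Rightarrow> complex" where
  "maslov_vec p = Complex (gA p - gT p) (gM p)"

definition chart_density :: "real \<Rightarrow> real \<Rightarrow> 'a chart \<Rightarrow> 'a \<Rightarrow> real" where
  "chart_density s t c p =
     t * mixed_vol (f p) (\<nu> p) (chart_diff c f p (axis 1 1)) (chart_diff c f p (axis 2 1))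
        (chart_diff c \<nu> p (axis 1 1)) (chart_diff c \<nu> p (axis 2 1))
     + s * (vol (f p) (\<nu> p) (chart_diff c f p (axis 1 1)) (chart_diff c f p (axis 2 1))
        - vol (f p) (\<nu> p) (chart_diff c \<nu> p (axis 1 1)) (chart_diff c \<nu> p (axis 2 1)))"

lemma satisfies_sign:
  assumes t: "t = 1 \<or> t = -1" and sat: "satisfies s t p" and p: "p \<in> topspace M"
  shows "t * gM p + s * (gA p - gT p) \<noteq> 0"
proof -
  define c where "c = chart_at A p"
  have c: "c \<in> A" "p \<in> fst c" using chart_at[OF p] by (simp_all add: c_def)
  interpret P: front_patch "dom_of c" "\<lambda>z. f (psi c z)" "\<lambda>z. \<nu> (psi c z)" "\<lambda>z d. chart_diff c f (psi c z) (cvec d)"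
    "\<lambda>z d. chart_diff c \<nu> (psi c z) (cvec d)"
    by (rule patch[OF c(1) open_dom[OF c(1)]]) simp
  have z: "phi c p \<in> dom_of c" "psi c (phi c p) = p" using c psi_phi by (auto simp: dom_of_def)
  have eq: "P.qA (phi c p) = gA p" "P.qT (phi c p) = gT p" "P.qM (phi c p) = gM p"
    by (simp_all add: P.qA_def P.qT_def P.qM_def gA_def gT_def gM_def z(2) cvec_axis differential_chart_diff c_def[symmetric])
  show ?thesis using P.density_sign[OF z(1) t, of s] sat unfolding eq satisfies_def by simp
qed

theorem orientable:
  assumes t: "t = 1 \<or> t = -1" and sat: "\<And>p. p \<in> topspace M \<Longrightarrow> satisfies s t p"
  shows "orientable_surface M A"
proof (rule orientable_if_density)
  show "chart_density s t c p \<noteq> 0" if c: "c \<in> A" "p \<in> fst c" for c p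
  proof -
    have p: "p \<in> topspace M" using c chart_open(3) by blast
    have z: "phi c p \<in> dom_of c" "psi c (phi c p) = p" using c psi_phi by (auto simp: dom_of_def)
    note pf = patch_forms[OF c(1) z(1), unfolded z(2) cvec_axis]
    define k where "k = det (matrix (trans_deriv c (chart_at A p) p))"
    have "chart_density s t c p = k * (t * gM p + s * (gA p - gT p))"
      unfolding chart_density_def pf(2-4) k_def[symmetric] by (simp add: algebra_simps)
    then show ?thesis using satisfies_sign[OF t sat[OF p] p] pf(1) by (simp add: k_def)
  qed
  show "openin M {p \<in> fst c. e * chart_density s t c p > 0}" if c: "c \<in> A" for c e
  proof -
    interpret P: front_patch "dom_of c" "\<lambda>z. f (psi c z)" "\<lambda>z. \<nu> (psi c z)" "\<lambda>z d. chart_diff c f (psi c z) (cvec d)"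
      "\<lambda>z d. chart_diff c \<nu> (psi c z) (cvec d)"
      by (rule patch[OF c open_dom[OF c]]) simp
    have eq: "chart_density s t c (psi c z) = t * P.qM z + s * (P.qA z - P.qT z)" for z
      unfolding chart_density_def P.qA_def P.qT_def P.qM_def cvec_axis by simp
    define T where "T = dom_of c \<inter> (\<lambda>z. e * (t * P.qM z + s * (P.qA z - P.qT z))) -` {0<..}"
    have "continuous_on (dom_of c) (\<lambda>z. e * (t * P.qM z + s * (P.qA z - P.qT z)))"
      by (intro continuous_intros P.cont)
    then have "open T" unfolding T_def by (rule continuous_open_preimage[OF _ open_dom[OF c]]) simp
    then have "openin M (psi c ` T)" by (rule open_psi_image[OF c]) (simp add: T_def)
    moreover have "psi c ` T = {p \<in> fst c. e * chart_density s t c p > 0}"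
    proof (intro subset_antisym subsetI)
      fix p assume "p \<in> psi c ` T"
      then obtain z where z: "z \<in> T" "p = psi c z" by blast
      then have "z \<in> dom_of c" "e * chart_density s t c p > 0" using eq by (auto simp: T_def)
      then show "p \<in> {p \<in> fst c. e * chart_density s t c p > 0}" using phi_psi[OF c] z(2) by simp
    next
      fix p assume "p \<in> {p \<in> fst c. e * chart_density s t c p > 0}"
      then have p: "p \<in> fst c" "e * chart_density s t c p > 0" by auto
      have "phi c p \<in> dom_of c" "psi c (phi c p) = p" using c p psi_phi by (auto simp: dom_of_def)
      then have "phi c p \<in> T" using p(2) eq[of "phi c p"] by (simp add: T_def)
      then show "p \<in> psi c ` T" using \<open>psi c (phi c p) = p\<close> by (metis imageI)
    qed
    ultimately show ?thesis by simp
  qed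
  show "chart_density s t c p = det (matrix (trans_deriv c d p)) * chart_density s t d p"
    if cd: "c \<in> A" "d \<in> A" "p \<in> fst c" "p \<in> fst d" for c d p
  proof -
    have p: "p \<in> topspace M" using cd chart_open(3) by blast
    have h: "((f \<circ> inv_into (fst d) (snd d)) has_derivative chart_diff d f p) (at (snd d p))"
      "((\<nu> \<circ> inv_into (fst d) (snd d)) has_derivative chart_diff d \<nu> p) (at (snd d p))"
      using smooth_mapD(1)[OF smooth_f cd(2,4) p] smooth_mapD(1)[OF smooth_n cd(2,4) p] .
    have l: "linear (chart_diff d f p)" "linear (chart_diff d \<nu> p)" using h has_derivative_linear by blast+
    show ?thesis
      unfolding chart_density_def chart_diff_change(1)[OF h(1) cd] chart_diff_change(1)[OF h(2) cd]
        vol_change(1)[OF l(1) l(1), of _ _ "trans_deriv c d p _"] vol_change(1)[OF l(2) l(2), of _ _ "trans_deriv c d p _"]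
        vol_change(2)[OF l, of _ _ "trans_deriv c d p _"] cross2_matrix
      by (simp add: algebra_simps)
  qed
qed

lemma normal_plane_perp2: "normal_plane f \<nu> p = perp2 (f p) (\<nu> p)" "normal_plane \<nu> f p = perp2 (f p) (\<nu> p)"
  by (auto simp: normal_plane_def perp2_def)

text \<open>A change of bases multiplies the determinant by a nonzero real number, which cancels.
  Exchanging the roles uses d\<nu> + i df = i times the conjugate of df + i d\<nu>, whose
  determinant is minus the conjugate determinant.\<close>

lemma maslov_map_formula:
  assumes p: "p \<in> topspace M"
  shows "maslov_map A f \<nu> p = (maslov_vec p)\<^sup>2 / complex_of_real ((cmod (maslov_vec p))\<^sup>2)"
    "maslov_map A \<nu> f p = (cnj (maslov_vec p))\<^sup>2 / complex_of_real ((cmod (maslov_vec p))\<^sup>2)"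
proof -
  note l = linear_differential[OF p] and pd = point_data(1,2)[OF p]
  have scaled: "\<exists>r::real. r \<noteq> 0 \<and> maslov_det A f \<nu> p b e = of_real r * maslov_vec p
      \<and> maslov_det A \<nu> f p b e = of_real r * (- cnj (maslov_vec p))"
    if b: "tangent_basis b" and e: "mink_orthonormal (perp2 (f p) (\<nu> p)) e" for b e
  proof -
    have "range e \<subseteq> perp2 (f p) (\<nu> p)" "\<forall>i j. mink (e i) (e j) = (if i = j then 1 else 0)"
      using e by (simp_all add: mink_orthonormal_def)
    moreover have "(1::2) \<noteq> 2" by simp
    ultimately have fr: "frame (f p) (\<nu> p) (e 1) (e 2)"
      using norm_f[OF p] norm_n[OF p] perp_fn[OF p] unfolding frame_def by auto
    define k where "k = vol (f p) (\<nu> p) (e 1) (e 2)"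
    have k: "k \<noteq> 0" using frame_vol[OF fr] by (simp add: k_def)
    define x where "x = cross2 (b 1) (b 2)"
    have x: "x \<noteq> 0" using b by (simp add: tangent_basis_iff x_def)
    define a where "a j i = mink (differential A f p (b j)) (e i)" for i j
    define t where "t j i = mink (differential A \<nu> p (b j)) (e i)" for i j
    note fx = frame_vol_exp[OF fr, folded k_def]
    have A': "x * gA p = k * (a 1 1 * a 2 2 - a 1 2 * a 2 1)"
      using vol_change(1)[OF l(1) l(1), of "f p" "\<nu> p" "b 1" "b 2"] fx[OF pd(1) pd(1), of "b 1" "b 2"]
      by (simp add: gA_def x_def a_def)
    have T': "x * gT p = k * (t 1 1 * t 2 2 - t 1 2 * t 2 1)"
      using vol_change(1)[OF l(2) l(2), of "f p" "\<nu> p" "b 1" "b 2"] fx[OF pd(2) pd(2), of "b 1" "b 2"]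
      by (simp add: gT_def x_def t_def)
    have M': "x * gM p = k * ((a 1 1 * t 2 2 - a 1 2 * t 2 1) + (t 1 1 * a 2 2 - t 1 2 * a 2 1))"
      using vol_change(2)[OF l, of "f p" "\<nu> p" "b 1" "b 2"] fx[OF pd(1) pd(2), of "b 1" "b 2"] fx[OF pd(2) pd(1), of "b 1" "b 2"]
      by (simp add: gM_def x_def t_def a_def mixed_vol_def algebra_simps)
    have d1: "maslov_det A f \<nu> p b e = Complex ((a 1 1 * a 2 2 - a 1 2 * a 2 1) - (t 1 1 * t 2 2 - t 1 2 * t 2 1))
        ((a 1 1 * t 2 2 - a 1 2 * t 2 1) + (t 1 1 * a 2 2 - t 1 2 * a 2 1))"
      by (simp add: maslov_det_def det_2 complex_eq_iff a_def t_def algebra_simps)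
    have d2: "maslov_det A \<nu> f p b e = Complex (- ((a 1 1 * a 2 2 - a 1 2 * a 2 1) - (t 1 1 * t 2 2 - t 1 2 * t 2 1)))
        ((a 1 1 * t 2 2 - a 1 2 * t 2 1) + (t 1 1 * a 2 2 - t 1 2 * a 2 1))"
      by (simp add: maslov_det_def det_2 complex_eq_iff a_def t_def algebra_simps)
    have AT: "(a 1 1 * a 2 2 - a 1 2 * a 2 1) - (t 1 1 * t 2 2 - t 1 2 * t 2 1) = x / k * (gA p - gT p)"
      using A' T' k by (simp add: field_simps)
    have MM: "(a 1 1 * t 2 2 - a 1 2 * t 2 1) + (t 1 1 * a 2 2 - t 1 2 * a 2 1) = x / k * gM p"
      using M' k by (simp add: field_simps)
    show ?thesis
      unfolding d1 d2 AT MM maslov_vec_def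
      by (rule exI[of _ "x / k"]) (use x k in \<open>simp add: complex_eq_iff\<close>)
  qed
  have quot: "(of_real r * z)\<^sup>2 / complex_of_real ((cmod (of_real r * z))\<^sup>2) = z\<^sup>2 / complex_of_real ((cmod z)\<^sup>2)"
    if "r \<noteq> 0" for r z
    using that by (simp add: norm_mult power_mult_distrib flip: of_real_power)
  obtain e1 e2 where fr: "frame (f p) (\<nu> p) e1 e2" using frame_exists[OF norm_f[OF p] norm_n[OF p] perp_fn[OF p]] by blast
  define e0 :: "2 \<Rightarrow> real^4" where "e0 i = (if i = 1 then e1 else e2)" for i
  have e0: "mink_orthonormal (perp2 (f p) (\<nu> p)) e0"
    using fr by (auto simp: mink_orthonormal_def frame_def e0_def mink_commute[of e2 e1]) (metis exhaust_2)+
  define b0 :: "2 \<Rightarrow> real^2" where "b0 i = axis i 1" for i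
  have b0: "tangent_basis b0" by (simp add: tangent_basis_iff cross2_def b0_def axis_def)
  show "maslov_map A f \<nu> p = (maslov_vec p)\<^sup>2 / complex_of_real ((cmod (maslov_vec p))\<^sup>2)"
    unfolding maslov_map_def normal_plane_perp2
  proof (rule the_equality)
    show v: "\<forall>b e. tangent_basis b \<and> mink_orthonormal (perp2 (f p) (\<nu> p)) e \<longrightarrow>
      (maslov_vec p)\<^sup>2 / complex_of_real ((cmod (maslov_vec p))\<^sup>2) =
      (maslov_det A f \<nu> p b e)\<^sup>2 / complex_of_real ((cmod (maslov_det A f \<nu> p b e))\<^sup>2)"
      using scaled quot by metis
    fix m assume "\<forall>b e. tangent_basis b \<and> mink_orthonormal (perp2 (f p) (\<nu> p)) e \<longrightarrow>
      m = (maslov_det A f \<nu> p b e)\<^sup>2 / complex_of_real ((cmod (maslov_det A f \<nu> p b e))\<^sup>2)"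
    then show "m = (maslov_vec p)\<^sup>2 / complex_of_real ((cmod (maslov_vec p))\<^sup>2)" using v b0 e0 by metis
  qed
  have q2: "(cnj (maslov_vec p))\<^sup>2 / complex_of_real ((cmod (maslov_vec p))\<^sup>2) =
      (of_real r * - cnj (maslov_vec p))\<^sup>2 / complex_of_real ((cmod (of_real r * - cnj (maslov_vec p)))\<^sup>2)" if "r \<noteq> 0" for r
    using quot[OF that, of "- cnj (maslov_vec p)"] by simp
  show "maslov_map A \<nu> f p = (cnj (maslov_vec p))\<^sup>2 / complex_of_real ((cmod (maslov_vec p))\<^sup>2)"
    unfolding maslov_map_def normal_plane_perp2
  proof (rule the_equality)
    show v: "\<forall>b e. tangent_basis b \<and> mink_orthonormal (perp2 (f p) (\<nu> p)) e \<longrightarrow>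
      (cnj (maslov_vec p))\<^sup>2 / complex_of_real ((cmod (maslov_vec p))\<^sup>2) =
      (maslov_det A \<nu> f p b e)\<^sup>2 / complex_of_real ((cmod (maslov_det A \<nu> f p b e))\<^sup>2)"
      using scaled q2 by metis
    fix m assume "\<forall>b e. tangent_basis b \<and> mink_orthonormal (perp2 (f p) (\<nu> p)) e \<longrightarrow>
      m = (maslov_det A \<nu> f p b e)\<^sup>2 / complex_of_real ((cmod (maslov_det A \<nu> f p b e))\<^sup>2)"
    then show "m = (cnj (maslov_vec p))\<^sup>2 / complex_of_real ((cmod (maslov_vec p))\<^sup>2)" using v b0 e0 by metis
  qed
qed

text \<open>\<open>maslov_vec\<close> need not be continuous, because it is taken in preferred
  charts. Near each point it differs by a real factor from the continuous function \<open>N\<close>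
  of one fixed chart, and the quotient does not see that factor.\<close>

lemma maslov_continuous:
  assumes nz: "\<And>p. p \<in> topspace M \<Longrightarrow> maslov_vec p \<noteq> 0"
  shows "continuous_map M euclidean (\<lambda>p. (maslov_vec p)\<^sup>2 / complex_of_real ((cmod (maslov_vec p))\<^sup>2))"
    (is "continuous_map M euclidean ?m")
  unfolding continuous_map_def
proof (intro conjI allI impI)
  fix T :: "complex set" assume "openin euclidean T"
  then have T: "open T" by simp
  show "openin M {p \<in> topspace M. ?m p \<in> T}"
  proof (subst openin_subopen, intro ballI)
    fix p assume "p \<in> {p \<in> topspace M. ?m p \<in> T}"
    then have p: "p \<in> topspace M" "?m p \<in> T" by auto
    obtain c where c: "c \<in> A" "p \<in> fst c" using chart_at[OF p(1)] by blast
    interpret P: front_patch "dom_of c" "\<lambda>z. f (psi c z)" "\<lambda>z. \<nu> (psi c z)" "\<lambda>z d. chart_diff c f (psi c z) (cvec d)"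
      "\<lambda>z d. chart_diff c \<nu> (psi c z) (cvec d)"
      by (rule patch[OF c(1) open_dom[OF c(1)]]) simp
    define N where "N z = complex_of_real (P.qA z - P.qT z) + \<i> * complex_of_real (P.qM z)" for z
    have N: "\<exists>k::real. k \<noteq> 0 \<and> N z = of_real k * maslov_vec (psi c z)" if "z \<in> dom_of c" for z
    proof -
      note pf = patch_forms[OF c(1) that]
      show ?thesis
        unfolding N_def P.qA_def P.qT_def P.qM_def pf(2-4) maslov_vec_def
        by (rule exI, rule conjI[OF pf(1)]) (simp add: complex_eq_iff algebra_simps)
    qed
    have pm: "psi c z \<in> topspace M" if "z \<in> dom_of c" for z using phi_psi[OF c(1) that] chart_open(3)[OF c(1)] by blast
    have Nz: "N z \<noteq> 0" if "z \<in> dom_of c" for z using N[OF that] nz[OF pm[OF that]] by auto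
    have m: "?m (psi c z) = (N z)\<^sup>2 / complex_of_real ((cmod (N z))\<^sup>2)" if "z \<in> dom_of c" for z
      using N[OF that] by (auto simp: norm_mult power_mult_distrib simp flip: of_real_power)
    have "continuous_on (dom_of c) N" unfolding N_def by (intro continuous_intros P.cont)
    then have cm: "continuous_on (dom_of c) (\<lambda>z. (N z)\<^sup>2 / complex_of_real ((cmod (N z))\<^sup>2))"
      by (intro continuous_intros) (use Nz in auto)
    define Y where "Y = dom_of c \<inter> (\<lambda>z. (N z)\<^sup>2 / complex_of_real ((cmod (N z))\<^sup>2)) -` T"
    have "open Y" unfolding Y_def by (rule continuous_open_preimage[OF cm open_dom[OF c(1)] T])
    then have o: "openin M (psi c ` Y)" by (rule open_psi_image[OF c(1)]) (simp add: Y_def)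
    have z: "phi c p \<in> dom_of c" "psi c (phi c p) = p" using c psi_phi by (auto simp: dom_of_def)
    have "phi c p \<in> Y" using m[OF z(1)] p(2) z by (simp add: Y_def)
    then have "p \<in> psi c ` Y" using z(2) by (metis imageI)
    moreover have "psi c ` Y \<subseteq> {p \<in> topspace M. ?m p \<in> T}"
    proof
      fix q assume "q \<in> psi c ` Y"
      then obtain z where z: "z \<in> dom_of c" "(N z)\<^sup>2 / complex_of_real ((cmod (N z))\<^sup>2) \<in> T" "q = psi c z" by (auto simp: Y_def)
      then show "q \<in> {p \<in> topspace M. ?m p \<in> T}" using m[OF z(1)] pm[OF z(1)] by simp
    qed
    ultimately show "\<exists>Y. openin M Y \<and> p \<in> Y \<and> Y \<subseteq> {p \<in> topspace M. ?m p \<in> T}" using o by blast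
  qed
qed simp

end

lemma zigzag_rep_zero:
  assumes m: "continuous_map M euclidean m" and eq: "\<And>p. p \<in> topspace M \<Longrightarrow> maslov_map A f \<nu> p = m p"
    and u: "u \<noteq> 0" and av: "\<And>p. p \<in> topspace M \<Longrightarrow> m p * u \<notin> complex_of_real ` {..0}"
    and c: "c \<in> carrier (fundamental_group M x)"
  shows "zigzag_rep A f \<nu> c = 0"
proof -
  have "c \<in> loops M x // loop_homotopy M x" using c by (simp add: fundamental_group_def)
  then obtain \<gamma>0 where g0: "\<gamma>0 \<in> loops M x" "c = loop_homotopy M x `` {\<gamma>0}" by (auto elim: quotientE)
  \<comment> \<open>The class must be inhabited for the definite description in
    \<open>zigzag_rep\<close> to have a unique solution.\<close>
  have "(\<gamma>0, \<gamma>0) \<in> loop_homotopy M x"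
    using g0(1) by (auto simp: loop_homotopy_def loops_def pathin_def homotopic_with_refl)
  then have g0c: "\<gamma>0 \<in> c" using g0(2) by blast
  have "winding_number (maslov_map A f \<nu> \<circ> \<gamma>) 0 = 0" if "\<gamma> \<in> c" for \<gamma>
  proof -
    have "\<gamma> \<in> loops M x" using that g0(2) by (auto simp: loop_homotopy_def)
    then have g: "pathin M \<gamma>" "\<gamma> 0 = \<gamma> 1" by (auto simp: loops_def)
    have gM: "\<gamma> s \<in> topspace M" if "s \<in> {0..1}" for s
      using g(1) that by (auto simp: pathin_def continuous_map_def Pi_iff)
    have "continuous_map (top_of_set {0..1}) euclidean (m \<circ> \<gamma>)"
      by (rule continuous_map_compose[OF _ m]) (use g(1) in \<open>simp add: pathin_def\<close>)
    then have cont: "continuous_on {0..1} (m \<circ> \<gamma>)" by simp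
    have "continuous_on {0..1} (maslov_map A f \<nu> \<circ> \<gamma>)"
      by (rule continuous_on_eq[OF cont]) (use eq gM in simp)
    then have pth: "path (maslov_map A f \<nu> \<circ> \<gamma>)" by (simp add: path_def)
    show ?thesis
    proof (rule winding_number_avoiding_ray[OF pth _ u])
      show "pathfinish (maslov_map A f \<nu> \<circ> \<gamma>) = pathstart (maslov_map A f \<nu> \<circ> \<gamma>)"
        using g(2) by (simp add: pathfinish_def pathstart_def)
      fix y assume "y \<in> path_image (maslov_map A f \<nu> \<circ> \<gamma>)"
      then obtain s where "s \<in> {0..1}" "y = maslov_map A f \<nu> (\<gamma> s)" by (auto simp: path_image_def)
      then show "y * u \<notin> complex_of_real ` {..0}" using eq[OF gM] av[OF gM] by simp
    qed
  qed
  then show ?thesis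
    unfolding zigzag_rep_def using g0c by (intro the_equality) auto
qed

context cooriented_front
begin

theorem zigzag_trivial:
  assumes t: "t = 1 \<or> t = -1" and sat: "\<And>p. p \<in> topspace M \<Longrightarrow> satisfies s t p"
    and c: "c \<in> carrier (fundamental_group M x)"
  shows "zigzag_rep A f \<nu> c = 0" "zigzag_rep A \<nu> f c = 0"
proof -
  \<comment> \<open>With this \<open>u\<close>, the real part of \<open>maslov_vec p * cnj u\<close>
    is the orientation density of \<open>satisfies_sign\<close>. So \<open>maslov_vec\<close> avoids
    the line perpendicular to \<open>u\<close>, and its square avoids a ray.\<close>
  define u where "u = Complex s t"
  have u: "u \<noteq> 0" using t by (auto simp: u_def complex_eq_iff)
  have re: "Re (maslov_vec p * cnj u) \<noteq> 0" if "p \<in> topspace M" for p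
    using satisfies_sign[OF t sat[OF that] that] by (simp add: maslov_vec_def u_def algebra_simps)
  then have nz: "maslov_vec p \<noteq> 0" if "p \<in> topspace M" for p using that by fastforce
  let ?m = "\<lambda>p. (maslov_vec p)\<^sup>2 / complex_of_real ((cmod (maslov_vec p))\<^sup>2)"
  have avoid: "z\<^sup>2 / complex_of_real ((cmod z)\<^sup>2) * v\<^sup>2 \<notin> complex_of_real ` {..0}" if "Re (z * v) \<noteq> 0" for z v
  proof -
    have "z \<noteq> 0" using that by auto
    then have "Re (z * v / complex_of_real (cmod z)) \<noteq> 0" using that by (simp add: Re_divide_of_real)
    from square_avoids_ray[OF this] show ?thesis by (simp add: power_divide power_mult_distrib)
  qed
  note cm = maslov_continuous[OF nz]
  have "?m p * (cnj u)\<^sup>2 \<notin> complex_of_real ` {..0}" if "p \<in> topspace M" for p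
    by (rule avoid[OF re[OF that]])
  then show "zigzag_rep A f \<nu> c = 0"
    by (intro zigzag_rep_zero[OF cm maslov_map_formula(1) _ _ c, of "(cnj u)\<^sup>2"]) (use u in auto)
  have "continuous_map M euclidean (\<lambda>p. cnj (?m p))"
    using continuous_map_compose[OF cm, of euclidean cnj] continuous_on_cnj[OF continuous_on_id] by (simp add: o_def)
  then have cm': "continuous_map M euclidean (\<lambda>p. (cnj (maslov_vec p))\<^sup>2 / complex_of_real ((cmod (maslov_vec p))\<^sup>2))"
    by simp
  have re': "Re (cnj (maslov_vec p) * u) \<noteq> 0" if "p \<in> topspace M" for p
    using re[OF that] by (simp add: algebra_simps)
  have "(cnj (maslov_vec p))\<^sup>2 / complex_of_real ((cmod (maslov_vec p))\<^sup>2) * u\<^sup>2 \<notin> complex_of_real ` {..0}" if "p \<in> topspace M" for p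
    using avoid[OF re'[OF that]] by simp
  then show "zigzag_rep A \<nu> f c = 0"
    by (intro zigzag_rep_zero[OF cm' maslov_map_formula(2) _ _ c, of "u\<^sup>2"]) (use u in auto)
qed

end

subsection \<open>Fronts in hyperbolic and in de Sitter space\<close>

text \<open>\<open>front\<close> provides only local conormal fields \<open>m\<close> of arbitrary
  length. Such an \<open>m\<close> is a differentiable function times \<nu>, so dm is a multiple of
  d\<nu> plus a multiple of \<nu>. A vector killed by df and d\<nu> is thus killed by the
  differential of the Legendrian lift.\<close>

lemma (in surface) front_orthogonal_immersion:
  assumes fr: "front M A N f L" and n: "smooth_map_on A (topspace M) \<nu>" "represents (topspace M) \<nu> L"
    and unit: "\<And>p. p \<in> topspace M \<Longrightarrow> mink (\<nu> p) (\<nu> p) = e" "e \<noteq> 0" and p: "p \<in> topspace M"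
  shows "mink (f p) (\<nu> p) = 0" "mink (differential A f p X) (\<nu> p) = 0"
    "differential A f p X = 0 \<Longrightarrow> differential A \<nu> p X = 0 \<Longrightarrow> X = 0"
proof -
  obtain U m where U: "openin M U" "p \<in> U" and m: "conormal_field A U f m" "represents U m L"
    and imm: "\<forall>q\<in>U. \<forall>X. differential A f q X = 0 \<and> differential A m q X \<in> span {m q} \<longrightarrow> X = 0"
    using bspec[OF conjunct2[OF conjunct2[OF fr[unfolded front_def]]] p] by blast
  have UM: "U \<subseteq> topspace M" using U openin_subset by blast
  have sp: "span {m q} = span {\<nu> q}" if "q \<in> U" for q
    using m(2) n(2) that UM by (auto simp: represents_def)
  have "\<nu> p \<in> span {m p}" using sp[OF U(2)] span_base[of "\<nu> p" "{\<nu> p}"] by simp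
  then obtain k where k: "\<nu> p = k *\<^sub>R m p" by (auto simp: span_singleton)
  show "mink (f p) (\<nu> p) = 0" "mink (differential A f p X) (\<nu> p) = 0"
    using m(1) U(2) by (simp_all add: k conormal_field_def mink_bilinear)
  define c where "c = chart_at A p"
  have c: "c \<in> A" "p \<in> fst c" using chart_at[OF p] by (simp_all add: c_def)
  let ?i = "inv_into (fst c) (snd c)"
  have dm: "((m \<circ> ?i) has_derivative chart_diff c m p) (at (snd c p))"
    using smooth_mapD(1)[of U m] m(1) c U(2) by (simp add: conormal_field_def)
  have dn: "((\<nu> \<circ> ?i) has_derivative chart_diff c \<nu> p) (at (snd c p))"
    by (rule smooth_mapD(1)[OF n(1) c p])
  define ph where "ph x = mink ((m \<circ> ?i) x) ((\<nu> \<circ> ?i) x) / e" for x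
  have "((\<lambda>x. mink ((m \<circ> ?i) x) ((\<nu> \<circ> ?i) x)) has_derivative
      (\<lambda>v. mink ((m \<circ> ?i) (snd c p)) (chart_diff c \<nu> p v) + mink (chart_diff c m p v) ((\<nu> \<circ> ?i) (snd c p)))) (at (snd c p))"
    by (rule mink.FDERIV[OF dm dn])
  then obtain Dp where Dp: "(ph has_derivative Dp) (at (snd c p))"
    unfolding ph_def[abs_def] using has_derivative_divide[OF _ has_derivative_const unit(2)] by blast
  have mn: "m q = (mink (m q) (\<nu> q) / e) *\<^sub>R \<nu> q" if q: "q \<in> U" for q
  proof -
    have "m q \<in> span {\<nu> q}" using sp[OF q] span_base[of "m q" "{m q}"] by simp
    then obtain j where "m q = j *\<^sub>R \<nu> q" by (auto simp: span_singleton)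
    then show ?thesis using unit q UM by (auto simp: mink_bilinear)
  qed
  have op: "open (snd c ` (fst c \<inter> U))"
    by (rule open_chart_image[OF c(1)]) (use openin_Int[OF chart_open(1)[OF c(1)] U(1)] in auto)
  have "((m \<circ> ?i) has_derivative (\<lambda>v. ph (snd c p) *\<^sub>R chart_diff c \<nu> p v + Dp v *\<^sub>R (\<nu> \<circ> ?i) (snd c p))) (at (snd c p))"
  proof (rule has_derivative_transform_within_open[OF has_derivative_scaleR[OF Dp dn] op])
    show "snd c p \<in> snd c ` (fst c \<inter> U)" using c U by blast
    fix x assume "x \<in> snd c ` (fst c \<inter> U)"
    then obtain q where q: "q \<in> fst c" "q \<in> U" "x = snd c q" by blast
    then have "?i x = q" using chart_inv[OF c(1)] by simp
    then show "ph x *\<^sub>R (\<nu> \<circ> ?i) x = (m \<circ> ?i) x" using mn[OF q(2)] by (simp add: ph_def)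
  qed
  then have D: "chart_diff c m p = (\<lambda>v. ph (snd c p) *\<^sub>R chart_diff c \<nu> p v + Dp v *\<^sub>R \<nu> p)"
    using has_derivative_unique[OF dm] chart_inv[OF c] by simp
  show "X = 0" if 0: "differential A f p X = 0" "differential A \<nu> p X = 0"
  proof (rule imm[rule_format, OF U(2)], rule conjI[OF 0(1)])
    have "differential A m p X = Dp X *\<^sub>R \<nu> p"
      using 0(2) D by (simp add: differential_chart_diff c_def)
    then show "differential A m p X \<in> span {m p}" unfolding sp[OF U(2)] by (simp add: span_base span_scale)
  qed
qed

text \<open>Both orders of the pair are treated, since for fronts in de Sitter space the hyperbolic
  front is the second argument of \<open>zigzag_rep\<close>.\<close>

lemma front_conclusion:
  assumes surf: "smooth_surface M A" and conn: "connected_space M" and W: "bryant_type_H3 M A f L"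
    and n: "smooth_map_on A (topspace M) \<nu>" "represents (topspace M) \<nu> L" "\<And>p. p \<in> topspace M \<Longrightarrow> mink (\<nu> p) (\<nu> p) = 1"
    and p0: "p0 \<in> topspace M" "regular_point A f p0"
  shows "orientable_surface M A"
    "c \<in> carrier (fundamental_group M x) \<Longrightarrow> zigzag_rep A f \<nu> c = 0 \<and> zigzag_rep A \<nu> f c = 0"
proof -
  obtain \<epsilon> where e: "(f, L) \<in> W M A \<epsilon>" using W by (auto simp: bryant_type_H3_def)
  have fr: "front M A H3 f L" using e by (simp add: W_def horospherical_LW_front_def)
  interpret S: surface M A by (rule surface.intro[OF surf])
  note imm = S.front_orthogonal_immersion[OF fr n(1,2), of 1]
  interpret C: cooriented_front M A f \<nu>
  proof
    show "smooth_map_on A (topspace M) f" using fr by (simp add: front_def)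
    show "smooth_map_on A (topspace M) \<nu>" by (rule n(1))
    fix p assume p: "p \<in> topspace M"
    show "mink (f p) (f p) = - 1" using fr p by (auto simp: front_def H3_def)
    show "mink (\<nu> p) (\<nu> p) = 1" by (rule n(3)[OF p])
    show "mink (f p) (\<nu> p) = 0" using imm(1)[OF n(3) _ p] by simp
    show "mink (differential A f p X) (\<nu> p) = 0" for X using imm(2)[OF n(3) _ p] by simp
    show "X = 0" if "differential A f p X = 0" "differential A \<nu> p X = 0" for X
      using imm(3)[OF n(3) _ p that] by simp
  qed
  obtain t where t: "t = 1 \<or> t = -1" "\<And>p. p \<in> topspace M \<Longrightarrow> C.satisfies (- \<epsilon>) t p"
    by (rule C.weingarten_everywhere[OF conn e n(2) p0]) blast
  show "orientable_surface M A" by (rule C.orientable[OF t])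
  show "zigzag_rep A f \<nu> c = 0 \<and> zigzag_rep A \<nu> f c = 0" if "c \<in> carrier (fundamental_group M x)"
    using C.zigzag_trivial[OF t that] by simp
qed

lemma zigzag_rep_cong:
  assumes "\<And>p. p \<in> topspace M \<Longrightarrow> maslov_map A f \<nu> p = maslov_map A f' \<nu>' p"
    and c: "c \<in> carrier (fundamental_group M x)"
  shows "zigzag_rep A f \<nu> c = zigzag_rep A f' \<nu>' c"
proof -
  have "winding_number (maslov_map A f \<nu> \<circ> \<gamma>) 0 = winding_number (maslov_map A f' \<nu>' \<circ> \<gamma>) 0" if "\<gamma> \<in> c" for \<gamma>
  proof -
    have "c \<in> loops M x // loop_homotopy M x" using c by (simp add: fundamental_group_def)
    then have "\<gamma> \<in> loops M x" using that by (auto simp: loop_homotopy_def elim!: quotientE)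
    then have "\<gamma> s \<in> topspace M" if "s \<in> {0..1}" for s
      using that by (auto simp: loops_def pathin_def continuous_map_def Pi_iff)
    then show ?thesis
      by (intro winding_number_cong) (use assms(1) in auto)
  qed
  then show ?thesis unfolding zigzag_rep_def by (metis (no_types, lifting))
qed

theorem theorem3p9:
  fixes M :: "'a topology" and A :: "'a atlas"
    and f \<nu> :: "'a \<Rightarrow> real^4" and L :: "'a \<Rightarrow> (real^4) set"
  assumes "smooth_surface M A" and "connected_space M"
    and "(coorientable_front M A H3 f L \<and> bryant_type_H3 M A f L \<and>
            unit_normal A S31 (topspace M) f \<nu> \<and> represents (topspace M) \<nu> L \<and>
            (\<exists>p\<in>topspace M. regular_point A f p)) \<or>
         (coorientable_bryant_type_S31 M A f L \<and>
            unit_normal A H3 (topspace M) f \<nu> \<and> represents (topspace M) \<nu> L \<and>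
            (\<exists>p\<in>topspace M. regular_point A \<nu> p))"
  shows "orientable_surface M A \<and>
    (\<forall>x\<in>topspace M. \<forall>c\<in>carrier (fundamental_group M x). zigzag_rep A f \<nu> c = 0)"
  using assms(3)
proof
  assume H: "coorientable_front M A H3 f L \<and> bryant_type_H3 M A f L \<and>
            unit_normal A S31 (topspace M) f \<nu> \<and> represents (topspace M) \<nu> L \<and>
            (\<exists>p\<in>topspace M. regular_point A f p)"
  then obtain p where p: "p \<in> topspace M" "regular_point A f p" by blast
  have n: "smooth_map_on A (topspace M) \<nu>" "\<And>p. p \<in> topspace M \<Longrightarrow> mink (\<nu> p) (\<nu> p) = 1"
    using H by (auto simp: unit_normal_def conormal_field_def S31_def)
  show ?thesis
    using front_conclusion[OF assms(1,2) _ n(1) _ n(2) p] H by blast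
next
  assume H: "coorientable_bryant_type_S31 M A f L \<and>
            unit_normal A H3 (topspace M) f \<nu> \<and> represents (topspace M) \<nu> L \<and>
            (\<exists>p\<in>topspace M. regular_point A \<nu> p)"
  then obtain p0 where p0: "p0 \<in> topspace M" "regular_point A \<nu> p0" by blast
  interpret S: surface M A by (rule surface.intro[OF assms(1)])
  obtain n where n: "unit_normal A H3 (topspace M) f n" "represents (topspace M) n L"
    and B: "bryant_type_H3 M A n (\<lambda>p. span {f p})"
    using H unfolding coorientable_bryant_type_S31_def by blast
  have fr: "front M A S31 f L" using H by (simp add: coorientable_bryant_type_S31_def coorientable_front_def)
  have f: "smooth_map_on A (topspace M) f" "\<And>p. p \<in> topspace M \<Longrightarrow> mink (f p) (f p) = 1"
    using fr by (auto simp: front_def S31_def)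
  \<comment> \<open>\<open>coorientable_bryant_type_S31\<close> only asserts that some normal field
    \<open>n\<close> is of Bryant type. It coincides with the given one, because a line meets the
    upper sheet of the hyperboloid at most once.\<close>
  have eq: "\<nu> p = n p" if p: "p \<in> topspace M" for p
  proof -
    have h: "mink (\<nu> p) (\<nu> p) = -1" "mink (n p) (n p) = -1" "\<nu> p $ 0 > 0" "n p $ 0 > 0"
      using H n(1) p by (auto simp: unit_normal_def H3_def)
    have "span {\<nu> p} = span {n p}" using H n(2) p by (auto simp: represents_def)
    then have "\<nu> p = n p \<or> \<nu> p = - n p" by (rule span_unit_eq[OF _ h(1,2)]) simp
    then show ?thesis using h(3,4) by auto
  qed
  have sn: "smooth_map_on A (topspace M) n" using n(1) by (simp add: unit_normal_def conormal_field_def)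
  have d: "differential A \<nu> p = differential A n p" if p: "p \<in> topspace M" for p
    using S.differential_lincomb[OF sn p sn p, of "topspace M" \<nu> 1 0] p eq by simp
  have reg: "regular_point A n p0" using p0 d[OF p0(1)] by (simp add: regular_point_def)
  \<comment> \<open>The roles are exchanged from here on: \<open>n\<close> is the front in
    hyperbolic space and \<open>f\<close> is its unit normal.\<close>
  have rep: "represents (topspace M) f (\<lambda>p. span {f p})" by (simp add: represents_def)
  have "maslov_map A f \<nu> p = maslov_map A f n p" if p: "p \<in> topspace M" for p
    by (simp add: maslov_map_def maslov_det_def normal_plane_def d[OF p] eq[OF p])
  then have "zigzag_rep A f \<nu> c = zigzag_rep A f n c" if "c \<in> carrier (fundamental_group M x)" for c x
    using zigzag_rep_cong[OF _ that] by blast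
  then show ?thesis
    using front_conclusion[OF assms(1,2) B f(1) rep f(2) p0(1) reg] by simp
qed

end
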